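(* There exists an absolute constant $C>0$ (independent of the dimension $n$, of $j$, of $\lambda$ and of $f$) such that for every $n\ge 1$, every $j\in\{1,\dots,n\}$, every $\lambda>0$ and every $f\in L^1(\mathbb{R}^n)$, \[ |\{x\in\mathbb{R}^n:|R_jf(x)|>\lambda\}|\le C\left(\frac{1}{\lambda}\|f\|_{L^1(\mathbb{R}^n)}+\sup_{\nu}|\{x\in\mathbb{R}^n:|R_j\nu(x)|>\lambda\}|\right), \] where the supremum is taken over all measures of the form $\nu=\sum_{k=1}^N a_k\delta_{c_k}$ with $N\in\mathbb{N}$, $c_k\in\mathbb{R}^n$, $a_k\in\mathbb{R}^+$ and $\sum_{k=1}^N a_k\le 16\|f\|_{L^1(\mathbb{R}^n)}$.
   Context: For $j\in\{1,\dots,n\}$, the $j$-th Riesz transform is defined for $f\in C_c^\infty(\mathbb{R}^n)$ by $R_jf(x)=\frac{\Gamma(\frac{n+1}{2})}{\pi^{\frac{n+1}{2}}}\,\mathrm{p.v.}\int\frac{x_j-y_j}{|x-y|^{n+1}}f(y)\,dy$ (principal value $=\lim_{\varepsilon\to0}$ of the integral over $|x-y|\ge\varepsilon$), and extended to $L^1(\mathbb{R}^n)$ in the standard way (it maps $L^1$ into weak $L^1$). For a finite Borel measure $\nu$, $R_j\nu(x)=\frac{\Gamma(\frac{n+1}{2})}{\pi^{\frac{n+1}{2}}}\,\mathrm{p.v.}\int\frac{x_j-y_j}{|x-y|^{n+1}}\,d\nu(y)$; for $\nu$ a finite sum of Dirac masses this is defined away from the points $c_k$. $|\cdot|$ denotes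 Lebesgue measure and $\delta_c$ the Dirac mass at $c$. *)

theory Defs
  imports "HOL-Analysis.Analysis"
begin

text \<open>Points of R^n are modelled as functions x :: nat => real, extensional on {..<n}
  (coordinates x 0, ..., x (n-1)).  Lebesgue measure on R^n is the completion of the
  n-fold product of the Borel-Lebesgue measure on the reals.\<close>

definition Leb :: "nat \<Rightarrow> (nat \<Rightarrow> real) measure" where
  "Leb n = completion (PiM {..<n} (\<lambda>_. lborel))"

definition eucl_norm :: "nat \<Rightarrow> (nat \<Rightarrow> real) \<Rightarrow> real" where
  "eucl_norm n x = sqrt (\<Sum>i<n. (x i)\<^sup>2)"

definition riesz_const :: "nat \<Rightarrow> real" where
  "riesz_const n = Gamma (real (n + 1) / 2) / pi powr (real (n + 1) / 2)"

definition riesz_kernel :: "nat \<Rightarrow> nat \<Rightarrow> (nat \<Rightarrow> real) \<Rightarrow> real" where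
  "riesz_kernel n j z = riesz_const n * z j / (eucl_norm n z) ^ (n + 1)"

definition riesz_trunc :: "nat \<Rightarrow> nat \<Rightarrow> ((nat \<Rightarrow> real) \<Rightarrow> real) \<Rightarrow> real \<Rightarrow> (nat \<Rightarrow> real) \<Rightarrow> real" where
  "riesz_trunc n j f eps x =
     (LINT y|Leb n. indicator {y. eucl_norm n (\<lambda>i. x i - y i) \<ge> eps} y
                     * riesz_kernel n j (\<lambda>i. x i - y i) * f y)"

text \<open>Riesz transform of an L^1 function as the principal value (limit eps -> 0+).
  For f in L^1 this limit exists a.e. and agrees a.e. with the standard extension.\<close>
definition riesz :: "nat \<Rightarrow> nat \<Rightarrow> ((nat \<Rightarrow> real) \<Rightarrow> real) \<Rightarrow> (nat \<Rightarrow> real) \<Rightarrow> real" where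
  "riesz n j f x = Lim (at_right 0) (\<lambda>eps. riesz_trunc n j f eps x)"

text \<open>Riesz transform of nu = sum_{k<N} a_k delta_{c_k}, defined away from the c_k.\<close>
definition riesz_dirac :: "nat \<Rightarrow> nat \<Rightarrow> nat \<Rightarrow> (nat \<Rightarrow> real) \<Rightarrow> (nat \<Rightarrow> nat \<Rightarrow> real)
    \<Rightarrow> (nat \<Rightarrow> real) \<Rightarrow> real" where
  "riesz_dirac n j N a c x = (\<Sum>k<N. a k * riesz_kernel n j (\<lambda>i. x i - c k i))"

definition L1_norm :: "nat \<Rightarrow> ((nat \<Rightarrow> real) \<Rightarrow> real) \<Rightarrow> real" where
  "L1_norm n f = (LINT x|Leb n. \<bar>f x\<bar>)"

end

theory Submission
  imports Defs "HOL-Probability.Probability"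
begin

text \<open>
  The dimension-free input is an \<open>L\<^sup>2\<close> bound, obtained by the method of rotations: Gaussian
  subordination writes the conjugate Poisson operators as Gaussian averages over directions \<open>u\<close> of
  truncated Hilbert transforms along \<open>u\<close>, whose \<open>L\<^sup>2\<close> norms do not see the dimension. To prove the
  weak type bound at height \<open>lam\<close>, approximate \<open>f\<close> in \<open>L\<^sup>1\<close> by a step function \<open>F\<close> on a grid of cubes
  and cut \<open>F\<close> at the levels \<open>lam\<close> and \<open>- lam\<close>. The bounded part is controlled by Chebyshev's inequality
  and the \<open>L\<^sup>2\<close> bound. The support of each of the two high parts has measure at most
  \<open>2 \<parallel>f\<parallel>\<^sub>1 / lam\<close>; after discarding the enlargement of its cubes by the factor \<open>1 + 1 / n\<close>, which
  multiplies the measure by at most \<open>e\<close>, the high part can be replaced by Dirac masses on an extremely fine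
  grid, with an error that is as small as we like. No cancellation and no doubling are needed here, so
  no constant depends on the dimension.

  The approximation of \<open>f\<close> by \<open>F\<close> and the existence of the principal value almost everywhere only need
  a weak type bound for the maximal truncation with a constant that may depend on \<open>n\<close>, since
  \<open>F\<close> may be chosen after that constant. It comes from a Calderon-Zygmund decomposition and from
  Cotlar's inequality.
\<close>

section \<open>One-dimensional kernels\<close>

text \<open>The number 16 is a budget. The approximation error gets \<open>lam / 2\<close>, the
  bounded part \<open>lam / 8\<close>, each high part \<open>3 * lam / 16\<close>. The supremum over
  Dirac masses is available at height \<open>lam\<close> only, so by linearity the atoms carry 8
  times the mass of the high part: off their level set the unscaled sum is at most
  \<open>lam / 8\<close>, and \<open>lam / 16\<close> is left for discretization. As
  \<open>F\<close> has norm at most twice that of \<open>f\<close>, the total mass is at most 16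
  times the norm of \<open>f\<close>. The two signs are treated separately because the atoms must
  have positive weights. The obstacle is that smoothness of the kernel, doubling, and the comparison
  of hard truncations with conjugate Poisson kernels cost factors exponential in \<open>n\<close>.
  So the L^2 bound is proved for conjugate Poisson kernels and passed directly to principal values
  of step functions by Fatou's lemma, without hard truncations. It is free of the dimension because
  a Gaussian factors over the coordinates, and in the average over directions only the factor of
  coordinate \<open>j\<close> differs from 1.\<close>

lemma tendsto_arctan_div_at_top: "c > 0 \<Longrightarrow> ((\<lambda>x. arctan ((x - r) / c)) \<longlongrightarrow> pi / 2) at_top"
proof -
  assume c: "c > 0"
  have "filterlim (\<lambda>x. (x - r) / c) at_top at_top"
    using c by real_asymp
  then show ?thesis by (rule filterlim_compose[OF tendsto_arctan_at_top])
qed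

lemma tendsto_arctan_div_at_bot: "c > 0 \<Longrightarrow> ((\<lambda>x. arctan ((x - r) / c)) \<longlongrightarrow> - pi / 2) at_bot"
proof -
  assume c: "c > 0"
  have "filterlim (\<lambda>x. (x - r) / c) at_bot at_bot"
    using c by real_asymp
  then show ?thesis using filterlim_compose[OF tendsto_arctan_at_bot] by simp
qed

lemma integral_FTC_real_line:
  fixes f F :: "real \<Rightarrow> real"
  assumes F: "\<And>x. DERIV F x :> f x" and f: "\<And>x. isCont f x" and int: "integrable lborel f"
    and A: "(F \<longlongrightarrow> A) at_bot" and B: "(F \<longlongrightarrow> B) at_top"
  shows "(\<integral>x. f x \<partial>lborel) = B - A"
proof -
  have "(LBINT x=-\<infinity>..\<infinity>. f x) = B - A"
  proof (rule interval_integral_FTC_integrable)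
    show "set_integrable lborel (einterval (-\<infinity>) \<infinity>) f"
      using int by (simp add: set_integrable_def)
  qed (use F f A B in \<open>auto simp: ereal_tendsto_simps has_real_derivative_iff_has_vector_derivative\<close>)
  then show ?thesis by (simp add: interval_lebesgue_integral_def set_lebesgue_integral_def)
qed

lemma has_bochner_integral_Cauchy_density:
  assumes c: "c > (0::real)"
  shows "has_bochner_integral lborel (\<lambda>x. c / (x\<^sup>2 + c\<^sup>2)) pi"
proof -
  have ne: "x\<^sup>2 + c\<^sup>2 \<noteq> 0" for x using c by (simp add: sum_power2_eq_zero_iff)
  have D: "DERIV (\<lambda>x. arctan (x / c)) x :> c / (x\<^sup>2 + c\<^sup>2)" for x
    using c ne[of x] by (auto intro!: derivative_eq_intros simp: field_simps power2_eq_square)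
  have int: "set_integrable lborel (einterval (-\<infinity>) \<infinity>) (\<lambda>x. c / (x\<^sup>2 + c\<^sup>2))"
   by (rule interval_integral_FTC_nonneg(1)[where F="\<lambda>x. arctan (x / c)" and A="-pi/2" and B="pi/2"])
      (use c ne D tendsto_arctan_div_at_top[of c 0] tendsto_arctan_div_at_bot[of c 0] in \<open>auto simp: ereal_tendsto_simps\<close>)
  then have int': "integrable lborel (\<lambda>x. c / (x\<^sup>2 + c\<^sup>2))" by (simp add: set_integrable_def)
  have "(\<integral>x. c / (x\<^sup>2 + c\<^sup>2) \<partial>lborel) = pi/2 - (-pi/2)"
    by (rule integral_FTC_real_line[where F="\<lambda>x. arctan (x / c)"])
      (use c ne D int' tendsto_arctan_div_at_top[of c 0] tendsto_arctan_div_at_bot[of c 0] in auto)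
  with int' show ?thesis by (simp add: has_bochner_integral_iff)
qed

lemma has_bochner_integral_Cauchy_density_shift:
  assumes c: "c > (0::real)"
  shows "has_bochner_integral lborel (\<lambda>x. c / ((x - r)\<^sup>2 + c\<^sup>2)) pi"
  using has_bochner_integral_Cauchy_density[OF c]
    lborel_has_bochner_integral_real_affine_iff[of 1 "\<lambda>x. c / (x\<^sup>2 + c\<^sup>2)" pi "-r"]
  by (simp add: algebra_simps)

text \<open>The conjugate Poisson kernel of the half-plane at height \<open>a\<close>, up to the
  factor 1/pi: a smooth substitute for the Hilbert kernel 1/t whose autocorrelations can be
  computed.\<close>

definition conj_pois :: "real \<Rightarrow> real \<Rightarrow> real" where
  "conj_pois a t = t / (t\<^sup>2 + a\<^sup>2)"

lemma borel_measurable_conj_pois [measurable]: "conj_pois a \<in> borel_measurable borel"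
  unfolding conj_pois_def by measurable

lemma conj_pois_square_le:
  assumes "a > 0" shows "(conj_pois a t)\<^sup>2 \<le> 1 / (t\<^sup>2 + a\<^sup>2)"
proof -
  have p: "t\<^sup>2 + a\<^sup>2 > 0" using assms by (simp add: add_nonneg_pos)
  have "(conj_pois a t)\<^sup>2 = (t\<^sup>2 / (t\<^sup>2 + a\<^sup>2)) * (1 / (t\<^sup>2 + a\<^sup>2))"
    unfolding conj_pois_def by (simp add: power2_eq_square)
  also have "\<dots> \<le> 1 * (1 / (t\<^sup>2 + a\<^sup>2))"
    by (rule mult_right_mono) (use p in auto)
  finally show ?thesis by simp
qed

text \<open>Each factor decays only like 1/t; the product is dominated by the sum of the two
  squares, which are bounded by multiples of Cauchy densities.\<close>

lemma integrable_conj_pois_mult: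
  assumes a: "a > 0" and b: "b > 0"
  shows "integrable lborel (\<lambda>t. conj_pois a t * conj_pois b (t - r))"
proof (rule Bochner_Integration.integrable_bound)
  show "integrable lborel (\<lambda>t. (1/a) * (a / (t\<^sup>2 + a\<^sup>2)) + (1/b) * (b / ((t - r)\<^sup>2 + b\<^sup>2)))"
    using has_bochner_integral_Cauchy_density[OF a] has_bochner_integral_Cauchy_density_shift[OF b]
    by (intro Bochner_Integration.integrable_add integrable_mult_right) (auto simp: has_bochner_integral_iff)
  show "AE t in lborel. norm (conj_pois a t * conj_pois b (t - r))
      \<le> norm ((1/a) * (a / (t\<^sup>2 + a\<^sup>2)) + (1/b) * (b / ((t - r)\<^sup>2 + b\<^sup>2)))"
  proof (rule AE_I2)
    fix t
    let ?x = "conj_pois a t" and ?y = "conj_pois b (t - r)"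
    have "0 \<le> (\<bar>?x\<bar> - \<bar>?y\<bar>)\<^sup>2" by simp
    then have "2 * (\<bar>?x\<bar> * \<bar>?y\<bar>) \<le> ?x\<^sup>2 + ?y\<^sup>2" by (simp add: power2_diff)
    moreover have "0 \<le> \<bar>?x\<bar> * \<bar>?y\<bar>" by simp
    ultimately have "\<bar>?x * ?y\<bar> \<le> ?x\<^sup>2 + ?y\<^sup>2" unfolding abs_mult by linarith
    also have "\<dots> \<le> 1 / (t\<^sup>2 + a\<^sup>2) + 1 / ((t - r)\<^sup>2 + b\<^sup>2)"
      by (intro add_mono conj_pois_square_le a b)
    also have "\<dots> = (1/a) * (a / (t\<^sup>2 + a\<^sup>2)) + (1/b) * (b / ((t - r)\<^sup>2 + b\<^sup>2))" using a b by simp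
    finally show "norm (?x * ?y) \<le> norm ((1/a) * (a / (t\<^sup>2 + a\<^sup>2)) + (1/b) * (b / ((t - r)\<^sup>2 + b\<^sup>2)))"
      unfolding real_norm_def by linarith
  qed
qed simp

text \<open>The coefficients of the partial fraction decomposition come from the residues of the
  integrand at \<open>i a\<close> and \<open>r + i b\<close>.\<close>
lemma integral_conj_pois_mult:
  assumes a: "a > 0" and b: "b > 0" and r: "r \<noteq> 0"
  shows "(\<integral>t. conj_pois a t * conj_pois b (t - r) \<partial>lborel) = pi * ((a + b) / (r\<^sup>2 + (a + b)\<^sup>2))"
proof -
  \<comment> \<open>\<open>\<Delta>\<close> is the product of the squared distances from
    \<open>i a\<close> to \<open>r - i b\<close> and \<open>r + i b\<close>. For
    \<open>a = b\<close> it is positive only because \<open>r\<close> is nonzero.\<close>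
  define \<Delta> where "\<Delta> = ((a + b)\<^sup>2 + r\<^sup>2) * ((a - b)\<^sup>2 + r\<^sup>2)"
  have r2: "r\<^sup>2 > 0" using r by simp
  have \<Delta>: "\<Delta> > 0" unfolding \<Delta>_def using r2 by (intro mult_pos_pos add_nonneg_pos) auto
  define C where "C = - r * (r\<^sup>2 + a\<^sup>2 + b\<^sup>2) / \<Delta>"
  define D where "D = a\<^sup>2 * (r\<^sup>2 + a\<^sup>2 - b\<^sup>2) / \<Delta>"
  define E where "E = b\<^sup>2 * (r\<^sup>2 + b\<^sup>2 - a\<^sup>2) / \<Delta>"
  let ?u = "\<lambda>t. t\<^sup>2 + a\<^sup>2" and ?v = "\<lambda>t. (t - r)\<^sup>2 + b\<^sup>2"
  have u: "?u t > 0" and v: "?v t > 0" for t using a b by (auto intro!: add_nonneg_pos)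
  define F where "F t = C / 2 * ln (?u t / ?v t) + (D / a) * arctan (t / a) + (E / b) * arctan ((t - r) / b)" for t
  have poly: "t * (t - r) * \<Delta> = ((C * \<Delta>) * t + D * \<Delta>) * ?v t + (- (C * \<Delta>) * (t - r) + E * \<Delta>) * ?u t" for t
  proof -
    have "C * \<Delta> = - r * (r\<^sup>2 + a\<^sup>2 + b\<^sup>2)" "D * \<Delta> = a\<^sup>2 * (r\<^sup>2 + a\<^sup>2 - b\<^sup>2)" "E * \<Delta> = b\<^sup>2 * (r\<^sup>2 + b\<^sup>2 - a\<^sup>2)"
      unfolding C_def D_def E_def using \<Delta> by simp_all
    then show ?thesis unfolding \<Delta>_def by (simp only: power2_eq_square) (simp add: algebra_simps)
  qed
  have id: "conj_pois a t * conj_pois b (t - r) = (C * t + D) / ?u t + (- C * (t - r) + E) / ?v t" for t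
  proof -
    have "t * (t - r) = (C * t + D) * ?v t + (- C * (t - r) + E) * ?u t"
    proof -
      have "\<Delta> * (t * (t - r)) = \<Delta> * ((C * t + D) * ?v t + (- C * (t - r) + E) * ?u t)"
        using poly[of t] by (simp add: algebra_simps)
      then show ?thesis using \<Delta> by simp
    qed
    then show ?thesis using u[of t] v[of t] unfolding conj_pois_def
      by (subst add_frac_eq) (auto simp: algebra_simps)
  qed
  have DF: "DERIV F t :> conj_pois a t * conj_pois b (t - r)" for t
  proof -
    have d1: "DERIV (\<lambda>t. ln (?u t / ?v t)) t :> 2 * t / ?u t - 2 * (t - r) / ?v t"
    proof -
      have "DERIV (\<lambda>t. ln (?u t) - ln (?v t)) t :> 2 * t / ?u t - 2 * (t - r) / ?v t"
        using u[of t] v[of t] by (auto intro!: derivative_eq_intros)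
      moreover have "(\<lambda>t. ln (?u t / ?v t)) = (\<lambda>t. ln (?u t) - ln (?v t))"
        using u v by (intro ext ln_divide_pos)
      ultimately show ?thesis by simp
    qed
    have d2: "DERIV (\<lambda>t. arctan (t / a)) t :> a / ?u t"
      using a u[of t] by (auto intro!: derivative_eq_intros simp: field_simps power2_eq_square)
    have d3: "DERIV (\<lambda>t. arctan ((t - r) / b)) t :> b / ?v t"
      using b v[of t] by (auto intro!: derivative_eq_intros simp: field_simps power2_eq_square)
    have "DERIV F t :> C / 2 * (2 * t / ?u t - 2 * (t - r) / ?v t) + (D / a) * (a / ?u t) + (E / b) * (b / ?v t)"
      unfolding F_def by (intro DERIV_add DERIV_cmult d1 d2 d3)
    also have "C / 2 * (2 * t / ?u t - 2 * (t - r) / ?v t) + (D / a) * (a / ?u t) + (E / b) * (b / ?v t)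
        = conj_pois a t * conj_pois b (t - r)"
      unfolding id using a b by (simp add: add_divide_distrib diff_divide_distrib algebra_simps)
    finally show ?thesis .
  qed
  \<comment> \<open>The opposite coefficients \<open>C\<close> and \<open>- C\<close> give the
    logarithm of a quotient that tends to 1 at both ends, so only the arctangents contribute to the
    integral.\<close>
  have lim_log: "((\<lambda>t. ln (?u t / ?v t)) \<longlongrightarrow> 0) at_top" "((\<lambda>t. ln (?u t / ?v t)) \<longlongrightarrow> 0) at_bot"
  proof -
    have "((\<lambda>t. ?u t / ?v t) \<longlongrightarrow> 1) at_top" "((\<lambda>t. ?u t / ?v t) \<longlongrightarrow> 1) at_bot" by real_asymp+
    from this[THEN tendsto_ln] show "((\<lambda>t. ln (?u t / ?v t)) \<longlongrightarrow> 0) at_top" "((\<lambda>t. ln (?u t / ?v t)) \<longlongrightarrow> 0) at_bot" by simp_all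
  qed
  have cont: "isCont (\<lambda>t. conj_pois a t * conj_pois b (t - r)) t" for t
    unfolding conj_pois_def using u[of t] v[of t] by (intro continuous_intros) auto
  have "(\<integral>t. conj_pois a t * conj_pois b (t - r) \<partial>lborel) =
     (C / 2 * 0 + (D / a) * (pi / 2) + (E / b) * (pi / 2)) - (C / 2 * 0 + (D / a) * (- pi / 2) + (E / b) * (- pi / 2))"
  proof (rule integral_FTC_real_line[where F=F])
    show "(F \<longlongrightarrow> C / 2 * 0 + (D / a) * (- pi / 2) + (E / b) * (- pi / 2)) at_bot"
      unfolding F_def using tendsto_arctan_div_at_bot[OF a, of 0] tendsto_arctan_div_at_bot[OF b, of r]
      by (intro tendsto_intros lim_log) auto
    show "(F \<longlongrightarrow> C / 2 * 0 + (D / a) * (pi / 2) + (E / b) * (pi / 2)) at_top"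
      unfolding F_def using tendsto_arctan_div_at_top[OF a, of 0] tendsto_arctan_div_at_top[OF b, of r]
      by (intro tendsto_intros lim_log) auto
  qed (use DF cont integrable_conj_pois_mult[OF a b] in auto)
  also have "\<dots> = pi * (D / a + E / b)" by (simp add: field_simps)
  also have "D / a + E / b = (a + b) / (r\<^sup>2 + (a + b)\<^sup>2)"
  proof -
    have "D / a + E / b = (a * (r\<^sup>2 + a\<^sup>2 - b\<^sup>2) + b * (r\<^sup>2 + b\<^sup>2 - a\<^sup>2)) / \<Delta>"
      unfolding D_def E_def using a b by (simp add: power2_eq_square add_divide_distrib)
    also have "a * (r\<^sup>2 + a\<^sup>2 - b\<^sup>2) + b * (r\<^sup>2 + b\<^sup>2 - a\<^sup>2) = (a + b) * ((a - b)\<^sup>2 + r\<^sup>2)"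
      by (simp add: algebra_simps power2_eq_square)
    also have "\<dots> / \<Delta> = (a + b) / ((a + b)\<^sup>2 + r\<^sup>2)"
    proof -
      have "(a - b)\<^sup>2 + r\<^sup>2 > 0" using r2 by (intro add_nonneg_pos) auto
      then show ?thesis unfolding \<Delta>_def by (intro mult_divide_mult_cancel_right less_imp_neq[THEN not_sym])
    qed
    finally show ?thesis by (simp add: add.commute)
  qed
  finally show ?thesis .
qed

text \<open>By bilinearity the autocorrelation is a signed sum of four Poisson kernels. Each has
  total mass pi^2 at every height, so the bound does not see \<open>a\<close> and \<open>b\<close>;
  this is where uniformity in the truncation parameters comes from.\<close>

lemma nn_integral_autocorrelation_conj_pois_diff:
  assumes a: "0 < a" and b: "0 < b"
  shows "(\<integral>\<^sup>+r. ennreal \<bar>\<integral>t. (conj_pois a t - conj_pois b t) * (conj_pois a (t - r) - conj_pois b (t - r)) \<partial>lborel\<bar> \<partial>lborel)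
     \<le> ennreal (4 * pi\<^sup>2)"
proof -
  let ?J = "\<lambda>c r. pi * (c / (r\<^sup>2 + c\<^sup>2)) :: real"
  have J: "(\<integral>\<^sup>+r. ennreal (?J c r) \<partial>lborel) = ennreal (pi\<^sup>2)" if "c > 0" for c
    using has_bochner_integral_mult_right[OF has_bochner_integral_Cauchy_density[OF that], of pi] that
    by (subst nn_integral_eq_integral) (auto simp: has_bochner_integral_iff power2_eq_square)
  have J0: "?J c r \<ge> 0" if "c > 0" for c r using that by simp
  have "(\<integral>\<^sup>+r. ennreal \<bar>\<integral>t. (conj_pois a t - conj_pois b t) * (conj_pois a (t - r) - conj_pois b (t - r)) \<partial>lborel\<bar> \<partial>lborel)
     \<le> (\<integral>\<^sup>+r. ennreal (?J (a+a) r) + ennreal (?J (a+b) r) + ennreal (?J (b+a) r) + ennreal (?J (b+b) r) \<partial>lborel)"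
  proof (rule nn_integral_mono_AE)
    have "AE r in lborel. r \<noteq> (0::real)" by (rule AE_lborel_singleton)
    then show "AE r in lborel. ennreal \<bar>\<integral>t. (conj_pois a t - conj_pois b t) * (conj_pois a (t - r) - conj_pois b (t - r)) \<partial>lborel\<bar>
      \<le> ennreal (?J (a+a) r) + ennreal (?J (a+b) r) + ennreal (?J (b+a) r) + ennreal (?J (b+b) r)"
    proof eventually_elim
      case (elim r)
      note I = integrable_conj_pois_mult
      have "(\<integral>t. (conj_pois a t - conj_pois b t) * (conj_pois a (t - r) - conj_pois b (t - r)) \<partial>lborel)
        = (\<integral>t. conj_pois a t * conj_pois a (t - r) - conj_pois a t * conj_pois b (t - r)
               - conj_pois b t * conj_pois a (t - r) + conj_pois b t * conj_pois b (t - r) \<partial>lborel)"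
        by (rule Bochner_Integration.integral_cong) (auto simp: algebra_simps)
      also have "\<dots> = ?J (a+a) r - ?J (a+b) r - ?J (b+a) r + ?J (b+b) r"
        using I[OF a a, of r] I[OF a b, of r] I[OF b a, of r] I[OF b b, of r] elim
        by (simp add: integral_conj_pois_mult a b del: ennreal_plus)
      finally have "\<bar>\<integral>t. (conj_pois a t - conj_pois b t) * (conj_pois a (t - r) - conj_pois b (t - r)) \<partial>lborel\<bar>
         \<le> ?J (a+a) r + ?J (a+b) r + ?J (b+a) r + ?J (b+b) r"
        using J0[of "a+a" r] J0[of "a+b" r] J0[of "b+a" r] J0[of "b+b" r] a b by linarith
      then show ?case
        using J0[of "a+a" r] J0[of "a+b" r] J0[of "b+a" r] J0[of "b+b" r] a b
        by (simp add: ennreal_leI flip: ennreal_plus)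
    qed
  qed
  also have "\<dots> = ennreal (pi\<^sup>2) + ennreal (pi\<^sup>2) + ennreal (pi\<^sup>2) + ennreal (pi\<^sup>2)"
  proof -
    have "a + a > 0" "a + b > 0" "b + a > 0" "b + b > 0" using a b by auto
    note J' = this[THEN J]
    have "(\<integral>\<^sup>+r. ennreal (?J (a+a) r) + ennreal (?J (a+b) r) + ennreal (?J (b+a) r) + ennreal (?J (b+b) r) \<partial>lborel)
      = (\<integral>\<^sup>+r. ennreal (?J (a+a) r) \<partial>lborel) + (\<integral>\<^sup>+r. ennreal (?J (a+b) r) \<partial>lborel)
        + (\<integral>\<^sup>+r. ennreal (?J (b+a) r) \<partial>lborel) + (\<integral>\<^sup>+r. ennreal (?J (b+b) r) \<partial>lborel)"
      by (simp add: nn_integral_add)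
    then show ?thesis by (simp only: J')
  qed
  also have "\<dots> = ennreal (4 * pi\<^sup>2)" by (simp flip: ennreal_plus)
  finally show ?thesis .
qed

text \<open>The tails 1/t cancel. A single \<open>conj_pois a\<close> is not integrable, which is
  why differences of two heights appear throughout the rotation argument.\<close>

lemma integrable_conj_pois_diff:
  assumes a: "0 < a" and b: "0 < b"
  shows "integrable lborel (\<lambda>t. conj_pois a t - conj_pois b t)"
proof (rule Bochner_Integration.integrable_bound)
  show "integrable lborel (\<lambda>t. (\<bar>b\<^sup>2 - a\<^sup>2\<bar> / (2 * a * b)) * (b / (t\<^sup>2 + b\<^sup>2)))"
    using has_bochner_integral_Cauchy_density[OF b] by (intro integrable_mult_right) (simp add: has_bochner_integral_iff)
  show "AE t in lborel. norm (conj_pois a t - conj_pois b t) \<le> norm ((\<bar>b\<^sup>2 - a\<^sup>2\<bar> / (2 * a * b)) * (b / (t\<^sup>2 + b\<^sup>2)))"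
  proof (rule AE_I2)
    fix t
    have u: "t\<^sup>2 + a\<^sup>2 > 0" and v: "t\<^sup>2 + b\<^sup>2 > 0" using a b by (auto intro!: add_nonneg_pos)
    have "conj_pois a t - conj_pois b t = (t / (t\<^sup>2 + a\<^sup>2)) * ((b\<^sup>2 - a\<^sup>2) / (t\<^sup>2 + b\<^sup>2))"
    proof -
      have "t / p - t / q = (t / p) * ((q - p) / q)" if "p > 0" "q > 0" for p q :: real
        using that by (simp add: field_simps)
      from this[OF u v] show ?thesis unfolding conj_pois_def by simp
    qed
    moreover have "\<bar>t / (t\<^sup>2 + a\<^sup>2)\<bar> \<le> 1 / (2 * a)"
    proof -
      have "0 \<le> (\<bar>t\<bar> - a)\<^sup>2" by simp
      then have "2 * a * \<bar>t\<bar> \<le> t\<^sup>2 + a\<^sup>2" by (simp add: power2_diff mult_ac)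
      then show ?thesis using u a by (simp add: field_simps abs_divide)
    qed
    ultimately have "\<bar>conj_pois a t - conj_pois b t\<bar> \<le> 1 / (2 * a) * \<bar>(b\<^sup>2 - a\<^sup>2) / (t\<^sup>2 + b\<^sup>2)\<bar>"
      by (simp only: abs_mult) (rule mult_right_mono, auto)
    also have "\<dots> = (\<bar>b\<^sup>2 - a\<^sup>2\<bar> / (2 * a * b)) * (b / (t\<^sup>2 + b\<^sup>2))" using a b v by (simp add: abs_divide)
    finally show "norm (conj_pois a t - conj_pois b t) \<le> norm ((\<bar>b\<^sup>2 - a\<^sup>2\<bar> / (2 * a * b)) * (b / (t\<^sup>2 + b\<^sup>2)))"
      unfolding real_norm_def by linarith
  qed
qed simp

text \<open>The cutoff of 1/t at scale \<open>a\<close> that Gaussian subordination produces. At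
  \<open>t = 0\<close> its value is 0 by the convention on division.\<close>

definition gauss_cut :: "real \<Rightarrow> real \<Rightarrow> real" where
  "gauss_cut a t = exp (- (pi * a\<^sup>2 / t\<^sup>2)) / t"

lemma borel_measurable_gauss_cut [measurable]: "gauss_cut a \<in> borel_measurable borel"
  unfolding gauss_cut_def by measurable

text \<open>With \<open>v = a^2 / t^2\<close> the claim becomes a bound for 1 - exp (- pi v) (1 + v)
  by pi sqrt v. The right-hand side has integral pi^2 for every \<open>a\<close>, so replacing one
  cutoff by the other costs a convolution with a kernel of fixed L^1 norm.\<close>

lemma gauss_cut_minus_conj_pois_le:
  assumes a: "a > 0"
  shows "\<bar>gauss_cut a t - conj_pois a t\<bar> \<le> pi * (a / (t\<^sup>2 + a\<^sup>2))"
proof (cases "t = 0")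
  case True then show ?thesis using a by (simp add: gauss_cut_def conj_pois_def)
next
  case False
  define v where "v = a\<^sup>2 / t\<^sup>2"
  have v: "v > 0" unfolding v_def using a False by simp
  have sv: "sqrt v = a / \<bar>t\<bar>" unfolding v_def using a by (simp add: real_sqrt_divide)
  have eq: "\<bar>gauss_cut a t - conj_pois a t\<bar> = (1 / \<bar>t\<bar>) * (\<bar>exp (- (pi * v)) * (1 + v) - 1\<bar> / (1 + v))"
  proof -
    have "1 + v = (t\<^sup>2 + a\<^sup>2) / t\<^sup>2" unfolding v_def using False by (simp add: field_simps)
    then have "conj_pois a t = (1 / t) * (1 / (1 + v))"
      unfolding conj_pois_def using False by (simp add: power2_eq_square)
    moreover have "gauss_cut a t = (1 / t) * exp (- (pi * v))" unfolding gauss_cut_def v_def by simp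
    ultimately have "gauss_cut a t - conj_pois a t = (1 / t) * ((exp (- (pi * v)) * (1 + v) - 1) / (1 + v))"
      using v by (simp add: diff_divide_distrib right_diff_distrib)
    then show ?thesis using v by (simp add: abs_mult abs_divide)
  qed
  have e1: "exp (- (pi * v)) * (1 + v) \<le> 1"
  proof -
    have "1 + v \<le> 1 + pi * v" using v pi_gt3 by simp
    also have "\<dots> \<le> exp (pi * v)" using exp_ge_add_one_self[of "pi * v"] by simp
    finally have "exp (- (pi * v)) * (1 + v) \<le> exp (- (pi * v)) * exp (pi * v)" by (intro mult_left_mono) auto
    then show ?thesis by (simp flip: exp_add)
  qed
  \<comment> \<open>For small \<open>v\<close> the left side is at most pi v, and v is at most sqrt
    v. For large \<open>v\<close> it is below 1, and pi sqrt v exceeds 1.\<close>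
  have e2: "1 - exp (- (pi * v)) * (1 + v) \<le> pi * sqrt v"
  proof (cases "v \<le> 1")
    case True
    have "exp (- (pi * v)) \<ge> 1 - pi * v" using exp_ge_add_one_self[of "- (pi * v)"] by simp
    moreover have "exp (- (pi * v)) * (1 + v) \<ge> exp (- (pi * v))" using v by simp
    ultimately have "1 - exp (- (pi * v)) * (1 + v) \<le> pi * v" by linarith
    also have "v \<le> sqrt v" using True v by (simp add: real_le_rsqrt power2_eq_square mult_left_le)
    finally show ?thesis by simp
  next
    case False
    then have "1 \<le> sqrt v" by simp
    then have "1 \<le> pi * sqrt v" using pi_gt3 by (metis less_eq_real_def mult_le_cancel_right1 mult_mono mult_1 pi_ge_two one_le_numeral order_trans zero_le_one)
    then show ?thesis using v by (smt (verit) exp_gt_zero mult_pos_pos)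
  qed
  have "\<bar>gauss_cut a t - conj_pois a t\<bar> \<le> (1 / \<bar>t\<bar>) * (pi * sqrt v / (1 + v))"
    unfolding eq using e1 e2 v by (intro mult_left_mono divide_right_mono) auto
  also have "\<dots> = pi * (a / (t\<^sup>2 + a\<^sup>2))"
  proof -
    have "1 + v = (t\<^sup>2 + a\<^sup>2) / t\<^sup>2" unfolding v_def using False by (simp add: field_simps)
    then show ?thesis unfolding sv using False by (simp add: power2_eq_square field_simps)
  qed
  finally show ?thesis .
qed

text \<open>Substitute \<open>v = a / t\<^sup>2\<close> in the Gamma integral.\<close>
lemma nn_integral_exp_inverse_square:
  assumes a: "a > 0"
  shows "(\<integral>\<^sup>+t. ennreal (exp (- (a / t\<^sup>2)) / \<bar>t\<bar> ^ (m + 2)) \<partial>lborel)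
     = ennreal (Gamma ((real m + 1) / 2) / a powr ((real m + 1) / 2))"
proof -
  define s where "s = (real m + 1) / 2"
  have s: "s > 0" by (simp add: s_def)
  have Ioi: "{0::real<..} \<in> sets lebesgue" by simp
  let ?f = "\<lambda>v. v powr (s - 1) / exp v :: real"
  let ?g = "\<lambda>t. a / t\<^sup>2 :: real"
  let ?h = "\<lambda>t. - (a * 2 / (t * (t * t))) :: real"
  have img: "?g ` {0<..} = {0<..}"
  proof (safe, goal_cases)
    case (1 x y) then show ?case using a by simp
  next
    case (2 v)
    have "v = ?g (sqrt (a / v))" using 2 a by simp
    moreover have "sqrt (a / v) \<in> {0<..}" using 2 a by simp
    ultimately show ?case by blast
  qed
  have inj: "inj_on ?g {0<..}"
    using a by (auto intro!: inj_onI simp: power2_eq_iff)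
  have der: "\<And>t. t \<in> {0<..} \<Longrightarrow> (?g has_field_derivative ?h t) (at t within {0<..})"
  proof -
    fix t :: real assume "t \<in> {0<..}"
    then have t: "t \<noteq> 0" by simp
    have "(?g has_field_derivative (0 * t\<^sup>2 - a * (2 * t)) / (t\<^sup>2 * t\<^sup>2)) (at t within {0<..})"
      using t by (auto intro!: derivative_eq_intros)
    also have "(0 * t\<^sup>2 - a * (2 * t)) / (t\<^sup>2 * t\<^sup>2) = ?h t"
      using t by (simp add: power2_eq_square power3_eq_cube)
    finally show "(?g has_field_derivative ?h t) (at t within {0<..})" .
  qed
  have G: "(?f has_integral Gamma s) {0<..}"
  proof -
    have "((\<lambda>t. if t \<in> {0<..} then ?f t else 0) has_integral Gamma s) {0..}"
      by (rule has_integral_spike[of "{0}", rotated 2, OF Gamma_integral_real[OF s]]) auto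
    then show ?thesis by (subst (asm) has_integral_restrict) auto
  qed
  have fi: "?f absolutely_integrable_on ?g ` {0<..} \<and> integral (?g ` {0<..}) ?f = Gamma s"
    unfolding img
  proof
    show "?f absolutely_integrable_on {0<..}"
      by (rule nonnegative_absolutely_integrable_1[OF has_integral_integrable[OF G]]) simp
  qed (rule integral_unique[OF G])
  have "(\<lambda>t. \<bar>?h t\<bar> *\<^sub>R ?f (?g t)) absolutely_integrable_on {0<..} \<and> integral {0<..} (\<lambda>t. \<bar>?h t\<bar> *\<^sub>R ?f (?g t)) = Gamma s"
    by (rule iffD2[OF has_absolute_integral_change_of_variables_real[OF Ioi der inj] fi])
  then have "(\<lambda>t. \<bar>?h t\<bar> *\<^sub>R ?f (?g t)) integrable_on {0<..}" and
    "integral {0<..} (\<lambda>t. \<bar>?h t\<bar> *\<^sub>R ?f (?g t)) = Gamma s"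
    by (auto intro: set_lebesgue_integral_eq_integral(1))
  then have hi: "((\<lambda>t. \<bar>?h t\<bar> *\<^sub>R ?f (?g t)) has_integral Gamma s) {0<..}"
    by (simp only: has_integral_iff)
  let ?k = "\<lambda>t. exp (- (a / t\<^sup>2)) / \<bar>t\<bar> ^ (m + 2)"
  have fg: "\<bar>?h t\<bar> *\<^sub>R ?f (?g t) = (2 * a powr s) * ?k t" if t: "t > 0" for t
  proof -
    have p: "(a / t\<^sup>2) powr (s - 1) = a powr s / a * (t\<^sup>2 / t ^ (m + 1))"
    proof -
      have "(t\<^sup>2) powr s = t powr (2 * s)" using t by (simp add: powr_powr flip: powr_numeral)
      also have "2 * s = real (m + 1)" by (simp add: s_def)
      also have "t powr real (m + 1) = t ^ (m + 1)" using t by (rule powr_realpow)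
      finally have "(t\<^sup>2) powr s = t ^ (m + 1)" .
      then show ?thesis using t a by (simp add: powr_diff powr_divide)
    qed
    have q: "exp (- (a / t\<^sup>2)) = 1 / exp (a / t\<^sup>2)" by (simp add: exp_minus inverse_eq_divide)
    show ?thesis unfolding p q using t a
      by (simp add: power2_eq_square)
  qed
  have "((\<lambda>t. (2 * a powr s) * ?k t) has_integral Gamma s) {0<..}"
    by (rule has_integral_eq[OF _ hi]) (use fg in auto)
  from has_integral_mult_right[OF this, of "1 / (2 * a powr s)"]
  have k: "(?k has_integral Gamma s / (2 * a powr s)) {0<..}" using a by simp
  \<comment> \<open>The substitution covers positive \<open>t\<close> only. The reflection t -> -t
    gives the other half line, and the two halves together absorb the factor 2 of the
    Jacobian.\<close>
  have half: "(\<integral>\<^sup>+t. ennreal (?k t * indicator {0<..} t) \<partial>lborel) = ennreal (Gamma s / (2 * a powr s))"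
    using nn_integral_has_integral_lebesgue[OF _ k] by (simp add: mult.commute)
  have half': "(\<integral>\<^sup>+t. ennreal (?k t * indicator {..<0} t) \<partial>lborel) = ennreal (Gamma s / (2 * a powr s))"
    unfolding half[symmetric]
    by (subst nn_integral_real_affine[where c="-1" and t=0]) (auto simp: indicator_def intro!: nn_integral_cong)
  have "(\<integral>\<^sup>+t. ennreal (?k t) \<partial>lborel) = (\<integral>\<^sup>+t. ennreal (?k t * indicator {0<..} t) + ennreal (?k t * indicator {..<0} t) \<partial>lborel)"
    by (rule nn_integral_cong_AE, rule AE_mp[OF AE_lborel_singleton[of 0]]) (auto simp: indicator_def)
  also have "\<dots> = (\<integral>\<^sup>+t. ennreal (?k t * indicator {0<..} t) \<partial>lborel) + (\<integral>\<^sup>+t. ennreal (?k t * indicator {..<0} t) \<partial>lborel)"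
    by (rule nn_integral_add) auto
  also have "\<dots> = ennreal (Gamma s / (2 * a powr s)) + ennreal (Gamma s / (2 * a powr s))"
    by (simp only: half half')
  also have "\<dots> = ennreal (Gamma s / a powr s)"
    using a Gamma_real_pos[OF s] by (simp flip: ennreal_plus)
  finally show ?thesis unfolding s_def .
qed

lemma nn_integral_gaussian_scaled:
  assumes "t \<noteq> 0"
  shows "(\<integral>\<^sup>+x. ennreal (exp (- (pi * (x - c)\<^sup>2 / t\<^sup>2))) \<partial>lborel) = ennreal \<bar>t\<bar>"
proof -
  define \<sigma> where "\<sigma> = \<bar>t\<bar> / sqrt (2 * pi)"
  have \<sigma>: "\<sigma> > 0" using assms by (simp add: \<sigma>_def)
  have s2: "2 * \<sigma>\<^sup>2 = t\<^sup>2 / pi" and s3: "sqrt (2 * pi * \<sigma>\<^sup>2) = \<bar>t\<bar>"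
    unfolding \<sigma>_def by (simp_all add: power_divide real_sqrt_mult real_sqrt_divide power_mult_distrib)
  have nd: "exp (- (pi * (x - c)\<^sup>2 / t\<^sup>2)) = \<bar>t\<bar> * normal_density c \<sigma> x" for x
    unfolding normal_density_def s2 s3 using assms by (simp add: mult.commute)
  have "(\<integral>\<^sup>+x. ennreal (normal_density c \<sigma> x) \<partial>lborel) = 1"
    using prob_space.emeasure_space_1[OF prob_space_normal_density[OF \<sigma>, of c]]
    by (simp add: emeasure_density)
  then show ?thesis unfolding nd by (simp add: ennreal_mult nn_integral_cmult)
qed

section \<open>Riesz and Poisson kernels\<close>

interpretation lborel_product: product_sigma_finite "\<lambda>_::nat. lborel :: real measure" ..

locale riesz_transform =
  fixes n j :: nat
  assumes j_less: "j < n"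
begin

text \<open>The uncompleted product measure, on which all Fubini arguments take place; the
  completion in \<open>Leb n\<close> is dealt with only in the final theorem.\<close>

abbreviation P :: "(nat \<Rightarrow> real) measure" where "P \<equiv> PiM {..<n} (\<lambda>_. lborel)"

sublocale P: sigma_finite_measure P
  by (rule lborel_product.sigma_finite) simp

sublocale PP: pair_sigma_finite P P ..

sublocale PL: pair_sigma_finite P "lborel :: real measure" ..

sublocale LP: pair_sigma_finite "lborel :: real measure" P ..

lemma space_P: "space P = extensional {..<n}"
  by (simp add: space_PiM PiE_UNIV_domain PiE_def)

lemma measurable_coord: "f \<in> measurable M P \<Longrightarrow> i < n \<Longrightarrow> (\<lambda>w. f w i) \<in> borel_measurable M"
  using measurable_compose[OF _ measurable_component_singleton[of i "{..<n}" "\<lambda>_. lborel :: real measure"], of f M]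
  by simp

lemma measurable_coord_j: "f \<in> measurable M P \<Longrightarrow> (\<lambda>w. f w j) \<in> borel_measurable M"
  using measurable_coord j_less by blast

section \<open>Euclidean distance and affine substitutions\<close>

definition edist :: "(nat \<Rightarrow> real) \<Rightarrow> (nat \<Rightarrow> real) \<Rightarrow> real" where
  "edist x y = eucl_norm n (\<lambda>i. x i - y i)"

lemma edist_L2_set: "edist x y = L2_set (\<lambda>i. x i - y i) {..<n}"
  by (simp add: edist_def eucl_norm_def L2_set_def)

lemma measurable_edist [measurable (raw)]:
  assumes "f \<in> measurable M P" "g \<in> measurable M P"
  shows "(\<lambda>w. edist (f w) (g w)) \<in> borel_measurable M"
  unfolding edist_def eucl_norm_def using assms[THEN measurable_coord] by measurable

lemma edist_nonneg [simp]: "0 \<le> edist x y"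
  by (simp add: edist_L2_set)

lemma edist_self [simp]: "edist x x = 0"
  by (simp add: edist_def eucl_norm_def)

lemma edist_commute: "edist x y = edist y x"
  unfolding edist_def eucl_norm_def by (simp add: power2_commute)

lemma edist_triangle: "edist x z \<le> edist x y + edist y z"
proof -
  have "L2_set (\<lambda>i. (x i - y i) + (y i - z i)) {..<n} \<le> edist x y + edist y z"
    unfolding edist_L2_set by (rule L2_set_triangle_ineq)
  then show ?thesis by (simp add: edist_L2_set)
qed

lemma coord_le_edist: "i < n \<Longrightarrow> \<bar>x i - y i\<bar> \<le> edist x y"
  unfolding edist_L2_set using member_le_L2_set[of "{..<n}" i "\<lambda>i. \<bar>x i - y i\<bar>"]
  by (simp add: L2_set_def)

lemma edist_le_sum: "edist x y \<le> (\<Sum>i<n. \<bar>x i - y i\<bar>)"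
  unfolding edist_L2_set by (rule L2_set_le_sum_abs)

lemma edist_le: "(\<And>i. i < n \<Longrightarrow> \<bar>x i - y i\<bar> \<le> b) \<Longrightarrow> edist x y \<le> real n * b"
  using order_trans[OF edist_le_sum sum_bounded_above[of "{..<n}" "\<lambda>i. \<bar>x i - y i\<bar>" b]] by simp

text \<open>One affine map, restricted so that its values are extensional, serves as translation
  (\<open>t = 1\<close>), as the point \<open>x - t u\<close> of a line in direction
  \<open>u\<close>, and as point reflection (\<open>t = - 1\<close>).\<close>

definition aff :: "real \<Rightarrow> (nat \<Rightarrow> real) \<Rightarrow> (nat \<Rightarrow> real) \<Rightarrow> nat \<Rightarrow> real" where
  "aff t c x = (\<lambda>i\<in>{..<n}. c i + t * x i)"

lemma aff_in_space [simp]: "aff t c x \<in> space P"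
  by (simp add: space_P aff_def)

lemma measurable_aff [measurable (raw)]:
  assumes "f \<in> measurable M P" "g \<in> measurable M P" "s \<in> borel_measurable M"
  shows "(\<lambda>w. aff (s w) (g w) (f w)) \<in> measurable M P"
  unfolding aff_def
  using assms(1,2)[THEN measurable_coord] assms(3) by (intro measurable_restrict) auto

lemma measurable_aff' [measurable]: "aff t c \<in> measurable P P"
  unfolding aff_def by (intro measurable_restrict) (use measurable_coord[OF measurable_ident] in auto)

text \<open>Both measures are compared on boxes, where the claim factors into the one-dimensional
  affine rule.\<close>

lemma density_distr_aff:
  assumes t: "t \<noteq> 0"
  shows "density (distr P P (aff t c)) (\<lambda>_. ennreal (\<bar>t\<bar> ^ n)) = P"
proof (rule lborel_product.PiM_eqI)
  fix A :: "nat \<Rightarrow> real set" assume A: "\<And>i. i \<in> {..<n} \<Longrightarrow> A i \<in> sets lborel"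
  then have A': "\<And>i. i < n \<Longrightarrow> A i \<in> sets borel" by simp
  have S: "Pi\<^sub>E {..<n} A \<in> sets P" by (rule sets_PiM_I_finite) (use A in auto)
  have v: "aff t c -` Pi\<^sub>E {..<n} A \<inter> space P = Pi\<^sub>E {..<n} (\<lambda>i. (\<lambda>x. c i + t * x) -` A i)"
    by (auto simp: space_P aff_def PiE_iff extensional_def)
  have m: "(\<lambda>x. c i + t * x) -` A i \<in> sets lborel" if "i < n" for i
    using measurable_sets[of "\<lambda>x. c i + t * x" borel borel "A i"] A'[OF that] by simp
  have e: "emeasure lborel (A i) = ennreal \<bar>t\<bar> * emeasure lborel ((\<lambda>x. c i + t * x) -` A i)" if "i < n" for i
    by (subst lborel_real_affine[OF t, of "c i"])
       (use A'[OF that] in \<open>simp add: emeasure_density nn_integral_cmult_indicator emeasure_distr\<close>)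
  have "emeasure (density (distr P P (aff t c)) (\<lambda>_. ennreal (\<bar>t\<bar> ^ n))) (Pi\<^sub>E {..<n} A)
     = ennreal (\<bar>t\<bar> ^ n) * emeasure P (Pi\<^sub>E {..<n} (\<lambda>i. (\<lambda>x. c i + t * x) -` A i))"
    using S by (simp add: emeasure_density nn_integral_cmult_indicator emeasure_distr v)
  also have "emeasure P (Pi\<^sub>E {..<n} (\<lambda>i. (\<lambda>x. c i + t * x) -` A i)) = (\<Prod>i<n. emeasure lborel ((\<lambda>x. c i + t * x) -` A i))"
    using m by (intro lborel_product.emeasure_PiM) auto
  also have "ennreal (\<bar>t\<bar> ^ n) * \<dots> = (\<Prod>i<n. ennreal \<bar>t\<bar> * emeasure lborel ((\<lambda>x. c i + t * x) -` A i))"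
    by (simp add: prod.distrib ennreal_power)
  also have "\<dots> = (\<Prod>i<n. emeasure lborel (A i))" using e by simp
  finally show "emeasure (density (distr P P (aff t c)) (\<lambda>_. ennreal (\<bar>t\<bar> ^ n))) (Pi\<^sub>E {..<n} A) = (\<Prod>i<n. emeasure lborel (A i))" .
qed auto

lemma nn_integral_aff:
  assumes [measurable]: "f \<in> borel_measurable P" and t: "t \<noteq> 0"
  shows "(\<integral>\<^sup>+x. f x \<partial>P) = ennreal (\<bar>t\<bar> ^ n) * (\<integral>\<^sup>+x. f (aff t c x) \<partial>P)"
  by (subst density_distr_aff[OF t, of c, symmetric])
     (simp add: nn_integral_density nn_integral_distr nn_integral_cmult)

lemma integral_aff:
  fixes f :: "(nat \<Rightarrow> real) \<Rightarrow> real"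
  assumes [measurable]: "f \<in> borel_measurable P" and t: "t \<noteq> 0"
  shows "(\<integral>x. f x \<partial>P) = \<bar>t\<bar> ^ n * (\<integral>x. f (aff t c x) \<partial>P)"
  by (subst density_distr_aff[OF t, of c, symmetric])
     (simp add: integral_density integral_distr)

section \<open>Riesz and Poisson kernels: size, regularity and mutual comparison\<close>

definition cn :: real where "cn = riesz_const n"

lemma cn_pos [simp]: "cn > 0"
  unfolding cn_def riesz_const_def by (intro divide_pos_pos Gamma_real_pos) auto

definition ker :: "(nat \<Rightarrow> real) \<Rightarrow> (nat \<Rightarrow> real) \<Rightarrow> real" where
  "ker x y = cn * (x j - y j) / edist x y ^ (n + 1)"

lemma ker_eq_riesz_kernel: "ker x y = riesz_kernel n j (\<lambda>i. x i - y i)"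
  by (simp add: ker_def riesz_kernel_def edist_def cn_def)

definition tker :: "real \<Rightarrow> (nat \<Rightarrow> real) \<Rightarrow> (nat \<Rightarrow> real) \<Rightarrow> real" where
  "tker \<epsilon> x y = (if edist x y \<ge> \<epsilon> then ker x y else 0)"

text \<open>The Poisson kernel of the upper half-space at height \<open>r\<close>; the Riesz
  constant \<open>cn\<close> is also its normalizing constant (\<open>nn_integral_pois\<close>).
  Kernel errors are measured by it throughout, so that one maximal function controls them.\<close>

definition pois :: "real \<Rightarrow> (nat \<Rightarrow> real) \<Rightarrow> (nat \<Rightarrow> real) \<Rightarrow> real" where
  "pois r x y = cn * r / sqrt (r\<^sup>2 + (edist x y)\<^sup>2) ^ (n + 1)"

text \<open>The conjugate Poisson kernel in direction \<open>j\<close>, that is, the Riesz kernel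
  smoothed at scale \<open>r\<close>.\<close>

definition cpois :: "real \<Rightarrow> (nat \<Rightarrow> real) \<Rightarrow> (nat \<Rightarrow> real) \<Rightarrow> real" where
  "cpois r x y = cn * (x j - y j) / sqrt (r\<^sup>2 + (edist x y)\<^sup>2) ^ (n + 1)"

lemma measurable_kernels [measurable (raw)]:
  assumes [measurable]: "f \<in> measurable M P" "g \<in> measurable M P"
  shows "(\<lambda>w. ker (f w) (g w)) \<in> borel_measurable M"
    "(\<lambda>w. tker \<epsilon> (f w) (g w)) \<in> borel_measurable M"
    "(\<lambda>w. pois \<epsilon> (f w) (g w)) \<in> borel_measurable M"
    "(\<lambda>w. cpois \<epsilon> (f w) (g w)) \<in> borel_measurable M"
proof -
  note [measurable] = assms[THEN measurable_coord_j]
  show "(\<lambda>w. ker (f w) (g w)) \<in> borel_measurable M"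
    "(\<lambda>w. tker \<epsilon> (f w) (g w)) \<in> borel_measurable M"
    "(\<lambda>w. pois \<epsilon> (f w) (g w)) \<in> borel_measurable M"
    "(\<lambda>w. cpois \<epsilon> (f w) (g w)) \<in> borel_measurable M"
  unfolding ker_def tker_def pois_def cpois_def by measurable
qed

lemma pois_nonneg [simp]: "r \<ge> 0 \<Longrightarrow> 0 \<le> pois r x y"
  unfolding pois_def using cn_pos by (intro divide_nonneg_nonneg mult_nonneg_nonneg zero_le_power) (auto simp del: cn_pos)

lemma pois_commute: "pois r x y = pois r y x"
  unfolding pois_def by (simp add: edist_commute)

text \<open>With q = r^2 + |x - y|^2 this writes the common factor of \<open>pois\<close> and
  \<open>cpois\<close> as a superposition of Gaussians of width |t|. Gaussians factor over the
  coordinates, which is what later removes the dimension.\<close>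

lemma nn_integral_subordination:
  assumes q: "q > 0"
  shows "(\<integral>\<^sup>+t. ennreal (exp (- (pi * q / t\<^sup>2)) / \<bar>t\<bar> ^ (n + 2)) \<partial>lborel) = ennreal (cn / sqrt q ^ (n + 1))"
proof -
  have "(pi * q) powr ((real n + 1) / 2) = pi powr (real (n + 1) / 2) * sqrt q ^ (n + 1)"
  proof -
    have "sqrt q ^ (n + 1) = (q powr (1 / 2)) powr real (n + 1)"
      using q by (simp only: powr_realpow powr_half_sqrt real_sqrt_gt_zero less_imp_le)
    also have "\<dots> = q powr (real (n + 1) / 2)" by (simp add: powr_powr)
    finally show ?thesis using q by (simp add: powr_mult add.commute)
  qed
  then show ?thesis
    using nn_integral_exp_inverse_square[of "pi * q" n] q
    by (simp add: cn_def riesz_const_def add.commute)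
qed

lemma nn_integral_gaussian_P:
  assumes t: "t \<noteq> 0"
  shows "(\<integral>\<^sup>+y. ennreal (exp (- (pi * (edist x y)\<^sup>2 / t\<^sup>2))) \<partial>P) = ennreal (\<bar>t\<bar> ^ n)"
proof -
  have "exp (- (pi * (edist x y)\<^sup>2 / t\<^sup>2)) = (\<Prod>i<n. exp (- (pi * (y i - x i)\<^sup>2 / t\<^sup>2)))" for y
  proof -
    have "(edist x y)\<^sup>2 = (\<Sum>i<n. (y i - x i)\<^sup>2)"
      unfolding edist_def eucl_norm_def by (simp add: sum_nonneg power2_commute)
    then show ?thesis by (simp add: sum_divide_distrib sum_distrib_left exp_sum flip: sum_negf)
  qed
  then have "(\<integral>\<^sup>+y. ennreal (exp (- (pi * (edist x y)\<^sup>2 / t\<^sup>2))) \<partial>P)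
      = (\<integral>\<^sup>+y. (\<Prod>i<n. ennreal (exp (- (pi * (y i - x i)\<^sup>2 / t\<^sup>2)))) \<partial>P)"
    by (simp add: prod_ennreal)
  also have "\<dots> = (\<Prod>i<n. \<integral>\<^sup>+z. ennreal (exp (- (pi * (z - x i)\<^sup>2 / t\<^sup>2))) \<partial>lborel)"
    by (rule lborel_product.product_nn_integral_prod) auto
  also have "\<dots> = ennreal (\<bar>t\<bar> ^ n)"
    by (simp add: nn_integral_gaussian_scaled[OF t] ennreal_power)
  finally show ?thesis .
qed

text \<open>After subordination the Gaussian in \<open>y\<close> integrates to |t|^n, which leaves
  the case \<open>m = 0\<close> of the same Gamma integral, with value 1 / r.\<close>

lemma nn_integral_pois:
  assumes r: "r > 0" and [measurable]: "x \<in> space P"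
  shows "(\<integral>\<^sup>+y. ennreal (pois r x y) \<partial>P) = 1"
proof -
  let ?e = "\<lambda>t q. exp (- (pi * q / t\<^sup>2)) / \<bar>t\<bar> ^ (n + 2)"
  have "ennreal (pois r x y) = (\<integral>\<^sup>+t. ennreal (r * ?e t (r\<^sup>2 + (edist x y)\<^sup>2)) \<partial>lborel)" for y
  proof -
    have "(\<integral>\<^sup>+t. ennreal (r * ?e t (r\<^sup>2 + (edist x y)\<^sup>2)) \<partial>lborel) = ennreal r * (\<integral>\<^sup>+t. ennreal (?e t (r\<^sup>2 + (edist x y)\<^sup>2)) \<partial>lborel)"
      using r by (subst nn_integral_cmult[symmetric]) (auto simp: ennreal_mult[symmetric])
    also have "\<dots> = ennreal r * ennreal (cn / sqrt (r\<^sup>2 + (edist x y)\<^sup>2) ^ (n + 1))"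
      using r by (subst nn_integral_subordination) (auto intro: add_pos_nonneg)
    finally show ?thesis using r by (simp add: pois_def mult.commute flip: ennreal_mult')
  qed
  then have "(\<integral>\<^sup>+y. ennreal (pois r x y) \<partial>P) = (\<integral>\<^sup>+y. \<integral>\<^sup>+t. ennreal (r * ?e t (r\<^sup>2 + (edist x y)\<^sup>2)) \<partial>lborel \<partial>P)" by simp
  also have "\<dots> = (\<integral>\<^sup>+t. \<integral>\<^sup>+y. ennreal (r * ?e t (r\<^sup>2 + (edist x y)\<^sup>2)) \<partial>P \<partial>lborel)"
    by (rule PL.Fubini'[symmetric]) (use assms in measurable)
  also have "\<dots> = (\<integral>\<^sup>+t. ennreal (r * (exp (- (pi * r\<^sup>2 / t\<^sup>2)) / \<bar>t\<bar> ^ 2)) \<partial>lborel)"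
  proof (rule nn_integral_cong_AE, rule AE_mp[OF AE_lborel_singleton[of 0]], intro AE_I2 impI)
    fix t :: real assume t: "t \<noteq> 0"
    have eq: "r * ?e t (r\<^sup>2 + (edist x y)\<^sup>2) = (r * exp (- (pi * r\<^sup>2 / t\<^sup>2)) / \<bar>t\<bar> ^ (n + 2)) * exp (- (pi * (edist x y)\<^sup>2 / t\<^sup>2))" for y
      by (simp add: add_divide_distrib distrib_left exp_add[symmetric])
    have "(\<integral>\<^sup>+y. ennreal (r * ?e t (r\<^sup>2 + (edist x y)\<^sup>2)) \<partial>P) = ennreal (r * exp (- (pi * r\<^sup>2 / t\<^sup>2)) / \<bar>t\<bar> ^ (n + 2)) * ennreal (\<bar>t\<bar> ^ n)"
      unfolding eq nn_integral_gaussian_P[OF t, symmetric, of x] using r assms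
      by (subst nn_integral_cmult[symmetric]) (auto simp: ennreal_mult[symmetric])
    also have "\<dots> = ennreal (r * (exp (- (pi * r\<^sup>2 / t\<^sup>2)) / \<bar>t\<bar> ^ 2))"
      using t r by (simp add: power_add power2_eq_square flip: ennreal_mult)
    finally show "(\<integral>\<^sup>+y. ennreal (r * ?e t (r\<^sup>2 + (edist x y)\<^sup>2)) \<partial>P) = ennreal (r * (exp (- (pi * r\<^sup>2 / t\<^sup>2)) / \<bar>t\<bar> ^ 2))" .
  qed
  also have "\<dots> = ennreal r * (\<integral>\<^sup>+t. ennreal (exp (- (pi * r\<^sup>2 / t\<^sup>2)) / \<bar>t\<bar> ^ (0 + 2)) \<partial>lborel)"
    using r by (subst nn_integral_cmult[symmetric]) (auto simp: ennreal_mult[symmetric] power2_eq_square)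
  also have "\<dots> = ennreal r * ennreal (1 / r)"
    using r by (subst nn_integral_exp_inverse_square) (auto simp: Gamma_one_half_real powr_half_sqrt real_sqrt_mult)
  also have "\<dots> = 1" using r by (simp flip: ennreal_mult)
  finally show ?thesis .
qed

lemma integrable_pois: "r > 0 \<Longrightarrow> x \<in> space P \<Longrightarrow> integrable P (pois r x)"
  by (rule integrableI_nonneg) (use nn_integral_pois in auto)

lemma integral_pois: "r > 0 \<Longrightarrow> x \<in> space P \<Longrightarrow> (\<integral>y. pois r x y \<partial>P) = 1"
  using nn_integral_pois[of r x] by (subst integral_eq_nn_integral) auto

lemma sqrt_sum_le: "0 \<le> r \<Longrightarrow> 0 \<le> d \<Longrightarrow> sqrt (r\<^sup>2 + d\<^sup>2) \<le> r + d"
  by (rule real_le_lsqrt) (auto simp: power2_sum)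

lemma pois_lower:
  assumes r: "r > 0" and s: "r + edist x y \<le> L"
  shows "cn * r / L ^ (n + 1) \<le> pois r x y"
proof -
  have 1: "0 < sqrt (r\<^sup>2 + (edist x y)\<^sup>2)" using r by (simp add: add_pos_nonneg)
  have 2: "sqrt (r\<^sup>2 + (edist x y)\<^sup>2) \<le> L"
    using sqrt_sum_le[of r "edist x y"] r s by simp
  show ?thesis unfolding pois_def
    using r 1 2 less_le_trans[OF 1 2]
    by (intro divide_left_mono power_mono mult_nonneg_nonneg mult_pos_pos zero_less_power) (auto intro: less_imp_le)
qed

lemma pois_upper:
  assumes r: "r > 0" shows "pois r x y \<le> cn / r ^ n"
proof -
  have "r \<le> sqrt (r\<^sup>2 + (edist x y)\<^sup>2)" using r by (simp add: real_le_rsqrt)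
  then have "r ^ (n + 1) \<le> sqrt (r\<^sup>2 + (edist x y)\<^sup>2) ^ (n + 1)" using r by (intro power_mono) auto
  then have "pois r x y \<le> cn * r / r ^ (n + 1)"
    unfolding pois_def using r less_imp_le[OF cn_pos] by (intro divide_left_mono mult_nonneg_nonneg mult_pos_pos zero_less_power) (auto simp: add_pos_nonneg simp del: cn_pos)
  then show ?thesis using r by simp
qed

lemma pois_upper_far:
  assumes r: "r > 0" and d: "edist x y \<ge> d" "d > 0" shows "pois r x y \<le> cn * r / d ^ (n + 1)"
proof -
  have "d\<^sup>2 \<le> r\<^sup>2 + (edist x y)\<^sup>2" using d power_mono[of d "edist x y" 2] by (simp add: add_increasing)
  then have "d \<le> sqrt (r\<^sup>2 + (edist x y)\<^sup>2)" by (rule real_le_rsqrt)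
  then have "d ^ (n + 1) \<le> sqrt (r\<^sup>2 + (edist x y)\<^sup>2) ^ (n + 1)" using d by (intro power_mono) auto
  then show ?thesis
    unfolding pois_def using r d less_imp_le[OF cn_pos] by (intro divide_left_mono mult_nonneg_nonneg mult_pos_pos zero_less_power) (auto simp: add_pos_nonneg simp del: cn_pos)
qed

text \<open>A Harnack inequality: if the distance to \<open>x\<close> at most doubles, so does sqrt
  (r^2 + d^2), and the kernel is homogeneous of order n + 1 in this radius.\<close>

lemma pois_Harnack:
  assumes r: "r > 0" and d: "edist x y' \<le> 2 * edist x y"
  shows "pois r x y \<le> 2 ^ (n + 1) * pois r x y'"
proof -
  let ?s = "\<lambda>y. sqrt (r\<^sup>2 + (edist x y)\<^sup>2)"
  have p: "?s y > 0" for y using r by (simp add: add_pos_nonneg)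
  have "(edist x y')\<^sup>2 \<le> (2 * edist x y)\<^sup>2" using d by (intro power_mono) auto
  then have *: "?s y' \<le> sqrt (4 * (r\<^sup>2 + (edist x y)\<^sup>2))"
    by (intro real_sqrt_le_mono) (simp add: power_mult_distrib distrib_left, smt (verit) zero_le_power2)
  have "sqrt (4 * (r\<^sup>2 + (edist x y)\<^sup>2)) = 2 * ?s y" by (simp only: real_sqrt_mult real_sqrt_four)
  with * have "?s y' \<le> 2 * ?s y" by (simp only:)
  then have "?s y' ^ (n + 1) \<le> (2 * ?s y) ^ (n + 1)" using p by (intro power_mono) (auto intro: less_imp_le)
  then have "?s y' ^ (n + 1) \<le> 2 ^ (n + 1) * ?s y ^ (n + 1)" by (simp only: power_mult_distrib)
  then have "cn * r * (?s y' ^ (n + 1)) \<le> cn * r * (2 ^ (n + 1) * ?s y ^ (n + 1))"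
    using r less_imp_le[OF cn_pos] by (intro mult_left_mono) auto
  then show ?thesis unfolding pois_def
    using zero_less_power[OF p[of y], of "n+1"] zero_less_power[OF p[of y'], of "n+1"]
    by (simp add: field_simps del: power_Suc)
qed

lemma abs_power_diff_le:
  fixes a b :: real
  assumes "0 \<le> a" "0 \<le> b" "a \<le> M" "b \<le> M"
  shows "\<bar>a ^ Suc m - b ^ Suc m\<bar> \<le> real (Suc m) * M ^ m * \<bar>a - b\<bar>"
proof -
  have "\<bar>\<Sum>i<Suc m. a ^ i * b ^ (m - i)\<bar> \<le> (\<Sum>i<Suc m. M ^ m)"
  proof (rule order_trans[OF sum_abs sum_mono])
    fix i assume "i \<in> {..<Suc m}"
    then have "M ^ m = M ^ i * M ^ (m - i)" by (simp flip: power_add)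
    moreover have "a ^ i * b ^ (m - i) \<le> M ^ i * M ^ (m - i)" using assms by (intro mult_mono power_mono) auto
    ultimately show "\<bar>a ^ i * b ^ (m - i)\<bar> \<le> M ^ m" using assms by simp
  qed
  then have "\<bar>(a - b) * (\<Sum>i<Suc m. a ^ i * b ^ (m - i))\<bar> \<le> \<bar>a - b\<bar> * (real (Suc m) * M ^ m)"
    unfolding abs_mult by (intro mult_left_mono) auto
  then show ?thesis unfolding diff_power_eq_sum by (simp only: mult_ac)
qed

text \<open>The disjunction in the hypothesis says that only one of the two points moves, so the
  difference vector changes by at most \<open>\<delta>\<close>; one lemma serves both variables. The
  factor 4^n arises because the distance may double in the power difference and halve in the
  denominator.\<close>

lemma ker_diff_le:
  assumes \<delta>: "0 \<le> \<delta>" and x: "edist x x' \<le> \<delta>" and y: "edist y y' \<le> \<delta>" "edist x x' = 0 \<or> edist y y' = 0"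
    and d: "2 * \<delta> \<le> edist x y" "0 < edist x y"
  shows "\<bar>ker x y - ker x' y'\<bar> \<le> cn * ((1 + real (n + 1) * 4 ^ n) * \<delta> / edist x y ^ (n + 1))"
proof -
  define a where "a = edist x y"
  define b where "b = edist x' y'"
  have a: "a > 0" using d by (simp add: a_def)
  have ab: "\<bar>a - b\<bar> \<le> \<delta>"
    using edist_triangle[of x y x'] edist_triangle[of x' y y'] edist_triangle[of x' y' x] edist_triangle[of x y' y]
      x y edist_commute[of x x'] edist_commute[of y y'] unfolding a_def b_def by linarith
  have b: "a / 2 \<le> b" "b \<le> 2 * a" "b > 0" using ab d a unfolding a_def by linarith+
  have zj: "\<bar>(x j - y j) - (x' j - y' j)\<bar> \<le> \<delta>"
    using coord_le_edist[OF j_less, of x x'] coord_le_edist[OF j_less, of y y'] x y by linarith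
  have zb: "\<bar>x' j - y' j\<bar> \<le> b" unfolding b_def by (rule coord_le_edist[OF j_less])
  have "\<bar>a ^ Suc n - b ^ Suc n\<bar> \<le> real (Suc n) * (2 * a) ^ n * \<bar>a - b\<bar>"
    using a b by (intro abs_power_diff_le) auto
  also have "\<dots> \<le> real (Suc n) * (2 * a) ^ n * \<delta>" using ab a by (intro mult_left_mono) auto
  finally have pd: "\<bar>b ^ Suc n - a ^ Suc n\<bar> \<le> real (Suc n) * (2 * a) ^ n * \<delta>" by linarith
  have "\<bar>(x' j - y' j) * (1 / a ^ Suc n - 1 / b ^ Suc n)\<bar> \<le> b * (real (Suc n) * (2 * a) ^ n * \<delta> / (a ^ Suc n * b ^ Suc n))"
  proof -
    have "1 / a ^ Suc n - 1 / b ^ Suc n = (b ^ Suc n - a ^ Suc n) / (a ^ Suc n * b ^ Suc n)"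
      using a b by (simp add: diff_frac_eq)
    then have "\<bar>1 / a ^ Suc n - 1 / b ^ Suc n\<bar> \<le> real (Suc n) * (2 * a) ^ n * \<delta> / (a ^ Suc n * b ^ Suc n)"
    proof -
      have "\<bar>a ^ Suc n * b ^ Suc n\<bar> = a ^ Suc n * b ^ Suc n" using a b by simp
      then show ?thesis unfolding \<open>1 / a ^ Suc n - 1 / b ^ Suc n = _\<close> abs_divide
        using pd a b by (auto intro!: divide_right_mono simp del: power_Suc)
    qed
    then show ?thesis unfolding abs_mult using zb b by (intro mult_mono) auto
  qed
  also have "\<dots> = real (Suc n) * (2 * a) ^ n * \<delta> / (a ^ Suc n * b ^ n)" using b by simp
  also have "\<dots> \<le> real (Suc n) * (2 * a) ^ n * \<delta> / (a ^ Suc n * (a / 2) ^ n)"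
    using a b \<delta> by (intro divide_left_mono mult_left_mono power_mono mult_nonneg_nonneg mult_pos_pos zero_less_power) auto
  also have "\<dots> = real (Suc n) * (2 ^ n * 2 ^ n) * \<delta> / a ^ Suc n"
    using a by (simp add: power_mult_distrib power_divide)
  also have "(2::real) ^ n * 2 ^ n = 4 ^ n" by (simp flip: power_mult_distrib)
  finally have 1: "\<bar>(x' j - y' j) * (1 / a ^ Suc n - 1 / b ^ Suc n)\<bar> \<le> real (Suc n) * 4 ^ n * \<delta> / a ^ Suc n" .
  have 2: "\<bar>((x j - y j) - (x' j - y' j)) / a ^ Suc n\<bar> \<le> \<delta> / a ^ Suc n"
    unfolding abs_divide using zj a by (auto intro!: divide_right_mono)
  \<comment> \<open>Separate the change of the numerator from the change of the denominator.\<close>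
  have eq: "ker x y - ker x' y' = cn * (((x j - y j) - (x' j - y' j)) / a ^ Suc n + (x' j - y' j) * (1 / a ^ Suc n - 1 / b ^ Suc n))"
  proof -
    have "cn * u / p - cn * v / q = cn * ((u - v) / p + v * (1 / p - 1 / q))" for u v p q :: real
      by (simp add: right_diff_distrib distrib_left diff_divide_distrib)
    then show ?thesis unfolding ker_def a_def[symmetric] b_def[symmetric] by simp
  qed
  have "\<bar>ker x y - ker x' y'\<bar> \<le> cn * (\<delta> / a ^ Suc n + real (Suc n) * 4 ^ n * \<delta> / a ^ Suc n)"
    unfolding eq abs_mult using order_trans[OF abs_triangle_ineq add_mono[OF 2 1]] less_imp_le[OF cn_pos]
    by (intro mult_mono) (auto simp del: power_Suc)
  then show ?thesis unfolding a_def by (simp add: distrib_right add_divide_distrib)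
qed

text \<open>One constant large enough for every comparison of a kernel with \<open>pois\<close>. It
  is exponential in \<open>n\<close> and must not enter the final constant.\<close>

definition CK :: real where "CK = (1 + real (n + 1) * 4 ^ n) * 3 ^ (n + 1)"

lemma CK_ge: "1 \<le> CK" "3 ^ (n + 1) \<le> CK" "real (n + 1) * 2 ^ n \<le> CK"
    "(1 + real (n + 1) * 4 ^ n) * 2 ^ (n + 1) \<le> CK"
proof -
  let ?u = "1 + real (n + 1) * 4 ^ n"
  have u: "1 \<le> ?u" by simp
  have t: "(1::real) \<le> 3 ^ (n + 1)" by (rule one_le_power) simp
  have "1 * 3 ^ (n + 1) \<le> ?u * 3 ^ (n + 1)" using u by (intro mult_right_mono) auto
  then show 3: "3 ^ (n + 1) \<le> CK" by (simp add: CK_def)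
  then show "1 \<le> CK" using t by linarith
  have "real (n + 1) * 2 ^ n \<le> real (n + 1) * 4 ^ n" by (intro mult_left_mono power_mono) auto
  also have "\<dots> \<le> ?u * 1" by simp
  also have "\<dots> \<le> CK" unfolding CK_def using t u by (intro mult_left_mono) auto
  finally show "real (n + 1) * 2 ^ n \<le> CK" .
  show "?u * 2 ^ (n + 1) \<le> CK" unfolding CK_def using u by (intro mult_left_mono power_mono) auto
qed

lemma abs_ker_le: "\<bar>ker x y\<bar> \<le> cn / edist x y ^ n"
proof (cases "edist x y = 0")
  case False
  then have p: "edist x y > 0" using edist_nonneg[of x y] by linarith
  have "\<bar>ker x y\<bar> = cn * \<bar>x j - y j\<bar> / edist x y ^ (n + 1)"
    unfolding ker_def abs_divide abs_mult using less_imp_le[OF cn_pos] by (simp add: power_abs)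
  also have "\<dots> \<le> cn * edist x y / edist x y ^ (n + 1)"
    using coord_le_edist[OF j_less, of x y] p less_imp_le[OF cn_pos] by (intro divide_right_mono mult_left_mono) auto
  finally show ?thesis using p by simp
qed (use less_imp_le[OF cn_pos] in \<open>simp add: ker_def\<close>)

lemma abs_ker_le':
  assumes "\<epsilon> > 0" "\<epsilon> \<le> edist x y" shows "\<bar>ker x y\<bar> \<le> cn / \<epsilon> ^ n"
proof -
  have "cn / edist x y ^ n \<le> cn / \<epsilon> ^ n"
    using assms less_imp_le[OF cn_pos] by (intro divide_left_mono power_mono mult_pos_pos zero_less_power) auto
  then show ?thesis using abs_ker_le[of x y] by linarith
qed

lemma abs_tker_le: "\<epsilon> > 0 \<Longrightarrow> \<bar>tker \<epsilon> x y\<bar> \<le> cn / \<epsilon> ^ n"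
  unfolding tker_def using abs_ker_le'[of \<epsilon> x y] less_imp_le[OF cn_pos] by auto

lemma abs_cpois_le: "r > 0 \<Longrightarrow> \<bar>cpois r x y\<bar> \<le> cn / r ^ n"
proof -
  assume r: "r > 0"
  let ?s = "sqrt (r\<^sup>2 + (edist x y)\<^sup>2)"
  have s: "?s \<ge> r" "?s \<ge> edist x y" using r by (simp_all add: real_le_rsqrt)
  have "\<bar>cpois r x y\<bar> = cn * \<bar>x j - y j\<bar> / ?s ^ (n + 1)"
    unfolding cpois_def abs_divide abs_mult using less_imp_le[OF cn_pos] by (simp add: power_abs)
  also have "\<dots> \<le> cn * ?s / ?s ^ (n + 1)"
    using order_trans[OF coord_le_edist[OF j_less, of x y] s(2)] less_imp_le[OF cn_pos] r
    by (intro divide_right_mono mult_left_mono zero_le_power) auto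
  also have "\<dots> = cn / ?s ^ n"
  proof -
    have "cn * q / q ^ (n + 1) = cn / q ^ n" if "q > 0" for q :: real using that by simp
    from this[OF less_le_trans[OF r s(1)]] show ?thesis .
  qed
  also have "\<dots> \<le> cn / r ^ n"
    using s r less_le_trans[OF r s(1)] less_imp_le[OF cn_pos]
    by (intro divide_left_mono power_mono mult_pos_pos zero_less_power) (auto simp del: real_sqrt_gt_0_iff)
  finally show ?thesis .
qed

text \<open>Within distance \<open>r\<close> only \<open>cpois\<close> is present and its numerator
  is below \<open>r\<close>. Beyond it the two denominators are powers of \<open>s\<close> and
  \<open>d\<close> with \<open>s - d\<close> at most \<open>r\<close>, and this gains the factor
  \<open>r\<close> of the Poisson kernel.\<close>

lemma cpois_minus_tker_le:
  assumes r: "r > 0"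
  shows "\<bar>cpois r x y - tker r x y\<bar> \<le> CK * pois r x y"
proof -
  define d where "d = edist x y"
  define s where "s = sqrt (r\<^sup>2 + d\<^sup>2)"
  have s: "s > 0" "s \<ge> d" "s \<le> r + d" using r sqrt_sum_le[of r d]
    by (auto simp: s_def d_def real_le_rsqrt add_pos_nonneg)
  have z: "\<bar>x j - y j\<bar> \<le> d" unfolding d_def by (rule coord_le_edist[OF j_less])
  have po: "pois r x y = cn * r / s ^ (n + 1)" unfolding pois_def s_def d_def ..
  show ?thesis
  proof (cases "d < r")
    case True
    have "\<bar>cpois r x y - tker r x y\<bar> = cn * \<bar>x j - y j\<bar> / s ^ (n + 1)"
      using True s less_imp_le[OF cn_pos] unfolding tker_def cpois_def d_def[symmetric] s_def[symmetric] by (simp add: abs_mult)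
    also have "\<dots> \<le> 1 * pois r x y" unfolding po
      using z True s less_imp_le[OF cn_pos] by (auto intro!: divide_right_mono mult_left_mono)
    also have "\<dots> \<le> CK * pois r x y" using CK_ge(1) r by (intro mult_right_mono) auto
    finally show ?thesis .
  next
    case False
    then have d: "d \<ge> r" "d > 0" using r by auto
    have "\<bar>s ^ Suc n - d ^ Suc n\<bar> \<le> real (Suc n) * (2 * d) ^ n * \<bar>s - d\<bar>"
      using s d by (intro abs_power_diff_le) auto
    also have "\<dots> \<le> real (Suc n) * (2 * d) ^ n * r" using s d by (intro mult_left_mono) auto
    finally have pd: "\<bar>s ^ Suc n - d ^ Suc n\<bar> \<le> real (Suc n) * (2 * d) ^ n * r" .
    have "cpois r x y - tker r x y = cn * ((x j - y j) * (1 / s ^ Suc n - 1 / d ^ Suc n))"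
      using d unfolding tker_def cpois_def ker_def d_def[symmetric] s_def[symmetric] by (simp add: algebra_simps)
    also have "1 / s ^ Suc n - 1 / d ^ Suc n = (d ^ Suc n - s ^ Suc n) / (s ^ Suc n * d ^ Suc n)"
      using s d by (simp add: diff_frac_eq)
    finally have "\<bar>cpois r x y - tker r x y\<bar> = cn * (\<bar>x j - y j\<bar> * (\<bar>s ^ Suc n - d ^ Suc n\<bar> / (s ^ Suc n * d ^ Suc n)))"
      using s d less_imp_le[OF cn_pos] by (simp add: abs_mult abs_divide abs_minus_commute)
    also have "\<dots> \<le> cn * (d * (real (Suc n) * (2 * d) ^ n * r / (s ^ Suc n * d ^ Suc n)))"
      using z pd s d less_imp_le[OF cn_pos] by (intro mult_left_mono mult_mono divide_right_mono) auto
    also have "\<dots> = (real (n + 1) * 2 ^ n) * pois r x y"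
      unfolding po using d s by (simp add: power_mult_distrib)
    also have "\<dots> \<le> CK * pois r x y" using CK_ge(3) r by (intro mult_right_mono) auto
    finally show ?thesis .
  qed
qed

text \<open>Since \<open>\<delta> \<le> r \<le> edist x y\<close>, the Lipschitz bound is at most a
  multiple of \<open>pois r\<close>. In this form errors can be summed over cubes or integrated at
  the cost of a Poisson average.\<close>

lemma ker_diff_le_pois:
  assumes \<delta>: "0 < \<delta>" and x: "edist x x' \<le> \<delta>" and y: "edist y y' \<le> \<delta>" "edist x x' = 0 \<or> edist y y' = 0"
    and d: "2 * \<delta> \<le> edist x y" and r: "\<delta> \<le> r" "r \<le> edist x y"
  shows "\<bar>ker x y - ker x' y'\<bar> \<le> CK * pois r x y"
proof -
  define a where "a = edist x y"
  have a: "a > 0" using d \<delta> by (simp add: a_def)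
  have u: "0 \<le> 1 + real (n + 1) * 4 ^ n" by simp
  have "\<bar>ker x y - ker x' y'\<bar> \<le> cn * ((1 + real (n + 1) * 4 ^ n) * \<delta> / a ^ (n + 1))"
    unfolding a_def using assms a by (intro ker_diff_le) (auto simp: a_def)
  also have "\<dots> \<le> cn * ((1 + real (n + 1) * 4 ^ n) * r / a ^ (n + 1))"
    using a r less_imp_le[OF cn_pos] by (intro mult_left_mono divide_right_mono) auto
  also have "\<dots> = (1 + real (n + 1) * 4 ^ n) * 2 ^ (n + 1) * (cn * r / (2 * a) ^ (n + 1))"
    using a by (simp add: power_mult_distrib)
  also have "\<dots> \<le> (1 + real (n + 1) * 4 ^ n) * 2 ^ (n + 1) * pois r x y"
    using r \<delta> by (intro mult_left_mono pois_lower) (auto simp: a_def)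
  also have "\<dots> \<le> CK * pois r x y" using CK_ge(4) r \<delta> by (intro mult_right_mono) auto
  finally show ?thesis .
qed

text \<open>The Poisson kernel at scale \<open>\<delta>\<close> pays for the variation of
  \<open>ker\<close>. The one at scale \<open>\<epsilon>\<close> pays for the case that exactly one
  of \<open>y\<close> and \<open>c\<close> is cut off: then \<open>c\<close> lies within 2
  \<open>\<epsilon>\<close> of \<open>x\<close>, and the surviving value is at most
  \<open>cn / \<epsilon> ^ n\<close>.\<close>

lemma tker_diff_le:
  assumes \<delta>: "0 < \<delta>" and y: "edist y c \<le> \<delta>" and d: "2 * \<delta> \<le> edist x c" and \<epsilon>: "\<epsilon> > 0"
  shows "\<bar>tker \<epsilon> x y - tker \<epsilon> x c\<bar> \<le> CK * (pois \<delta> x c + pois \<epsilon> x c)"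
proof -
  have dd: "edist x y \<le> edist x c + \<delta>" "edist x c \<le> edist x y + \<delta>"
    using edist_triangle[of x y c] edist_triangle[of x c y] y edist_commute[of y c] by linarith+
  have p0: "0 \<le> CK * pois \<delta> x c" "0 \<le> CK * pois \<epsilon> x c"
    using CK_ge(1) \<delta> \<epsilon> by (auto intro!: mult_nonneg_nonneg)
  have aux: "cn / \<epsilon> ^ n \<le> CK * pois \<epsilon> x c" if "edist x c \<le> 2 * \<epsilon>"
  proof -
    have "cn / \<epsilon> ^ n = 3 ^ (n + 1) * (cn * \<epsilon> / (3 * \<epsilon>) ^ (n + 1))"
      using \<epsilon> by (simp add: power_mult_distrib)
    also have "\<dots> \<le> 3 ^ (n + 1) * pois \<epsilon> x c" using that \<epsilon> by (intro mult_left_mono pois_lower) auto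
    also have "\<dots> \<le> CK * pois \<epsilon> x c" using CK_ge(2) \<epsilon> by (intro mult_right_mono) auto
    finally show ?thesis .
  qed
  consider "edist x y \<ge> \<epsilon>" "edist x c \<ge> \<epsilon>" | "edist x y < \<epsilon>" "edist x c < \<epsilon>"
    | "edist x y \<ge> \<epsilon>" "edist x c < \<epsilon>" | "edist x y < \<epsilon>" "edist x c \<ge> \<epsilon>" by linarith
  then have "\<bar>tker \<epsilon> x y - tker \<epsilon> x c\<bar> \<le> CK * pois \<delta> x c + CK * pois \<epsilon> x c"
  proof cases
    case 1
    have "\<bar>ker x c - ker x y\<bar> \<le> CK * pois \<delta> x c"
      using y d \<delta> by (intro ker_diff_le_pois[where \<delta>=\<delta>]) (auto simp: edist_commute[of c y])
    then show ?thesis using 1 p0 unfolding tker_def by auto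
  next
    case 2 then show ?thesis using p0 unfolding tker_def by auto
  next
    case 3
    then have "edist x c \<le> 2 * \<epsilon>" using \<epsilon> by linarith
    then show ?thesis using 3 aux abs_ker_le'[OF \<epsilon>, of x y] p0 unfolding tker_def by auto
  next
    case 4
    have "edist x c \<le> 2 * \<epsilon>" using 4 dd d by linarith
    then show ?thesis using 4 aux abs_ker_le'[OF \<epsilon>, of x c] p0 unfolding tker_def by auto
  qed
  then show ?thesis by (simp add: distrib_left)
qed

end

section \<open>The dimension-free bound on square-integrable functions\<close>

text \<open>If \<open>g\<close> is not integrable, its Bochner integral is 0 by convention and the
  bound is trivial.\<close>

lemma ennreal_abs_integral_le:
  fixes g :: "'a \<Rightarrow> real"
  shows "ennreal \<bar>integral\<^sup>L M g\<bar> \<le> (\<integral>\<^sup>+x. ennreal \<bar>g x\<bar> \<partial>M)"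
proof (cases "integrable M g")
  case True then show ?thesis using integral_norm_bound_ennreal[OF True] by simp
qed (simp add: not_integrable_integral_eq)

lemma integrable_bounded_mult:
  fixes f k :: "'a \<Rightarrow> real"
  assumes f: "integrable M f" and k: "k \<in> borel_measurable M" "\<And>x. x \<in> space M \<Longrightarrow> \<bar>k x\<bar> \<le> B"
  shows "integrable M (\<lambda>x. k x * f x)"
proof (rule Bochner_Integration.integrable_bound)
  show "integrable M (\<lambda>x. B * f x)" using f by simp
  show "AE x in M. norm (k x * f x) \<le> norm (B * f x)"
  proof (rule AE_I2)
    fix x assume "x \<in> space M"
    from k(2)[OF this] have "\<bar>k x\<bar> \<le> \<bar>B\<bar>" by linarith
    then show "norm (k x * f x) \<le> norm (B * f x)" by (auto simp: abs_mult intro!: mult_right_mono)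
  qed
qed (use f k in measurable)

text \<open>Cauchy-Schwarz after splitting the weight into two square roots. For a weight of mass
  one, such as \<open>pois r x\<close>, it is Jensen's inequality for the square.\<close>

lemma nn_integral_weighted_square_le:
  fixes w :: "'a \<Rightarrow> real"
  assumes [measurable]: "w \<in> borel_measurable M" "g \<in> borel_measurable M" and w: "\<And>x. 0 \<le> w x"
  shows "(\<integral>\<^sup>+x. ennreal (w x) * g x \<partial>M)\<^sup>2 \<le> (\<integral>\<^sup>+x. ennreal (w x) \<partial>M) * (\<integral>\<^sup>+x. ennreal (w x) * (g x)\<^sup>2 \<partial>M)"
proof -
  have s: "ennreal (w x) = ennreal (sqrt (w x)) * ennreal (sqrt (w x))" for x
    using w[of x] by (simp flip: ennreal_mult)
  have "(\<integral>\<^sup>+x. ennreal (w x) * g x \<partial>M) = (\<integral>\<^sup>+x. ennreal (sqrt (w x)) * (ennreal (sqrt (w x)) * g x) \<partial>M)"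
    by (subst s) (simp add: mult.assoc)
  also have "\<dots>\<^sup>2 \<le> (\<integral>\<^sup>+x. (ennreal (sqrt (w x)))\<^sup>2 \<partial>M) * (\<integral>\<^sup>+x. (ennreal (sqrt (w x)) * g x)\<^sup>2 \<partial>M)"
    by (rule Cauchy_Schwarz_nn_integral) measurable
  also have "\<dots> = (\<integral>\<^sup>+x. ennreal (w x) \<partial>M) * (\<integral>\<^sup>+x. ennreal (w x) * (g x)\<^sup>2 \<partial>M)"
    by (simp only: power_mult_distrib) (simp only: power2_eq_square s[symmetric])
  finally show ?thesis .
qed

context riesz_transform begin

text \<open>The point \<open>x - t u\<close> is either \<open>u\<close> dilated about
  \<open>x\<close>, which suits substitutions in \<open>u\<close>, or \<open>x\<close> translated by
  \<open>- t u\<close>, which suits translation invariance in \<open>x\<close>.\<close>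

lemma aff_eq_shift: "aff (- t) x u = aff 1 (\<lambda>i. - t * u i) x"
  by (auto simp: aff_def fun_eq_iff)

lemma aff_shift_shift: "aff (- r) (aff 1 (\<lambda>i. - t * u i) x) u = aff (- (t + r)) x u"
  by (auto simp: aff_def fun_eq_iff algebra_simps)

lemma nn_integral_shift:
  assumes [measurable]: "f \<in> borel_measurable P"
  shows "(\<integral>\<^sup>+x. f (aff (- t) x u) \<partial>P) = (\<integral>\<^sup>+x. f x \<partial>P)"
  unfolding aff_eq_shift using nn_integral_aff[OF assms, of 1] by simp

text \<open>By Cauchy-Schwarz the square of the norm of convolution with \<open>q\<close> along a line is at most the
  \<open>L\<^sup>1\<close> norm of the autocorrelation of \<open>q\<close>; this avoids the Fourier transform.\<close>
lemma directional_L2_bound: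
  assumes f [measurable]: "f \<in> borel_measurable P" and f2: "integrable P (\<lambda>x. (f x)\<^sup>2)"
    and q: "integrable lborel q" and u [measurable]: "u \<in> space P"
    and B: "(\<integral>\<^sup>+r. ennreal \<bar>\<integral>t. q (t + r) * q t \<partial>lborel\<bar> \<partial>lborel) \<le> ennreal B" "0 \<le> B"
  shows "(\<integral>\<^sup>+x. ennreal ((\<integral>t. f (aff (- t) x u) * q t \<partial>lborel)\<^sup>2) \<partial>P) \<le> ennreal (B * (\<integral>x. (f x)\<^sup>2 \<partial>P))"
proof -
  define S where "S = (\<integral>x. (f x)\<^sup>2 \<partial>P)"
  have S0: "0 \<le> S" unfolding S_def by simp
  have S: "(\<integral>\<^sup>+x. ennreal ((f x)\<^sup>2 / 2) \<partial>P) = ennreal (S / 2)"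
    unfolding S_def using f2 by (subst nn_integral_eq_integral) auto
  have [measurable]: "q \<in> borel_measurable borel" using q by (simp add: integrable_iff_bounded)
  define a where "a x t = f (aff (- t) x u)" for x t
  have a_meas [measurable (raw)]: "(\<lambda>w. a (g w) (h w)) \<in> borel_measurable M"
    if [measurable]: "g \<in> measurable M P" "h \<in> borel_measurable M" for g h and M :: "'z measure"
    unfolding a_def by measurable
  interpret LL: pair_sigma_finite "lborel :: real measure" "lborel :: real measure" ..
  interpret L2: sigma_finite_measure "lborel \<Otimes>\<^sub>M lborel :: (real \<times> real) measure"
    by (rule sigma_finite_pair_measure) unfold_locales
  interpret X: pair_sigma_finite P "lborel \<Otimes>\<^sub>M lborel :: (real \<times> real) measure" ..
  \<comment> \<open>The pair \<open>rt\<close> is (r, t). Substituting s = t + r in the product of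
    two copies of the convolution integral turns its square into the integral of
    \<open>F x\<close>.\<close>
  define F where "F x rt = a x (snd rt + fst rt) * a x (snd rt) * (q (snd rt + fst rt) * q (snd rt))" for x and rt :: "real \<times> real"
  have Fm [measurable]: "case_prod F \<in> borel_measurable (P \<Otimes>\<^sub>M (lborel \<Otimes>\<^sub>M lborel))"
    unfolding F_def split_def by measurable
  have aS: "(\<integral>\<^sup>+x. ennreal ((a x t)\<^sup>2 / 2) \<partial>P) = ennreal (S / 2)" for t
    unfolding a_def S[symmetric] by (rule nn_integral_shift[of "\<lambda>x. ennreal ((f x)\<^sup>2 / 2)"]) measurable
  have aa: "(\<integral>\<^sup>+x. ennreal \<bar>a x s * a x t\<bar> \<partial>P) \<le> ennreal S" for s t
  proof -
    have "(\<integral>\<^sup>+x. ennreal \<bar>a x s * a x t\<bar> \<partial>P) \<le> (\<integral>\<^sup>+x. ennreal ((a x s)\<^sup>2 / 2) + ennreal ((a x t)\<^sup>2 / 2) \<partial>P)"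
    proof (rule nn_integral_mono)
      fix x
      have "0 \<le> (\<bar>a x s\<bar> - \<bar>a x t\<bar>)\<^sup>2" by simp
      then have "\<bar>a x s * a x t\<bar> \<le> (a x s)\<^sup>2 / 2 + (a x t)\<^sup>2 / 2" by (simp add: power2_diff abs_mult)
      then show "ennreal \<bar>a x s * a x t\<bar> \<le> ennreal ((a x s)\<^sup>2 / 2) + ennreal ((a x t)\<^sup>2 / 2)"
        by (simp add: ennreal_leI flip: ennreal_plus)
    qed
    also have "\<dots> = ennreal (S / 2) + ennreal (S / 2)"
      by (subst nn_integral_add) (simp_all add: aS)
    also have "\<dots> = ennreal S" using S0 by (simp flip: ennreal_plus)
    finally show ?thesis .
  qed
  have qq: "(\<integral>\<^sup>+rt. ennreal \<bar>q (snd rt + fst rt) * q (snd rt)\<bar> \<partial>(lborel \<Otimes>\<^sub>M lborel)) < \<infinity>"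
  proof -
    have "(\<integral>\<^sup>+rt. ennreal \<bar>q (snd rt + fst rt) * q (snd rt)\<bar> \<partial>(lborel \<Otimes>\<^sub>M lborel))
       = (\<integral>\<^sup>+t. \<integral>\<^sup>+r. ennreal \<bar>q (t + r) * q t\<bar> \<partial>lborel \<partial>lborel)"
      by (subst lborel_pair.nn_integral_snd[symmetric]) auto
    also have "\<dots> = (\<integral>\<^sup>+t. ennreal \<bar>q t\<bar> * (\<integral>\<^sup>+r. ennreal \<bar>q (t + r)\<bar> \<partial>lborel) \<partial>lborel)"
      by (subst nn_integral_cmult[symmetric]) (auto simp: abs_mult ennreal_mult mult.commute)
    also have "\<dots> = (\<integral>\<^sup>+t. ennreal \<bar>q t\<bar> * (\<integral>\<^sup>+r. ennreal \<bar>q r\<bar> \<partial>lborel) \<partial>lborel)"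
      using nn_integral_real_affine[of "\<lambda>r. ennreal \<bar>q r\<bar>" 1] by simp
    also have "\<dots> = (\<integral>\<^sup>+r. ennreal \<bar>q r\<bar> \<partial>lborel) * (\<integral>\<^sup>+r. ennreal \<bar>q r\<bar> \<partial>lborel)"
      by (simp add: nn_integral_multc)
    also have "\<dots> < \<infinity>" using q by (auto simp: integrable_iff_bounded ennreal_mult_less_top)
    finally show ?thesis .
  qed
  have Fint: "integrable (P \<Otimes>\<^sub>M (lborel \<Otimes>\<^sub>M lborel)) (case_prod F)"
  proof (rule integrableI_bounded)
    have "(\<integral>\<^sup>+z. ennreal (norm (case_prod F z)) \<partial>(P \<Otimes>\<^sub>M (lborel \<Otimes>\<^sub>M lborel)))
      = (\<integral>\<^sup>+rt. \<integral>\<^sup>+x. ennreal \<bar>F x rt\<bar> \<partial>P \<partial>(lborel \<Otimes>\<^sub>M lborel))"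
      by (subst X.nn_integral_snd[symmetric]) auto
    also have "\<dots> = (\<integral>\<^sup>+rt. ennreal \<bar>q (snd rt + fst rt) * q (snd rt)\<bar> * (\<integral>\<^sup>+x. ennreal \<bar>a x (snd rt + fst rt) * a x (snd rt)\<bar> \<partial>P) \<partial>(lborel \<Otimes>\<^sub>M lborel))"
      by (subst nn_integral_cmult[symmetric]) (auto simp: F_def abs_mult ennreal_mult[symmetric] mult.commute)
    also have "\<dots> \<le> (\<integral>\<^sup>+rt. ennreal \<bar>q (snd rt + fst rt) * q (snd rt)\<bar> * ennreal S \<partial>(lborel \<Otimes>\<^sub>M lborel))"
      by (intro nn_integral_mono mult_left_mono aa) auto
    also have "\<dots> = (\<integral>\<^sup>+rt. ennreal \<bar>q (snd rt + fst rt) * q (snd rt)\<bar> \<partial>(lborel \<Otimes>\<^sub>M lborel)) * ennreal S"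
      by (rule nn_integral_multc) measurable
    also have "\<dots> < \<infinity>" using qq by (simp add: ennreal_mult_less_top)
    finally show "(\<integral>\<^sup>+z. ennreal (norm (case_prod F z)) \<partial>(P \<Otimes>\<^sub>M (lborel \<Otimes>\<^sub>M lborel))) < \<infinity>" .
  qed measurable
  let ?h = "\<lambda>x. \<integral>t. a x t * q t \<partial>lborel"
  have hsq: "AE x in P. (?h x)\<^sup>2 = (\<integral>rt. F x rt \<partial>(lborel \<Otimes>\<^sub>M lborel))"
    using X.AE_integrable_fst'[OF Fint]
  proof eventually_elim
    case (elim x)
    then have i: "integrable (lborel \<Otimes>\<^sub>M lborel) (F x)" by simp
    have "(\<integral>rt. F x rt \<partial>(lborel \<Otimes>\<^sub>M lborel)) = (\<integral>t. \<integral>r. F x (r, t) \<partial>lborel \<partial>lborel)"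
      using lborel_pair.integral_snd[of "\<lambda>r t. F x (r, t)"] i by (simp add: split_def)
    also have "\<dots> = (\<integral>t. (a x t * q t) * (\<integral>r. a x (t + r) * q (t + r) \<partial>lborel) \<partial>lborel)"
      by (subst integral_mult_right_zero[symmetric]) (simp add: F_def mult_ac)
    also have "\<dots> = (\<integral>t. (a x t * q t) * ?h x \<partial>lborel)"
      using lborel_integral_real_affine[of 1 "\<lambda>t. a x t * q t"] by simp
    also have "\<dots> = (?h x)\<^sup>2" by (simp add: power2_eq_square)
    finally show ?case by simp
  qed
  \<comment> \<open>The autocorrelation of \<open>f\<close> along \<open>u\<close>. Translation
    invariance makes it depend on the lag \<open>r\<close> only, so absolute values are taken after
    the integration over \<open>t\<close>, around the autocorrelation of \<open>q\<close>, and the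
    cancellation in \<open>q\<close> is kept.\<close>
  define \<phi> where "\<phi> r = (\<integral>x. a x r * a x 0 \<partial>P)" for r
  have \<phi>: "(\<integral>x. a x (t + r) * a x t \<partial>P) = \<phi> r" for r t
  proof -
    have "\<phi> r = (\<integral>x. f (aff (- r) x u) * f (aff 0 x u) \<partial>P)" unfolding \<phi>_def a_def by simp
    also have "\<dots> = (\<integral>x. f (aff (- r) (aff 1 (\<lambda>i. - t * u i) x) u) * f (aff 0 (aff 1 (\<lambda>i. - t * u i) x) u) \<partial>P)"
      by (subst integral_aff[of _ 1 "\<lambda>i. - t * u i"]) auto
    also have "\<dots> = (\<integral>x. a x (t + r) * a x t \<partial>P)"
      using aff_shift_shift[of r t u] aff_shift_shift[of 0 t u] unfolding a_def by simp
    finally show ?thesis by simp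
  qed
  have \<phi>S: "\<bar>\<phi> r\<bar> \<le> S" for r
  proof -
    have "ennreal \<bar>\<phi> r\<bar> \<le> ennreal S" unfolding \<phi>_def by (rule order_trans[OF ennreal_abs_integral_le aa])
    then show ?thesis using S0 by (simp add: ennreal_le_iff)
  qed
  define \<rho> where "\<rho> r = (\<integral>t. q (t + r) * q t \<partial>lborel)" for r
  have Gint: "integrable (lborel \<Otimes>\<^sub>M lborel) (\<lambda>rt. \<integral>x. F x rt \<partial>P)"
    using X.integrable_snd[OF Fint] by simp
  have Geq: "(\<integral>x. F x rt \<partial>P) = \<phi> (fst rt) * (q (snd rt + fst rt) * q (snd rt))" for rt
    unfolding F_def \<phi>[of "snd rt" "fst rt", symmetric] by simp
  have "(\<integral>\<^sup>+x. ennreal ((?h x)\<^sup>2) \<partial>P) = (\<integral>\<^sup>+x. ennreal (\<integral>rt. F x rt \<partial>(lborel \<Otimes>\<^sub>M lborel)) \<partial>P)"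
    by (rule nn_integral_cong_AE) (use hsq in eventually_elim, simp)
  also have "\<dots> = ennreal (\<integral>x. (\<integral>rt. F x rt \<partial>(lborel \<Otimes>\<^sub>M lborel)) \<partial>P)"
  proof (rule nn_integral_eq_integral)
    show "integrable P (\<lambda>x. \<integral>rt. F x rt \<partial>(lborel \<Otimes>\<^sub>M lborel))" using X.integrable_fst[OF Fint] by simp
    show "AE x in P. 0 \<le> (\<integral>rt. F x rt \<partial>(lborel \<Otimes>\<^sub>M lborel))"
      using hsq by eventually_elim (metis zero_le_power2)
  qed
  also have "(\<integral>x. (\<integral>rt. F x rt \<partial>(lborel \<Otimes>\<^sub>M lborel)) \<partial>P) = (\<integral>rt. (\<integral>x. F x rt \<partial>P) \<partial>(lborel \<Otimes>\<^sub>M lborel))"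
    by (rule X.Fubini_integral[OF Fint, symmetric])
  also have "\<dots> = (\<integral>r. \<integral>t. \<phi> r * (q (t + r) * q t) \<partial>lborel \<partial>lborel)"
    using lborel_pair.integral_fst[of "\<lambda>r t. \<phi> r * (q (t + r) * q t)"] Gint unfolding Geq by (simp add: split_def)
  also have "\<dots> = (\<integral>r. \<phi> r * \<rho> r \<partial>lborel)" unfolding \<rho>_def by simp
  also have "ennreal (\<integral>r. \<phi> r * \<rho> r \<partial>lborel) \<le> ennreal \<bar>\<integral>r. \<phi> r * \<rho> r \<partial>lborel\<bar>" by (rule ennreal_leI) simp
  also have "\<dots> \<le> (\<integral>\<^sup>+r. ennreal \<bar>\<phi> r * \<rho> r\<bar> \<partial>lborel)" by (rule ennreal_abs_integral_le)
  also have "\<dots> \<le> (\<integral>\<^sup>+r. ennreal S * ennreal \<bar>\<rho> r\<bar> \<partial>lborel)"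
    using \<phi>S S0 by (intro nn_integral_mono) (auto simp: abs_mult ennreal_mult[symmetric] intro!: ennreal_leI mult_right_mono)
  also have "\<dots> = ennreal S * (\<integral>\<^sup>+r. ennreal \<bar>\<rho> r\<bar> \<partial>lborel)"
    unfolding \<rho>_def by (rule nn_integral_cmult) measurable
  also have "\<dots> \<le> ennreal S * ennreal B" unfolding \<rho>_def by (intro mult_left_mono B) auto
  also have "\<dots> = ennreal (B * S)" using S0 B by (simp add: mult.commute flip: ennreal_mult)
  finally show ?thesis unfolding a_def S_def .
qed

lemma integrable_directional:
  fixes f :: "(nat \<Rightarrow> real) \<Rightarrow> real" and q :: "real \<Rightarrow> real"
  assumes f: "integrable P f" and q: "integrable lborel q" and u [measurable]: "u \<in> space P"
  shows "integrable (P \<Otimes>\<^sub>M lborel) (\<lambda>(x, t). f (aff (- t) x u) * q t)"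
proof (rule integrableI_bounded)
  have [measurable]: "f \<in> borel_measurable P" "q \<in> borel_measurable borel"
    using f q by (auto simp: integrable_iff_bounded)
  have "(\<integral>\<^sup>+z. ennreal (norm (case z of (x, t) \<Rightarrow> f (aff (- t) x u) * q t)) \<partial>(P \<Otimes>\<^sub>M lborel))
    = (\<integral>\<^sup>+t. \<integral>\<^sup>+x. ennreal \<bar>f (aff (- t) x u) * q t\<bar> \<partial>P \<partial>lborel)"
    by (subst PL.nn_integral_snd[symmetric]) auto
  also have "\<dots> = (\<integral>\<^sup>+t. (\<integral>\<^sup>+x. ennreal \<bar>f (aff (- t) x u)\<bar> \<partial>P) * ennreal \<bar>q t\<bar> \<partial>lborel)"
    by (subst nn_integral_multc[symmetric]) (auto simp: abs_mult ennreal_mult)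
  also have "\<dots> = (\<integral>\<^sup>+t. (\<integral>\<^sup>+x. ennreal \<bar>f x\<bar> \<partial>P) * ennreal \<bar>q t\<bar> \<partial>lborel)"
    by (subst nn_integral_shift[of "\<lambda>x. ennreal \<bar>f x\<bar>"]) auto
  also have "\<dots> = (\<integral>\<^sup>+x. ennreal \<bar>f x\<bar> \<partial>P) * (\<integral>\<^sup>+t. ennreal \<bar>q t\<bar> \<partial>lborel)"
    by (rule nn_integral_cmult) measurable
  also have "\<dots> < \<infinity>" using f q by (auto simp: integrable_iff_bounded ennreal_mult_less_top)
  finally show "(\<integral>\<^sup>+z. ennreal (norm (case z of (x, t) \<Rightarrow> f (aff (- t) x u) * q t)) \<partial>(P \<Otimes>\<^sub>M lborel)) < \<infinity>" .
  show "(\<lambda>(x, t). f (aff (- t) x u) * q t) \<in> borel_measurable (P \<Otimes>\<^sub>M lborel)" by measurable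
qed

text \<open>Twice the two autocorrelation bounds 4 pi^2 and 4 pi^4, the factor 2 coming from (x +
  y)^2 \<le> 2 x^2 + 2 y^2.\<close>

definition B0 :: real where "B0 = 8 * pi\<^sup>2 + 8 * pi ^ 4"

text \<open>Splitting off \<open>conj_pois\<close> separates the part that needs cancellation, whose
  autocorrelation is explicit, from a remainder of L^1 norm at most 2 pi^2, for which absolute
  values suffice.\<close>

lemma directional_L2_gauss_cut:
  assumes f: "integrable P f" and f2: "integrable P (\<lambda>x. (f x)\<^sup>2)"
    and u [measurable]: "u \<in> space P" and a: "a > 0" and b: "b > 0"
  shows "(\<integral>\<^sup>+x. ennreal ((\<integral>t. f (aff (- t) x u) * (gauss_cut a t - gauss_cut b t) \<partial>lborel)\<^sup>2) \<partial>P)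
    \<le> ennreal (B0 * (\<integral>x. (f x)\<^sup>2 \<partial>P))"
proof -
  have [measurable]: "f \<in> borel_measurable P" using f by simp
  define S where "S = (\<integral>x. (f x)\<^sup>2 \<partial>P)"
  have S0: "0 \<le> S" unfolding S_def by simp
  define q1 where "q1 t = conj_pois a t - conj_pois b t" for t
  define d where "d t = (gauss_cut a t - conj_pois a t) - (gauss_cut b t - conj_pois b t)" for t
  have [measurable]: "q1 \<in> borel_measurable borel" "d \<in> borel_measurable borel"
    unfolding q1_def d_def by measurable
  have q1: "integrable lborel q1" unfolding q1_def by (rule integrable_conj_pois_diff[OF a b])
  have cauchy: "(\<integral>\<^sup>+t. ennreal (pi * (c / (t\<^sup>2 + c\<^sup>2))) \<partial>lborel) = ennreal (pi\<^sup>2)" if "c > 0" for c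
    using has_bochner_integral_mult_right[OF has_bochner_integral_Cauchy_density[OF that], of pi] that
    by (subst nn_integral_eq_integral) (auto simp: has_bochner_integral_iff power2_eq_square)
  have dnn: "(\<integral>\<^sup>+t. ennreal \<bar>d t\<bar> \<partial>lborel) \<le> ennreal (2 * pi\<^sup>2)"
  proof -
    have "(\<integral>\<^sup>+t. ennreal \<bar>d t\<bar> \<partial>lborel) \<le> (\<integral>\<^sup>+t. ennreal (pi * (a / (t\<^sup>2 + a\<^sup>2))) + ennreal (pi * (b / (t\<^sup>2 + b\<^sup>2))) \<partial>lborel)"
    proof (rule nn_integral_mono)
      fix t
      have "\<bar>d t\<bar> \<le> pi * (a / (t\<^sup>2 + a\<^sup>2)) + pi * (b / (t\<^sup>2 + b\<^sup>2))"
        unfolding d_def using gauss_cut_minus_conj_pois_le[OF a, of t] gauss_cut_minus_conj_pois_le[OF b, of t] by linarith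
      moreover have "0 \<le> pi * (a / (t\<^sup>2 + a\<^sup>2))" "0 \<le> pi * (b / (t\<^sup>2 + b\<^sup>2))" using a b by auto
      ultimately show "ennreal \<bar>d t\<bar> \<le> ennreal (pi * (a / (t\<^sup>2 + a\<^sup>2))) + ennreal (pi * (b / (t\<^sup>2 + b\<^sup>2)))"
        by (simp only: ennreal_plus[symmetric] ennreal_leI)
    qed
    also have "\<dots> = (\<integral>\<^sup>+t. ennreal (pi * (a / (t\<^sup>2 + a\<^sup>2))) \<partial>lborel) + (\<integral>\<^sup>+t. ennreal (pi * (b / (t\<^sup>2 + b\<^sup>2))) \<partial>lborel)"
      by (rule nn_integral_add) auto
    also have "\<dots> = ennreal (2 * pi\<^sup>2)" unfolding cauchy[OF a] cauchy[OF b] by (simp flip: ennreal_plus)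
    finally show ?thesis .
  qed
  have d: "integrable lborel d"
    using order_le_less_trans[OF dnn] by (intro integrableI_bounded) auto
  have rho1: "(\<integral>\<^sup>+r. ennreal \<bar>\<integral>t. q1 (t + r) * q1 t \<partial>lborel\<bar> \<partial>lborel) \<le> ennreal (4 * pi\<^sup>2)"
  proof -
    have "(\<integral>t. q1 (t + r) * q1 t \<partial>lborel) = (\<integral>t. q1 t * q1 (t - r) \<partial>lborel)" for r
      by (subst (2) lborel_integral_real_affine[of 1 _ r]) (auto simp: add.commute)
    then show ?thesis using nn_integral_autocorrelation_conj_pois_diff[OF a b] unfolding q1_def by simp
  qed
  have rho2: "(\<integral>\<^sup>+r. ennreal \<bar>\<integral>t. d (t + r) * d t \<partial>lborel\<bar> \<partial>lborel) \<le> ennreal (4 * pi ^ 4)"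
  proof -
    interpret LL: pair_sigma_finite "lborel :: real measure" "lborel :: real measure" ..
    have "(\<integral>\<^sup>+r. ennreal \<bar>\<integral>t. d (t + r) * d t \<partial>lborel\<bar> \<partial>lborel) \<le> (\<integral>\<^sup>+r. \<integral>\<^sup>+t. ennreal \<bar>d (t + r) * d t\<bar> \<partial>lborel \<partial>lborel)"
      by (intro nn_integral_mono ennreal_abs_integral_le)
    also have "\<dots> = (\<integral>\<^sup>+t. \<integral>\<^sup>+r. ennreal \<bar>d (t + r) * d t\<bar> \<partial>lborel \<partial>lborel)"
      by (rule lborel_pair.Fubini') measurable
    also have "\<dots> = (\<integral>\<^sup>+t. ennreal \<bar>d t\<bar> * (\<integral>\<^sup>+r. ennreal \<bar>d (t + r)\<bar> \<partial>lborel) \<partial>lborel)"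
      by (subst nn_integral_cmult[symmetric]) (auto simp: abs_mult ennreal_mult mult.commute)
    also have "\<dots> = (\<integral>\<^sup>+t. ennreal \<bar>d t\<bar> * (\<integral>\<^sup>+r. ennreal \<bar>d r\<bar> \<partial>lborel) \<partial>lborel)"
      using nn_integral_real_affine[of "\<lambda>r. ennreal \<bar>d r\<bar>" 1] by simp
    also have "\<dots> = (\<integral>\<^sup>+r. ennreal \<bar>d r\<bar> \<partial>lborel) * (\<integral>\<^sup>+r. ennreal \<bar>d r\<bar> \<partial>lborel)"
      by (simp add: nn_integral_multc)
    also have "\<dots> \<le> ennreal (2 * pi\<^sup>2) * ennreal (2 * pi\<^sup>2)" by (intro mult_mono dnn) auto
    also have "\<dots> = ennreal (4 * pi ^ 4)" by (simp add: power2_eq_square power4_eq_xxxx mult_ac flip: ennreal_mult)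
    finally show ?thesis .
  qed
  let ?h = "\<lambda>q x. \<integral>t. f (aff (- t) x u) * q t \<partial>lborel"
  have split: "AE x in P. ennreal ((?h (\<lambda>t. gauss_cut a t - gauss_cut b t) x)\<^sup>2) \<le> 2 * ennreal ((?h q1 x)\<^sup>2) + 2 * ennreal ((?h d x)\<^sup>2)"
    using PL.AE_integrable_fst'[OF integrable_directional[OF f q1 u]] PL.AE_integrable_fst'[OF integrable_directional[OF f d u]]
  proof eventually_elim
    case (elim x)
    have "?h (\<lambda>t. gauss_cut a t - gauss_cut b t) x = (\<integral>t. f (aff (- t) x u) * q1 t + f (aff (- t) x u) * d t \<partial>lborel)"
      by (rule Bochner_Integration.integral_cong) (auto simp: q1_def d_def algebra_simps)
    also have "\<dots> = ?h q1 x + ?h d x" using elim by simp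
    finally have "(?h (\<lambda>t. gauss_cut a t - gauss_cut b t) x)\<^sup>2 \<le> 2 * (?h q1 x)\<^sup>2 + 2 * (?h d x)\<^sup>2"
      using sum_squares_bound[of "?h q1 x" "?h d x"] by (simp add: power2_sum)
    then have "ennreal ((?h (\<lambda>t. gauss_cut a t - gauss_cut b t) x)\<^sup>2) \<le> ennreal (2 * (?h q1 x)\<^sup>2 + 2 * (?h d x)\<^sup>2)"
      by (rule ennreal_leI)
    then show ?case by (simp only: ennreal_plus ennreal_mult ennreal_numeral zero_le_numeral zero_le_power2 mult_nonneg_nonneg)
  qed
  have [measurable]: "(\<lambda>x. ?h q1 x) \<in> borel_measurable P" "(\<lambda>x. ?h d x) \<in> borel_measurable P"
    by measurable
  have "(\<integral>\<^sup>+x. ennreal ((?h (\<lambda>t. gauss_cut a t - gauss_cut b t) x)\<^sup>2) \<partial>P)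
     \<le> (\<integral>\<^sup>+x. 2 * ennreal ((?h q1 x)\<^sup>2) + 2 * ennreal ((?h d x)\<^sup>2) \<partial>P)"
    by (rule nn_integral_mono_AE[OF split])
  also have "\<dots> = 2 * (\<integral>\<^sup>+x. ennreal ((?h q1 x)\<^sup>2) \<partial>P) + 2 * (\<integral>\<^sup>+x. ennreal ((?h d x)\<^sup>2) \<partial>P)"
    by (simp add: nn_integral_add nn_integral_cmult)
  also have "\<dots> \<le> 2 * ennreal (4 * pi\<^sup>2 * S) + 2 * ennreal (4 * pi ^ 4 * S)"
    unfolding S_def
    by (intro add_mono mult_left_mono directional_L2_bound f2 q1 d u rho1 rho2) auto
  also have "\<dots> = ennreal (2 * (4 * pi\<^sup>2 * S) + 2 * (4 * pi ^ 4 * S))"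
  proof -
    have t: "2 * ennreal z = ennreal (2 * z)" if "0 \<le> z" for z using that by (simp add: ennreal_mult)
    have "0 \<le> 4 * pi\<^sup>2 * S" "0 \<le> 4 * pi ^ 4 * S" using S0 by auto
    then show ?thesis by (simp only: t ennreal_plus mult_nonneg_nonneg zero_le_numeral)
  qed
  also have "\<dots> = ennreal (B0 * S)" by (simp add: B0_def algebra_simps)
  finally show ?thesis unfolding S_def .
qed

section \<open>Method of rotations for conjugate Poisson kernels\<close>

lemma measurable_eucl_norm [measurable (raw)]:
  assumes "f \<in> measurable M P" shows "(\<lambda>w. eucl_norm n (f w)) \<in> borel_measurable M"
  unfolding eucl_norm_def using assms[THEN measurable_coord] by measurable

lemma edist_aff: "edist x (aff (- t) x u) = \<bar>t\<bar> * eucl_norm n u"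
proof -
  have "(\<Sum>i<n. (x i - aff (- t) x u i)\<^sup>2) = t\<^sup>2 * (\<Sum>i<n. (u i)\<^sup>2)"
    unfolding sum_distrib_left by (rule sum.cong) (auto simp: aff_def power_mult_distrib)
  then show ?thesis unfolding edist_def eucl_norm_def by (simp add: real_sqrt_mult)
qed

text \<open>The weight left on the direction \<open>u\<close> after the substitution: the coordinate
  comes from the numerator of the kernel, the Gaussian from subordination.\<close>

definition gw :: "(nat \<Rightarrow> real) \<Rightarrow> real" where
  "gw u = u j * exp (- (pi * (eucl_norm n u)\<^sup>2))"

lemma measurable_gw [measurable (raw)]:
  assumes [measurable]: "f \<in> measurable M P" shows "(\<lambda>w. gw (f w)) \<in> borel_measurable M"
proof -
  note [measurable] = measurable_coord_j[OF assms]
  show ?thesis unfolding gw_def by measurable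
qed

text \<open>Substitute \<open>y = x - t u\<close>, that is, \<open>u = (x - y) / t\<close>, for fixed \<open>t\<close>: the Gaussian weights combine to
  the integrand of the subordination formula.\<close>
lemma cpois_rotation:
  assumes f: "integrable P f" and x [measurable]: "x \<in> space P" and a: "a > 0" and b: "b > 0"
  shows "(\<integral>y. (cpois a x y - cpois b x y) * f y \<partial>P)
    = (\<integral>u. gw u * (\<integral>t. f (aff (- t) x u) * (gauss_cut a t - gauss_cut b t) \<partial>lborel) \<partial>P)"
proof -
  have [measurable]: "f \<in> borel_measurable P" using f by simp
  define e where "e c y t = exp (- (pi * (c\<^sup>2 + (edist x y)\<^sup>2) / t\<^sup>2)) / \<bar>t\<bar> ^ (n + 2)" for c y t
  have [measurable (raw)]: "(\<lambda>w. e c (g w) (h w)) \<in> borel_measurable M"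
    if [measurable]: "g \<in> measurable M P" "h \<in> borel_measurable M" for g h c and M :: "'z measure"
    unfolding e_def by measurable
  have e0: "0 \<le> e c y t" for c y t unfolding e_def by simp
  have enn: "(\<integral>\<^sup>+t. ennreal (e c y t) \<partial>lborel) = ennreal (cn / sqrt (c\<^sup>2 + (edist x y)\<^sup>2) ^ (n + 1))" if "c > 0" for c y
    unfolding e_def using that by (intro nn_integral_subordination) (auto intro: add_pos_nonneg)
  have eint: "integrable lborel (e c y)" if [measurable]: "c > 0" "y \<in> space P" for c y
    by (rule integrableI_nonneg) (use enn[OF that(1), of y] e0 in auto)
  have eI: "(\<integral>t. e c y t \<partial>lborel) = cn / sqrt (c\<^sup>2 + (edist x y)\<^sup>2) ^ (n + 1)" if [measurable]: "c > 0" "y \<in> space P" for c y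
    by (subst integral_eq_nn_integral) (use enn[OF that(1), of y] e0 less_imp_le[OF cn_pos] in auto)
  define Z where "Z y t = f y * (x j - y j) * (e a y t - e b y t)" for y t
  have [measurable]: "(\<lambda>z. fst z j) \<in> borel_measurable (P \<Otimes>\<^sub>M (lborel :: real measure))"
    by (rule measurable_coord_j) measurable
  have [measurable]: "case_prod Z \<in> borel_measurable (P \<Otimes>\<^sub>M lborel)" unfolding Z_def split_def by measurable
  have Zint: "integrable (P \<Otimes>\<^sub>M lborel) (case_prod Z)"
  proof (rule integrableI_bounded)
    have "(\<integral>\<^sup>+z. ennreal (norm (case_prod Z z)) \<partial>(P \<Otimes>\<^sub>M lborel)) = (\<integral>\<^sup>+y. \<integral>\<^sup>+t. ennreal \<bar>Z y t\<bar> \<partial>lborel \<partial>P)"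
      by (subst lborel.nn_integral_fst[symmetric]) auto
    also have "\<dots> \<le> (\<integral>\<^sup>+y. ennreal ((cn / a ^ n + cn / b ^ n) * \<bar>f y\<bar>) \<partial>P)"
    proof (rule nn_integral_mono)
      fix y assume y [measurable]: "y \<in> space P"
      let ?c = "\<bar>f y\<bar> * \<bar>x j - y j\<bar>"
      have "(\<integral>\<^sup>+t. ennreal \<bar>Z y t\<bar> \<partial>lborel) \<le> (\<integral>\<^sup>+t. ennreal ?c * (ennreal (e a y t) + ennreal (e b y t)) \<partial>lborel)"
      proof (rule nn_integral_mono)
        fix t
        have "\<bar>Z y t\<bar> \<le> ?c * (e a y t + e b y t)"
          unfolding Z_def abs_mult using e0[of a y t] e0[of b y t] by (intro mult_left_mono) auto
        then show "ennreal \<bar>Z y t\<bar> \<le> ennreal ?c * (ennreal (e a y t) + ennreal (e b y t))"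
          using e0[of a y t] e0[of b y t] by (simp add: ennreal_leI flip: ennreal_mult ennreal_plus)
      qed
      also have "\<dots> = ennreal ?c * (ennreal (cn / sqrt (a\<^sup>2 + (edist x y)\<^sup>2) ^ (n + 1)) + ennreal (cn / sqrt (b\<^sup>2 + (edist x y)\<^sup>2) ^ (n + 1)))"
      proof -
        have "(\<integral>\<^sup>+t. ennreal ?c * (ennreal (e a y t) + ennreal (e b y t)) \<partial>lborel) = ennreal ?c * (\<integral>\<^sup>+t. ennreal (e a y t) + ennreal (e b y t) \<partial>lborel)"
          by (rule nn_integral_cmult) measurable
        also have "(\<integral>\<^sup>+t. ennreal (e a y t) + ennreal (e b y t) \<partial>lborel) = (\<integral>\<^sup>+t. ennreal (e a y t) \<partial>lborel) + (\<integral>\<^sup>+t. ennreal (e b y t) \<partial>lborel)"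
          by (rule nn_integral_add) measurable
        finally show ?thesis by (simp only: enn[OF a] enn[OF b])
      qed
      also have "\<dots> = ennreal (\<bar>f y\<bar> * (\<bar>cpois a x y\<bar> + \<bar>cpois b x y\<bar>))"
      proof -
        have s0: "0 \<le> sqrt (c\<^sup>2 + (edist x y)\<^sup>2)" for c by simp
        have c: "\<bar>cpois c x y\<bar> = \<bar>x j - y j\<bar> * (cn / sqrt (c\<^sup>2 + (edist x y)\<^sup>2) ^ (n + 1))" for c
          unfolding cpois_def abs_divide abs_mult power_abs using s0[of c] less_imp_le[OF cn_pos] by simp
        have p: "0 \<le> cn / sqrt (c\<^sup>2 + (edist x y)\<^sup>2) ^ (n + 1)" for c
          using less_imp_le[OF cn_pos] s0[of c] by (intro divide_nonneg_nonneg zero_le_power) auto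
        show ?thesis unfolding c
          by (subst ennreal_plus[symmetric], rule p, rule p, subst ennreal_mult[symmetric], simp, rule add_nonneg_nonneg[OF p p])
             (simp only: mult.assoc distrib_left)
      qed
      also have "\<dots> \<le> ennreal ((cn / a ^ n + cn / b ^ n) * \<bar>f y\<bar>)"
      proof (rule ennreal_leI)
        have "\<bar>f y\<bar> * (\<bar>cpois a x y\<bar> + \<bar>cpois b x y\<bar>) \<le> \<bar>f y\<bar> * (cn / a ^ n + cn / b ^ n)"
          by (intro mult_left_mono add_mono abs_cpois_le a b) auto
        then show "\<bar>f y\<bar> * (\<bar>cpois a x y\<bar> + \<bar>cpois b x y\<bar>) \<le> (cn / a ^ n + cn / b ^ n) * \<bar>f y\<bar>" by (simp only: mult.commute)
      qed
      finally show "(\<integral>\<^sup>+t. ennreal \<bar>Z y t\<bar> \<partial>lborel) \<le> ennreal ((cn / a ^ n + cn / b ^ n) * \<bar>f y\<bar>)" .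
    qed
    also have "\<dots> < \<infinity>"
    proof -
      have "integrable P (\<lambda>y. (cn / a ^ n + cn / b ^ n) * \<bar>f y\<bar>)" using f by (intro integrable_mult_right) auto
      moreover have "AE y in P. 0 \<le> (cn / a ^ n + cn / b ^ n) * \<bar>f y\<bar>"
        using a b less_imp_le[OF cn_pos] by (intro AE_I2 mult_nonneg_nonneg add_nonneg_nonneg divide_nonneg_nonneg) auto
      ultimately show ?thesis by (simp only: nn_integral_eq_integral ennreal_less_top infinity_ennreal_def)
    qed
    finally show "(\<integral>\<^sup>+z. ennreal (norm (case_prod Z z)) \<partial>(P \<Otimes>\<^sub>M lborel)) < \<infinity>" .
  qed measurable
  \<comment> \<open>The Jacobian |t|^n and the factor \<open>t\<close> in
    \<open>x j - y j = t * u j\<close> meet the |t|^(n+2) of the subordination formula; what remains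
    is the 1/t of \<open>gauss_cut\<close>.\<close>
  have ZW: "\<bar>- t\<bar> ^ n * Z (aff (- t) x u) t = gw u * (f (aff (- t) x u) * (gauss_cut a t - gauss_cut b t))"
    if t: "t \<noteq> 0" for t u
  proof -
    have xj: "x j - aff (- t) x u j = t * u j" using j_less by (simp add: aff_def)
    have e': "e c (aff (- t) x u) t = exp (- (pi * c\<^sup>2 / t\<^sup>2)) * exp (- (pi * (eucl_norm n u)\<^sup>2)) / \<bar>t\<bar> ^ (n + 2)" for c
    proof -
      have "pi * (c\<^sup>2 + (edist x (aff (- t) x u))\<^sup>2) / t\<^sup>2 = pi * c\<^sup>2 / t\<^sup>2 + pi * (eucl_norm n u)\<^sup>2"
        unfolding edist_aff using t by (simp add: power_mult_distrib field_simps)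
      then show ?thesis unfolding e_def by (simp add: exp_add[symmetric])
    qed
    have p: "\<bar>t\<bar> ^ n * (t * (c / \<bar>t\<bar> ^ (n + 2))) = c / t" for c
      using t by (simp add: power_add power2_eq_square)
    have "\<bar>- t\<bar> ^ n * Z (aff (- t) x u) t = f (aff (- t) x u) * u j * (\<bar>t\<bar> ^ n * (t * (e a (aff (- t) x u) t)) - \<bar>t\<bar> ^ n * (t * (e b (aff (- t) x u) t)))"
      unfolding Z_def xj by (simp add: algebra_simps)
    also have "\<dots> = gw u * (f (aff (- t) x u) * (gauss_cut a t - gauss_cut b t))"
      unfolding e' p gw_def gauss_cut_def by (simp add: algebra_simps)
    finally show ?thesis .
  qed
  have "(\<integral>y. (cpois a x y - cpois b x y) * f y \<partial>P) = (\<integral>y. \<integral>t. Z y t \<partial>lborel \<partial>P)"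
  proof (rule Bochner_Integration.integral_cong[OF refl])
    fix y assume y: "y \<in> space P"
    have "(\<integral>t. Z y t \<partial>lborel) = f y * (x j - y j) * ((\<integral>t. e a y t \<partial>lborel) - (\<integral>t. e b y t \<partial>lborel))"
      unfolding Z_def using eint[OF a y] eint[OF b y] by simp
    also have "\<dots> = (cpois a x y - cpois b x y) * f y"
      unfolding eI[OF a y] eI[OF b y] cpois_def by (simp add: algebra_simps)
    finally show "(cpois a x y - cpois b x y) * f y = (\<integral>t. Z y t \<partial>lborel)" by simp
  qed
  also have "\<dots> = (\<integral>t. \<integral>y. Z y t \<partial>P \<partial>lborel)" by (rule PL.Fubini_integral[OF Zint, symmetric])
  also have "\<dots> = (\<integral>t. \<integral>u. gw u * (f (aff (- t) x u) * (gauss_cut a t - gauss_cut b t)) \<partial>P \<partial>lborel)"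
    (is "_ = (\<integral>t. \<integral>u. ?W u t \<partial>P \<partial>lborel)")
  proof (rule integral_cong_AE)
    show "AE t in lborel. (\<integral>y. Z y t \<partial>P) = (\<integral>u. ?W u t \<partial>P)"
    proof (rule AE_mp[OF AE_lborel_singleton[of 0]], intro AE_I2 impI)
      fix t :: real assume t: "t \<noteq> 0"
      have "(\<integral>y. Z y t \<partial>P) = \<bar>- t\<bar> ^ n * (\<integral>u. Z (aff (- t) x u) t \<partial>P)"
        using t by (intro integral_aff) auto
      also have "\<dots> = (\<integral>u. \<bar>- t\<bar> ^ n * Z (aff (- t) x u) t \<partial>P)" by (rule integral_mult_right_zero[symmetric])
      also have "\<dots> = (\<integral>u. ?W u t \<partial>P)" using ZW[OF t] by simp
      finally show "(\<integral>y. Z y t \<partial>P) = (\<integral>u. ?W u t \<partial>P)" .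
    qed
  qed measurable
  also have "\<dots> = (\<integral>u. \<integral>t. ?W u t \<partial>lborel \<partial>P)"
  proof (rule PL.Fubini_integral, rule integrableI_bounded)
    \<comment> \<open>Absolute integrability in (u, t) is that of \<open>Z\<close> in (y, t),
      carried over by the same substitution for each fixed \<open>t\<close>.\<close>
    have "(\<integral>\<^sup>+z. ennreal (norm (case z of (u, t) \<Rightarrow> ?W u t)) \<partial>(P \<Otimes>\<^sub>M lborel)) = (\<integral>\<^sup>+t. \<integral>\<^sup>+u. ennreal \<bar>?W u t\<bar> \<partial>P \<partial>lborel)"
      by (subst PL.nn_integral_snd[symmetric]) auto
    also have "\<dots> = (\<integral>\<^sup>+t. \<integral>\<^sup>+y. ennreal \<bar>Z y t\<bar> \<partial>P \<partial>lborel)"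
    proof (rule nn_integral_cong_AE, rule AE_mp[OF AE_lborel_singleton[of 0]], intro AE_I2 impI)
      fix t :: real assume t: "t \<noteq> 0"
      have "(\<integral>\<^sup>+y. ennreal \<bar>Z y t\<bar> \<partial>P) = ennreal (\<bar>- t\<bar> ^ n) * (\<integral>\<^sup>+u. ennreal \<bar>Z (aff (- t) x u) t\<bar> \<partial>P)"
        using t by (intro nn_integral_aff) auto
      also have "\<dots> = (\<integral>\<^sup>+u. ennreal (\<bar>- t\<bar> ^ n) * ennreal \<bar>Z (aff (- t) x u) t\<bar> \<partial>P)"
        by (rule nn_integral_cmult[symmetric]) measurable
      also have "\<dots> = (\<integral>\<^sup>+u. ennreal \<bar>?W u t\<bar> \<partial>P)"
        unfolding ZW[OF t, symmetric] by (simp add: abs_mult ennreal_mult power_abs)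
      finally show "(\<integral>\<^sup>+u. ennreal \<bar>?W u t\<bar> \<partial>P) = (\<integral>\<^sup>+y. ennreal \<bar>Z y t\<bar> \<partial>P)" by simp
    qed
    also have "\<dots> = (\<integral>\<^sup>+z. ennreal (norm (case_prod Z z)) \<partial>(P \<Otimes>\<^sub>M lborel))"
      by (subst PL.nn_integral_snd[symmetric]) auto
    also have "\<dots> < \<infinity>" using Zint by (simp add: integrable_iff_bounded)
    finally show "(\<integral>\<^sup>+z. ennreal (norm (case z of (u, t) \<Rightarrow> ?W u t)) \<partial>(P \<Otimes>\<^sub>M lborel)) < \<infinity>" .
  qed measurable
  finally show ?thesis by simp
qed

text \<open>A crude bound: |z| \<le> exp (z^2), and since pi - 1 \<ge> pi / 4 the product stays
  below a Gaussian of width 2.\<close>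

lemma nn_integral_abs_gauss_le: "(\<integral>\<^sup>+z. ennreal (\<bar>z\<bar> * exp (- (pi * z\<^sup>2))) \<partial>lborel) \<le> 2"
proof -
  have "\<bar>z\<bar> * exp (- (pi * z\<^sup>2)) \<le> exp (- (pi * (z - 0)\<^sup>2 / 2\<^sup>2))" for z :: real
  proof -
    have "\<bar>z\<bar> \<le> 1 + z\<^sup>2"
      using sum_squares_bound[of "\<bar>z\<bar>" 1] abs_ge_zero[of z] unfolding power2_abs one_power2 mult_1_right by linarith
    also have "\<dots> \<le> exp (z\<^sup>2)" by (rule exp_ge_add_one_self)
    finally have "\<bar>z\<bar> * exp (- (pi * z\<^sup>2)) \<le> exp (z\<^sup>2) * exp (- (pi * z\<^sup>2))" by (intro mult_right_mono) auto
    also have "\<dots> = exp (- ((pi - 1) * z\<^sup>2))" by (simp add: algebra_simps flip: exp_add)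
    also have "\<dots> \<le> exp (- (pi / 4 * z\<^sup>2))" using pi_gt3 mult_right_mono[of "pi / 4" "pi - 1" "z\<^sup>2"] by simp
    finally show ?thesis by simp
  qed
  then have "(\<integral>\<^sup>+z. ennreal (\<bar>z\<bar> * exp (- (pi * z\<^sup>2))) \<partial>lborel) \<le> (\<integral>\<^sup>+z. ennreal (exp (- (pi * (z - 0)\<^sup>2 / 2\<^sup>2))) \<partial>lborel)"
    by (intro nn_integral_mono ennreal_leI)
  also have "\<dots> = 2" by (subst nn_integral_gaussian_scaled) auto
  finally show ?thesis .
qed

text \<open>Here the dimension drops out: every coordinate other than \<open>j\<close> contributes a
  Gaussian integral equal to 1.\<close>

lemma nn_integral_gw_le: "(\<integral>\<^sup>+u. ennreal \<bar>gw u\<bar> \<partial>P) \<le> 2"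
proof -
  define g where "g i z = (if i = j then \<bar>z\<bar> else 1) * exp (- (pi * z\<^sup>2))" for i and z :: real
  have g0: "0 \<le> g i z" for i z unfolding g_def by simp
  have "\<bar>gw u\<bar> = (\<Prod>i<n. g i (u i))" for u
  proof -
    have "(eucl_norm n u)\<^sup>2 = (\<Sum>i<n. (u i)\<^sup>2)" unfolding eucl_norm_def by (simp add: sum_nonneg)
    then have "exp (- (pi * (eucl_norm n u)\<^sup>2)) = (\<Prod>i<n. exp (- (pi * (u i)\<^sup>2)))"
      by (simp add: sum_distrib_left exp_sum flip: sum_negf)
    moreover have "(\<Prod>i<n. if i = j then \<bar>u i\<bar> else 1) = \<bar>u j\<bar>" using j_less by (simp add: prod.delta)
    ultimately show ?thesis unfolding gw_def g_def prod.distrib abs_mult abs_exp_cancel by simp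
  qed
  then have "(\<integral>\<^sup>+u. ennreal \<bar>gw u\<bar> \<partial>P) = (\<integral>\<^sup>+u. (\<Prod>i<n. ennreal (g i (u i))) \<partial>P)"
    by (simp add: prod_ennreal g0)
  also have "\<dots> = (\<Prod>i<n. \<integral>\<^sup>+z. ennreal (g i z) \<partial>lborel)"
    by (rule lborel_product.product_nn_integral_prod) (auto simp: g_def)
  also have "\<dots> = (\<Prod>i<n. if i = j then (\<integral>\<^sup>+z. ennreal (\<bar>z\<bar> * exp (- (pi * z\<^sup>2))) \<partial>lborel) else 1)"
    using nn_integral_gaussian_scaled[of 1 0] by (intro prod.cong) (auto simp: g_def)
  also have "\<dots> \<le> 2" using j_less nn_integral_abs_gauss_le by (simp add: prod.delta)
  finally show ?thesis .
qed

text \<open>Cauchy-Schwarz with respect to the weight |gw|, of mass at most 2, moves the square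
  inside the average over directions; integrating the weight afterwards gives the second factor
  2.\<close>

lemma cpois_diff_L2:
  assumes f: "integrable P f" and f2: "integrable P (\<lambda>x. (f x)\<^sup>2)" and a: "a > 0" and b: "b > 0"
  shows "(\<integral>\<^sup>+x. ennreal ((\<integral>y. (cpois a x y - cpois b x y) * f y \<partial>P)\<^sup>2) \<partial>P) \<le> ennreal (4 * B0 * (\<integral>x. (f x)\<^sup>2 \<partial>P))"
proof -
  have [measurable]: "f \<in> borel_measurable P" using f by simp
  define S where "S = (\<integral>x. (f x)\<^sup>2 \<partial>P)"
  have S0: "0 \<le> S" unfolding S_def by simp
  have B0: "0 \<le> B0" unfolding B0_def by simp
  define h where "h x u = (\<integral>t. f (aff (- t) x u) * (gauss_cut a t - gauss_cut b t) \<partial>lborel)" for x u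
  have [measurable]: "case_prod h \<in> borel_measurable (P \<Otimes>\<^sub>M P)" unfolding h_def by measurable
  have "ennreal ((\<integral>y. (cpois a x y - cpois b x y) * f y \<partial>P)\<^sup>2) \<le> 2 * (\<integral>\<^sup>+u. ennreal \<bar>gw u\<bar> * ennreal ((h x u)\<^sup>2) \<partial>P)"
    if x [measurable]: "x \<in> space P" for x
  proof -
    have "ennreal ((\<integral>y. (cpois a x y - cpois b x y) * f y \<partial>P)\<^sup>2) = (ennreal \<bar>\<integral>u. gw u * h x u \<partial>P\<bar>)\<^sup>2"
      unfolding cpois_rotation[OF f x a b] h_def by (simp add: ennreal_power)
    also have "\<dots> \<le> (\<integral>\<^sup>+u. ennreal \<bar>gw u * h x u\<bar> \<partial>P)\<^sup>2"
      by (intro power_mono ennreal_abs_integral_le) auto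
    also have "\<dots> = (\<integral>\<^sup>+u. ennreal \<bar>gw u\<bar> * ennreal \<bar>h x u\<bar> \<partial>P)\<^sup>2" by (simp add: abs_mult ennreal_mult)
    also have "\<dots> \<le> (\<integral>\<^sup>+u. ennreal \<bar>gw u\<bar> \<partial>P) * (\<integral>\<^sup>+u. ennreal \<bar>gw u\<bar> * (ennreal \<bar>h x u\<bar>)\<^sup>2 \<partial>P)"
      by (rule nn_integral_weighted_square_le) auto
    also have "\<dots> \<le> 2 * (\<integral>\<^sup>+u. ennreal \<bar>gw u\<bar> * (ennreal \<bar>h x u\<bar>)\<^sup>2 \<partial>P)"
      by (intro mult_right_mono nn_integral_gw_le) auto
    finally show ?thesis by (simp add: ennreal_power)
  qed
  then have "(\<integral>\<^sup>+x. ennreal ((\<integral>y. (cpois a x y - cpois b x y) * f y \<partial>P)\<^sup>2) \<partial>P) \<le> (\<integral>\<^sup>+x. 2 * (\<integral>\<^sup>+u. ennreal \<bar>gw u\<bar> * ennreal ((h x u)\<^sup>2) \<partial>P) \<partial>P)"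
    by (intro nn_integral_mono)
  also have "\<dots> = 2 * (\<integral>\<^sup>+x. \<integral>\<^sup>+u. ennreal \<bar>gw u\<bar> * ennreal ((h x u)\<^sup>2) \<partial>P \<partial>P)"
    by (rule nn_integral_cmult) measurable
  also have "(\<integral>\<^sup>+x. \<integral>\<^sup>+u. ennreal \<bar>gw u\<bar> * ennreal ((h x u)\<^sup>2) \<partial>P \<partial>P) = (\<integral>\<^sup>+u. \<integral>\<^sup>+x. ennreal \<bar>gw u\<bar> * ennreal ((h x u)\<^sup>2) \<partial>P \<partial>P)"
    by (rule PP.Fubini'[symmetric]) measurable
  also have "\<dots> \<le> (\<integral>\<^sup>+u. ennreal \<bar>gw u\<bar> * ennreal (B0 * S) \<partial>P)"
  proof (rule nn_integral_mono)
    fix u assume u [measurable]: "u \<in> space P"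
    have "(\<integral>\<^sup>+x. ennreal \<bar>gw u\<bar> * ennreal ((h x u)\<^sup>2) \<partial>P) = ennreal \<bar>gw u\<bar> * (\<integral>\<^sup>+x. ennreal ((h x u)\<^sup>2) \<partial>P)"
      by (rule nn_integral_cmult) measurable
    also have "\<dots> \<le> ennreal \<bar>gw u\<bar> * ennreal (B0 * S)"
      unfolding h_def S_def by (intro mult_left_mono directional_L2_gauss_cut f f2 u a b) auto
    finally show "(\<integral>\<^sup>+x. ennreal \<bar>gw u\<bar> * ennreal ((h x u)\<^sup>2) \<partial>P) \<le> ennreal \<bar>gw u\<bar> * ennreal (B0 * S)" .
  qed
  also have "\<dots> = (\<integral>\<^sup>+u. ennreal \<bar>gw u\<bar> \<partial>P) * ennreal (B0 * S)"
    by (rule nn_integral_multc) measurable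
  also have "\<dots> \<le> 2 * ennreal (B0 * S)" by (intro mult_right_mono nn_integral_gw_le) auto
  finally have "(\<integral>\<^sup>+x. ennreal ((\<integral>y. (cpois a x y - cpois b x y) * f y \<partial>P)\<^sup>2) \<partial>P) \<le> 2 * (2 * ennreal (B0 * S))"
    by (simp add: mult_left_mono)
  also have "\<dots> = ennreal (4 * B0 * S)"
  proof -
    have "2 * (2 * ennreal z) = ennreal (4 * z)" if "0 \<le> z" for z
    proof -
      have "ennreal (4 * z) = ennreal (2 * (2 * z))" by simp
      then show ?thesis using that by (simp only: ennreal_mult ennreal_numeral zero_le_numeral mult_nonneg_nonneg)
    qed
    from this[of "B0 * S"] show ?thesis using S0 B0 by (simp add: mult.assoc)
  qed
  finally show ?thesis unfolding S_def .
qed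

text \<open>The second height tends to infinity: there the kernel is at most cn / (m + 1)^n, so its
  contribution disappears, and Fatou's lemma keeps the constant.\<close>

lemma cpois_L2:
  assumes f: "integrable P f" and f2: "integrable P (\<lambda>x. (f x)\<^sup>2)" and a: "a > 0"
  shows "(\<integral>\<^sup>+x. ennreal ((\<integral>y. cpois a x y * f y \<partial>P)\<^sup>2) \<partial>P) \<le> ennreal (4 * B0 * (\<integral>x. (f x)\<^sup>2 \<partial>P))"
proof -
  have [measurable]: "f \<in> borel_measurable P" using f by simp
  let ?T = "\<lambda>m x. \<integral>y. (cpois a x y - cpois (real (Suc m)) x y) * f y \<partial>P"
  have ci: "integrable P (\<lambda>y. cpois r x y * f y)" if [measurable]: "x \<in> space P" and r: "r > 0" for r x
    by (rule integrable_bounded_mult[OF f, of _ "cn / r ^ n"]) (use abs_cpois_le[OF r] in auto)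
  have lim: "(\<lambda>m. ?T m x) \<longlonglongrightarrow> (\<integral>y. cpois a x y * f y \<partial>P)" if x [measurable]: "x \<in> space P" for x
  proof -
    have eq: "?T m x = (\<integral>y. cpois a x y * f y \<partial>P) - (\<integral>y. cpois (real (Suc m)) x y * f y \<partial>P)" for m
      using ci[OF x a] ci[OF x, of "real (Suc m)"] by (simp add: left_diff_distrib)
    have "(\<lambda>m. \<integral>y. cpois (real (Suc m)) x y * f y \<partial>P) \<longlonglongrightarrow> 0"
    proof (rule Lim_null_comparison)
      show "\<forall>\<^sub>F m in sequentially. norm (\<integral>y. cpois (real (Suc m)) x y * f y \<partial>P) \<le> cn / real (Suc m) * (\<integral>y. \<bar>f y\<bar> \<partial>P)"
      proof (rule always_eventually, rule allI)
        fix m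
        have b: "\<bar>cpois (real (Suc m)) x y\<bar> \<le> cn / real (Suc m)" for y
        proof -
          have "\<bar>cpois (real (Suc m)) x y\<bar> \<le> cn / real (Suc m) ^ n" by (rule abs_cpois_le) simp
          also have "\<dots> \<le> cn / real (Suc m) ^ 1"
            using j_less less_imp_le[OF cn_pos] by (intro divide_left_mono power_increasing) auto
          finally show ?thesis by simp
        qed
        have "norm (\<integral>y. cpois (real (Suc m)) x y * f y \<partial>P) \<le> (\<integral>y. norm (cpois (real (Suc m)) x y * f y) \<partial>P)"
          by (rule integral_norm_bound)
        also have "\<dots> \<le> (\<integral>y. cn / real (Suc m) * \<bar>f y\<bar> \<partial>P)"
        proof (rule integral_mono)
          show "integrable P (\<lambda>y. norm (cpois (real (Suc m)) x y * f y))" by (rule integrable_norm[OF ci[OF x]]) simp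
          show "integrable P (\<lambda>y. cn / real (Suc m) * \<bar>f y\<bar>)" using f by simp
          show "norm (cpois (real (Suc m)) x y * f y) \<le> cn / real (Suc m) * \<bar>f y\<bar>" for y
            unfolding real_norm_def abs_mult using b by (rule mult_right_mono) simp
        qed
        finally show "norm (\<integral>y. cpois (real (Suc m)) x y * f y \<partial>P) \<le> cn / real (Suc m) * (\<integral>y. \<bar>f y\<bar> \<partial>P)" by simp
      qed
      show "(\<lambda>m. cn / real (Suc m) * (\<integral>y. \<bar>f y\<bar> \<partial>P)) \<longlonglongrightarrow> 0"
        by (rule tendsto_mult_left_zero) (use LIMSEQ_Suc[OF lim_const_over_n[of cn]] in simp)
    qed
    from tendsto_diff[OF tendsto_const this, of "\<integral>y. cpois a x y * f y \<partial>P"] show ?thesis unfolding eq by simp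
  qed
  have "(\<integral>\<^sup>+x. ennreal ((\<integral>y. cpois a x y * f y \<partial>P)\<^sup>2) \<partial>P) = (\<integral>\<^sup>+x. liminf (\<lambda>m. ennreal ((?T m x)\<^sup>2)) \<partial>P)"
  proof (rule nn_integral_cong)
    fix x assume x: "x \<in> space P"
    have "(\<lambda>m. ennreal ((?T m x)\<^sup>2)) \<longlonglongrightarrow> ennreal ((\<integral>y. cpois a x y * f y \<partial>P)\<^sup>2)"
      by (intro tendsto_ennrealI tendsto_power lim x)
    then show "ennreal ((\<integral>y. cpois a x y * f y \<partial>P)\<^sup>2) = liminf (\<lambda>m. ennreal ((?T m x)\<^sup>2))"
      by (intro lim_imp_Liminf[symmetric]) auto
  qed
  also have "\<dots> \<le> liminf (\<lambda>m. \<integral>\<^sup>+x. ennreal ((?T m x)\<^sup>2) \<partial>P)"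
    by (rule nn_integral_liminf) measurable
  also have "\<dots> \<le> liminf (\<lambda>m. ennreal (4 * B0 * (\<integral>x. (f x)\<^sup>2 \<partial>P)))"
    by (intro Liminf_mono always_eventually allI cpois_diff_L2 f f2 a) auto
  finally show ?thesis by (simp add: Liminf_const)
qed

section \<open>Truncated Riesz transforms\<close>

definition trunc :: "real \<Rightarrow> ((nat \<Rightarrow> real) \<Rightarrow> real) \<Rightarrow> (nat \<Rightarrow> real) \<Rightarrow> real" where
  "trunc \<epsilon> f x = (\<integral>y. tker \<epsilon> x y * f y \<partial>P)"

definition cpois_op :: "real \<Rightarrow> ((nat \<Rightarrow> real) \<Rightarrow> real) \<Rightarrow> (nat \<Rightarrow> real) \<Rightarrow> real" where
  "cpois_op r f x = (\<integral>y. cpois r x y * f y \<partial>P)"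

definition pois_op :: "real \<Rightarrow> ((nat \<Rightarrow> real) \<Rightarrow> real) \<Rightarrow> (nat \<Rightarrow> real) \<Rightarrow> real" where
  "pois_op r f x = (\<integral>y. pois r x y * f y \<partial>P)"

lemma measurable_trunc [measurable]:
  assumes [measurable]: "f \<in> borel_measurable P" shows "trunc \<epsilon> f \<in> borel_measurable P"
  unfolding trunc_def by measurable
lemma measurable_cpois_op [measurable]:
  assumes [measurable]: "f \<in> borel_measurable P" shows "cpois_op \<epsilon> f \<in> borel_measurable P"
  unfolding cpois_op_def by measurable
lemma measurable_pois_op [measurable]:
  assumes [measurable]: "f \<in> borel_measurable P" shows "pois_op \<epsilon> f \<in> borel_measurable P"
  unfolding pois_op_def by measurable

lemma pois_bounded: "r > 0 \<Longrightarrow> \<bar>pois r x y\<bar> \<le> cn / r ^ n"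
  using pois_upper[of r x y] by simp

lemma integrable_kernel_mult:
  fixes f :: "(nat \<Rightarrow> real) \<Rightarrow> real"
  assumes f: "integrable P f" and x [measurable]: "x \<in> space P" and r: "r > 0"
  shows "integrable P (\<lambda>y. tker r x y * f y)" "integrable P (\<lambda>y. pois r x y * f y)" "integrable P (\<lambda>y. cpois r x y * f y)"
  using integrable_bounded_mult[OF f, of "tker r x" "cn / r ^ n"] abs_tker_le[OF r, of x]
    integrable_bounded_mult[OF f, of "pois r x" "cn / r ^ n"] pois_bounded[OF r, of x]
    integrable_bounded_mult[OF f, of "cpois r x" "cn / r ^ n"] abs_cpois_le[OF r, of x]
  by auto

lemma pois_op_nonneg: "(\<And>y. y \<in> space P \<Longrightarrow> 0 \<le> f y) \<Longrightarrow> r > 0 \<Longrightarrow> 0 \<le> pois_op r f x"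
  unfolding pois_op_def by (intro integral_nonneg_AE AE_I2 mult_nonneg_nonneg) auto

lemma cpois_op_minus_trunc_le:
  assumes f: "integrable P f" and x: "x \<in> space P" and r: "r > 0"
  shows "\<bar>cpois_op r f x - trunc r f x\<bar> \<le> CK * pois_op r (\<lambda>y. \<bar>f y\<bar>) x"
proof -
  note i = integrable_kernel_mult[OF _ x r]
  have "cpois_op r f x - trunc r f x = (\<integral>y. (cpois r x y - tker r x y) * f y \<partial>P)"
    unfolding cpois_op_def trunc_def using i[OF f] by (simp add: left_diff_distrib)
  also have "\<bar>\<dots>\<bar> \<le> (\<integral>y. \<bar>(cpois r x y - tker r x y) * f y\<bar> \<partial>P)" by (rule integral_abs_bound)
  also have "\<dots> \<le> (\<integral>y. CK * (pois r x y * \<bar>f y\<bar>) \<partial>P)"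
  proof (rule integral_mono)
    show "integrable P (\<lambda>y. \<bar>(cpois r x y - tker r x y) * f y\<bar>)"
      using i[OF f] by (auto simp: left_diff_distrib)
    show "integrable P (\<lambda>y. CK * (pois r x y * \<bar>f y\<bar>))" using i(2)[of "\<lambda>y. \<bar>f y\<bar>"] f by simp
    show "\<bar>(cpois r x y - tker r x y) * f y\<bar> \<le> CK * (pois r x y * \<bar>f y\<bar>)" for y
      unfolding abs_mult mult.assoc[symmetric] by (intro mult_right_mono cpois_minus_tker_le r) auto
  qed
  finally show ?thesis unfolding pois_op_def by simp
qed

lemma pois_op_eq_nn_integral:
  assumes f: "integrable P f" and x: "x \<in> space P" and r: "r > 0" and f0: "\<And>y. 0 \<le> f y"
  shows "ennreal (pois_op r f x) = (\<integral>\<^sup>+y. ennreal (pois r x y) * ennreal (f y) \<partial>P)"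
  unfolding pois_op_def using integrable_kernel_mult(2)[OF f x r] r f0
  by (subst nn_integral_eq_integral[symmetric]) (auto simp: ennreal_mult)

lemma nn_integral_pois_mult_square_le:
  assumes x [measurable]: "x \<in> space P" and r: "r > 0" and [measurable]: "g \<in> borel_measurable P"
  shows "(\<integral>\<^sup>+y. ennreal (pois r x y) * g y \<partial>P)\<^sup>2 \<le> (\<integral>\<^sup>+y. ennreal (pois r x y) * (g y)\<^sup>2 \<partial>P)"
  using nn_integral_weighted_square_le[of "pois r x" P g] nn_integral_pois[OF r x] r by simp

lemma nn_integral_pois_conv:
  assumes r: "r > 0" and [measurable]: "g \<in> borel_measurable P"
  shows "(\<integral>\<^sup>+x. \<integral>\<^sup>+y. ennreal (pois r x y) * g y \<partial>P \<partial>P) = (\<integral>\<^sup>+y. g y \<partial>P)"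
proof -
  have "(\<integral>\<^sup>+x. \<integral>\<^sup>+y. ennreal (pois r x y) * g y \<partial>P \<partial>P) = (\<integral>\<^sup>+y. \<integral>\<^sup>+x. ennreal (pois r x y) * g y \<partial>P \<partial>P)"
    by (rule PP.Fubini'[symmetric]) measurable
  also have "\<dots> = (\<integral>\<^sup>+y. g y \<partial>P)"
  proof (rule nn_integral_cong)
    fix y assume y [measurable]: "y \<in> space P"
    have "(\<integral>\<^sup>+x. ennreal (pois r x y) * g y \<partial>P) = (\<integral>\<^sup>+x. ennreal (pois r y x) \<partial>P) * g y"
      by (subst pois_commute) (rule nn_integral_multc, measurable)
    then show "(\<integral>\<^sup>+x. ennreal (pois r x y) * g y \<partial>P) = g y" using nn_integral_pois[OF r y] by simp
  qed
  finally show ?thesis .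
qed

lemma pois_op_square_le:
  assumes f: "integrable P f" and f2: "integrable P (\<lambda>x. (f x)\<^sup>2)" and x: "x \<in> space P" and r: "r > 0"
    and f0: "\<And>y. 0 \<le> f y"
  shows "(pois_op r f x)\<^sup>2 \<le> pois_op r (\<lambda>y. (f y)\<^sup>2) x"
proof -
  have [measurable]: "f \<in> borel_measurable P" using f by simp
  have "ennreal ((pois_op r f x)\<^sup>2) = (ennreal (pois_op r f x))\<^sup>2" using pois_op_nonneg[of f r x] f0 r by (simp add: ennreal_power)
  also have "\<dots> \<le> (\<integral>\<^sup>+y. ennreal (pois r x y) * (ennreal (f y))\<^sup>2 \<partial>P)"
    unfolding pois_op_eq_nn_integral[OF f x r f0] by (rule nn_integral_pois_mult_square_le[OF x r]) measurable
  also have "\<dots> = ennreal (pois_op r (\<lambda>y. (f y)\<^sup>2) x)"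
    using f0 by (subst pois_op_eq_nn_integral[OF f2 x r]) (auto simp: ennreal_power)
  finally show ?thesis using pois_op_nonneg[of "\<lambda>y. (f y)\<^sup>2" r x] r by (simp add: ennreal_le_iff)
qed

definition CT :: real where "CT = 8 * B0 + 2 * CK\<^sup>2"

text \<open>The Poisson error averages against a probability density and is therefore bounded on
  L^2. The constant contains \<open>CK\<close> and grows with \<open>n\<close>; it serves the
  qualitative weak type bound only, while the dimension-free estimate goes through
  \<open>cpois_op\<close>.\<close>

lemma trunc_L2:
  assumes f: "integrable P f" and f2: "integrable P (\<lambda>x. (f x)\<^sup>2)" and r: "r > 0"
  shows "(\<integral>\<^sup>+x. ennreal ((trunc r f x)\<^sup>2) \<partial>P) \<le> ennreal (CT * (\<integral>x. (f x)\<^sup>2 \<partial>P))"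
proof -
  have [measurable]: "f \<in> borel_measurable P" using f by simp
  define S where "S = (\<integral>x. (f x)\<^sup>2 \<partial>P)"
  have S0: "0 \<le> S" unfolding S_def by simp
  have B0: "0 \<le> B0" unfolding B0_def by simp
  have S: "(\<integral>\<^sup>+x. ennreal ((f x)\<^sup>2) \<partial>P) = ennreal S"
    unfolding S_def using f2 by (subst nn_integral_eq_integral) auto
  have "(\<integral>\<^sup>+x. ennreal ((trunc r f x)\<^sup>2) \<partial>P) \<le> (\<integral>\<^sup>+x. ennreal 2 * ennreal ((cpois_op r f x)\<^sup>2) + ennreal (2 * CK\<^sup>2) * (\<integral>\<^sup>+y. ennreal (pois r x y) * ennreal ((f y)\<^sup>2) \<partial>P) \<partial>P)"
  proof (rule nn_integral_mono)
    fix x assume x: "x \<in> space P"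
    let ?m = "pois_op r (\<lambda>y. \<bar>f y\<bar>) x"
    have m: "?m\<^sup>2 \<le> pois_op r (\<lambda>y. (f y)\<^sup>2) x"
      using pois_op_square_le[of "\<lambda>y. \<bar>f y\<bar>" x r] f f2 x r by simp
    have "\<bar>trunc r f x\<bar> \<le> \<bar>cpois_op r f x\<bar> + CK * ?m" using cpois_op_minus_trunc_le[OF f x r] by linarith
    then have "\<bar>trunc r f x\<bar>\<^sup>2 \<le> (\<bar>cpois_op r f x\<bar> + CK * ?m)\<^sup>2" by (rule power_mono) simp
    also have "\<dots> \<le> 2 * \<bar>cpois_op r f x\<bar>\<^sup>2 + 2 * (CK * ?m)\<^sup>2"
      using sum_squares_bound[of "\<bar>cpois_op r f x\<bar>" "CK * ?m"] by (simp add: power2_sum)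
    also have "\<dots> \<le> 2 * (cpois_op r f x)\<^sup>2 + 2 * CK\<^sup>2 * pois_op r (\<lambda>y. (f y)\<^sup>2) x"
      using m by (simp add: power_mult_distrib mult_left_mono)
    finally have "ennreal ((trunc r f x)\<^sup>2) \<le> ennreal (2 * (cpois_op r f x)\<^sup>2 + 2 * CK\<^sup>2 * pois_op r (\<lambda>y. (f y)\<^sup>2) x)"
      by (simp add: ennreal_leI)
    also have "\<dots> = ennreal 2 * ennreal ((cpois_op r f x)\<^sup>2) + ennreal (2 * CK\<^sup>2) * ennreal (pois_op r (\<lambda>y. (f y)\<^sup>2) x)"
      using pois_op_nonneg[of "\<lambda>y. (f y)\<^sup>2" r x] r by (subst ennreal_plus) (auto simp: ennreal_mult)
    finally show "ennreal ((trunc r f x)\<^sup>2) \<le> ennreal 2 * ennreal ((cpois_op r f x)\<^sup>2) + ennreal (2 * CK\<^sup>2) * (\<integral>\<^sup>+y. ennreal (pois r x y) * ennreal ((f y)\<^sup>2) \<partial>P)"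
      by (subst pois_op_eq_nn_integral[symmetric, OF f2 x r]) auto
  qed
  also have "\<dots> = ennreal 2 * (\<integral>\<^sup>+x. ennreal ((cpois_op r f x)\<^sup>2) \<partial>P) + ennreal (2 * CK\<^sup>2) * (\<integral>\<^sup>+x. \<integral>\<^sup>+y. ennreal (pois r x y) * ennreal ((f y)\<^sup>2) \<partial>P \<partial>P)"
    by (simp add: nn_integral_add nn_integral_cmult)
  also have "\<dots> \<le> ennreal 2 * ennreal (4 * B0 * S) + ennreal (2 * CK\<^sup>2) * ennreal S"
    unfolding nn_integral_pois_conv[OF r, of "\<lambda>y. ennreal ((f y)\<^sup>2)", simplified] S cpois_op_def S_def
    using cpois_L2[OF f f2 r] S unfolding S_def by (intro add_mono mult_left_mono) auto
  also have "\<dots> = ennreal (2 * (4 * B0 * S) + 2 * CK\<^sup>2 * S)"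
    using S0 B0 by (simp only: ennreal_plus ennreal_mult mult_nonneg_nonneg zero_le_numeral zero_le_power2)
  also have "\<dots> = ennreal (CT * S)" by (simp add: CT_def algebra_simps)
  finally show ?thesis unfolding S_def .
qed

section \<open>Step functions on cubes\<close>

text \<open>The index of the half-open grid cube of side \<open>s\<close> that contains
  \<open>x\<close>; half-open cubes of one side partition the space.\<close>

definition cell :: "real \<Rightarrow> (nat \<Rightarrow> real) \<Rightarrow> nat \<Rightarrow> int" where
  "cell s x = (\<lambda>i\<in>{..<n}. \<lfloor>x i / s\<rfloor>)"

definition cube :: "real \<Rightarrow> (nat \<Rightarrow> int) \<Rightarrow> (nat \<Rightarrow> real) set" where
  "cube s m = {y \<in> space P. \<forall>i<n. s * m i \<le> y i \<and> y i < s * (m i + 1)}"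

definition corner :: "real \<Rightarrow> (nat \<Rightarrow> int) \<Rightarrow> nat \<Rightarrow> real" where
  "corner s m = (\<lambda>i\<in>{..<n}. s * m i)"

lemma corner_in_space [simp]: "corner s m \<in> space P"
  by (simp add: corner_def space_P)

lemma cell_eq_iff: "cell s x = cell s y \<longleftrightarrow> (\<forall>i<n. \<lfloor>x i / s\<rfloor> = \<lfloor>y i / s\<rfloor>)"
  unfolding cell_def by (metis (no_types, lifting) lessThan_iff restrict_apply' restrict_ext)

lemma floor_div_eq_iff: "s > 0 \<Longrightarrow> \<lfloor>t / s\<rfloor> = k \<longleftrightarrow> s * of_int k \<le> t \<and> t < s * (of_int k + 1)" for s t :: real
  by (simp add: floor_eq_iff field_simps)

lemma mem_cube_iff: "s > 0 \<Longrightarrow> y \<in> cube s m \<longleftrightarrow> y \<in> space P \<and> (\<forall>i<n. \<lfloor>y i / s\<rfloor> = m i)"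
  by (auto simp: cube_def floor_div_eq_iff)

lemma mem_cube_cell: "s > 0 \<Longrightarrow> y \<in> cube s (cell s x) \<longleftrightarrow> y \<in> space P \<and> cell s y = cell s x"
  unfolding cell_eq_iff mem_cube_iff by (metis cell_def lessThan_iff restrict_apply')

lemma cell_corner: "s > 0 \<Longrightarrow> m \<in> extensional {..<n} \<Longrightarrow> cell s (corner s m) = m"
  unfolding cell_def corner_def by (rule ext) (simp add: extensional_def)

lemma cell_extensional [simp]: "cell s x \<in> extensional {..<n}"
  by (simp add: cell_def)

lemma cube_eq_PiE: "cube s m = Pi\<^sub>E {..<n} (\<lambda>i. {s * m i..<s * (m i + 1)})"
  unfolding cube_def space_P by (rule set_eqI) (simp only: PiE_iff mem_Collect_eq atLeastLessThan_iff lessThan_iff Ball_def, blast)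

lemma sets_cube [measurable]: "cube s m \<in> sets P"
  unfolding cube_eq_PiE by (rule sets_PiM_I_finite) auto

lemma emeasure_cube: "s > 0 \<Longrightarrow> emeasure P (cube s m) = ennreal (s ^ n)"
  unfolding cube_eq_PiE
  by (subst lborel_product.emeasure_PiM) (auto simp: algebra_simps ennreal_power)

lemma measure_cube: "s > 0 \<Longrightarrow> measure P (cube s m) = s ^ n"
  by (simp add: measure_def emeasure_cube)

lemma edist_corner_cube: "s > 0 \<Longrightarrow> y \<in> cube s m \<Longrightarrow> edist y (corner s m) \<le> real n * s" for s :: real
  by (rule edist_le) (force simp: cube_def corner_def algebra_simps)

text \<open>Stated through constancy on cells and finitely many nonzero cells, not through a list of
  coefficients, so that cutting at levels (\<open>step_comp\<close>) and passing to finer grids stay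
  simple.\<close>

definition step :: "real \<Rightarrow> ((nat \<Rightarrow> real) \<Rightarrow> real) \<Rightarrow> bool" where
  "step s F \<longleftrightarrow> s > 0 \<and> (\<forall>x\<in>space P. \<forall>y\<in>space P. cell s x = cell s y \<longrightarrow> F x = F y) \<and>
     finite (cell s ` {x \<in> space P. F x \<noteq> 0})"

definition supp_cells :: "real \<Rightarrow> ((nat \<Rightarrow> real) \<Rightarrow> real) \<Rightarrow> (nat \<Rightarrow> int) set" where
  "supp_cells s F = cell s ` {x \<in> space P. F x \<noteq> 0}"

lemma step_pos: "step s F \<Longrightarrow> s > 0"
  and step_finite: "step s F \<Longrightarrow> finite (supp_cells s F)"
  unfolding step_def supp_cells_def by blast+

lemma step_const: "step s F \<Longrightarrow> x \<in> space P \<Longrightarrow> y \<in> space P \<Longrightarrow> cell s x = cell s y \<Longrightarrow> F x = F y"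
  unfolding step_def by blast

lemma stepI:
  assumes "s > 0" "\<And>x y. x \<in> space P \<Longrightarrow> y \<in> space P \<Longrightarrow> cell s x = cell s y \<Longrightarrow> F x = F y"
    "finite (cell s ` {x \<in> space P. F x \<noteq> 0})"
  shows "step s F"
  unfolding step_def using assms by blast

lemma step_expand:
  assumes "step s F" "x \<in> space P"
  shows "F x = (\<Sum>m\<in>supp_cells s F. F (corner s m) * indicator (cube s m) x)"
proof -
  have s: "s > 0" and fin: "finite (supp_cells s F)" using assms step_pos step_finite by auto
  have ind: "indicator (cube s m) x = (if m = cell s x then 1 else 0 :: real)" if "m \<in> supp_cells s F" for m
    using that mem_cube_cell[OF s] assms(2) by (auto simp: supp_cells_def indicator_def)
  have "(\<Sum>m\<in>supp_cells s F. F (corner s m) * indicator (cube s m) x) = (\<Sum>m\<in>supp_cells s F. if m = cell s x then F (corner s m) else 0)"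
    by (rule sum.cong) (auto simp: ind)
  also have "\<dots> = (if cell s x \<in> supp_cells s F then F (corner s (cell s x)) else 0)"
    using fin by simp
  also have "F (corner s (cell s x)) = F x"
    by (rule step_const[OF assms(1)]) (use assms(2) cell_corner[OF s] in auto)
  finally show ?thesis using assms(2) by (auto simp: supp_cells_def)
qed

lemma step_measurable: "step s F \<Longrightarrow> F \<in> borel_measurable P"
  by (subst measurable_cong[OF step_expand]) auto

lemma step_integrable: assumes "step s F" shows "integrable P F"
proof -
  have s: "s > 0" by (rule step_pos[OF assms])
  have "integrable P (\<lambda>x. \<Sum>m\<in>supp_cells s F. F (corner s m) * indicator (cube s m) x)"
    using s by (intro Bochner_Integration.integrable_sum integrable_mult_right integrable_real_indicator) (auto simp: emeasure_cube)
  then show ?thesis by (subst Bochner_Integration.integrable_cong[OF refl step_expand[OF assms]])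
qed

lemma step_comp:
  assumes "step s F" "h 0 = 0" shows "step s (\<lambda>x. h (F x))"
proof -
  have "cell s ` {x \<in> space P. h (F x) \<noteq> 0} \<subseteq> cell s ` {x \<in> space P. F x \<noteq> 0}" using assms(2) by auto
  moreover have "finite (cell s ` {x \<in> space P. F x \<noteq> 0})" using step_finite[OF assms(1)] by (simp add: supp_cells_def)
  ultimately have "finite (cell s ` {x \<in> space P. h (F x) \<noteq> 0})" by (rule finite_subset)
  moreover have "h (F x) = h (F y)" if "x \<in> space P" "y \<in> space P" "cell s x = cell s y" for x y
    using step_const[OF assms(1) that] by simp
  ultimately show ?thesis using step_pos[OF assms(1)] by (intro stepI) blast+
qed

lemma step_add:
  assumes "step s F" "step s G" shows "step s (\<lambda>x. F x + G x)"
proof -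
  have "cell s ` {x \<in> space P. F x + G x \<noteq> 0} \<subseteq> cell s ` {x \<in> space P. F x \<noteq> 0} \<union> cell s ` {x \<in> space P. G x \<noteq> 0}" by auto
  moreover have "finite (cell s ` {x \<in> space P. F x \<noteq> 0} \<union> cell s ` {x \<in> space P. G x \<noteq> 0})"
    using assms[THEN step_finite] by (simp add: supp_cells_def)
  ultimately have "finite (cell s ` {x \<in> space P. F x + G x \<noteq> 0})" by (rule finite_subset)
  moreover have "F x + G x = F y + G y" if "x \<in> space P" "y \<in> space P" "cell s x = cell s y" for x y
    using step_const[OF assms(1) that] step_const[OF assms(2) that] by simp
  ultimately show ?thesis using step_pos[OF assms(1)] by (intro stepI) blast+
qed

section \<open>Refinement of grids and density of dyadic step functions\<close>

lemma floor_div_nat: "\<lfloor>t / real k\<rfloor> = \<lfloor>t\<rfloor> div int k"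
  using floor_divide_real_eq_div[of "int k" t] by simp

lemma cell_coarsen:
  assumes "s > 0" "cell s x = cell s y" shows "cell (s * real k) x = cell (s * real k) y"
proof -
  have "\<lfloor>z / (s * real k)\<rfloor> = \<lfloor>z / s\<rfloor> div int k" for z
    using floor_div_nat[of "z / s" k] by simp
  then show ?thesis using assms unfolding cell_eq_iff by simp
qed

text \<open>Dividing the side by an integer makes every old cube a finite union of new ones. This
  brings two dyadic step functions to a common grid, and later puts the atoms on a grid as fine as
  desired.\<close>

lemma step_refine:
  assumes F: "step s F" and k: "k > 0"
  shows "step (s / real k) F"
proof -
  have s: "s > 0" by (rule step_pos[OF F])
  have co: "cell s x = (\<lambda>i\<in>{..<n}. cell (s / real k) x i div int k)" for x
  proof -
    have "\<lfloor>x i / s\<rfloor> = \<lfloor>x i / (s / real k)\<rfloor> div int k" for i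
      using floor_div_nat[of "x i / (s / real k)" k] k by simp
    then show ?thesis by (auto simp: cell_def fun_eq_iff)
  qed
  have "cell (s / real k) ` {x \<in> space P. F x \<noteq> 0} \<subseteq> (\<Union>m\<in>supp_cells s F. Pi\<^sub>E {..<n} (\<lambda>i. {int k * m i..<int k * (m i + 1)}))"
  proof safe
    fix x assume x: "x \<in> space P" "F x \<noteq> 0"
    have "cell s x \<in> supp_cells s F" using x by (auto simp: supp_cells_def)
    moreover have "cell (s / real k) x \<in> Pi\<^sub>E {..<n} (\<lambda>i. {int k * cell s x i..<int k * (cell s x i + 1)})"
    proof (rule PiE_I)
      fix i assume i: "i \<in> {..<n}"
      have "cell s x i = cell (s / real k) x i div int k" using i by (subst co) simp
      moreover have "int k * (z div int k) \<le> z \<and> z < int k * (z div int k + 1)" for z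
      proof -
        have "int k > 0" using k by simp
        then have "0 \<le> z mod int k" "z mod int k < int k" by simp_all
        then show ?thesis using mult_div_mod_eq[of "int k" z] unfolding distrib_left by linarith
      qed
      ultimately show "cell (s / real k) x i \<in> {int k * cell s x i..<int k * (cell s x i + 1)}" by simp
    qed (auto simp: cell_def)
    ultimately show "cell (s / real k) x \<in> (\<Union>m\<in>supp_cells s F. Pi\<^sub>E {..<n} (\<lambda>i. {int k * m i..<int k * (m i + 1)}))" by blast
  qed
  then have "finite (cell (s / real k) ` {x \<in> space P. F x \<noteq> 0})"
  proof (rule finite_subset)
    show "finite (\<Union>m\<in>supp_cells s F. Pi\<^sub>E {..<n} (\<lambda>i. {int k * m i..<int k * (m i + 1)}))"
      using step_finite[OF F] by (intro finite_UN_I finite_PiE) auto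
  qed
  moreover have "F x = F y" if "x \<in> space P" "y \<in> space P" "cell (s / real k) x = cell (s / real k) y" for x y
    by (rule step_const[OF F that(1,2)]) (simp only: co[of x] co[of y] that(3))
  ultimately show ?thesis using s k by (intro stepI) (assumption | simp)+
qed

text \<open>Dyadic sides guarantee that two approximants have a common refinement, so the class is
  closed under sums.\<close>

definition approximable :: "((nat \<Rightarrow> real) \<Rightarrow> real) \<Rightarrow> bool" where
  "approximable f \<longleftrightarrow> integrable P f \<and> (\<forall>e>0. \<exists>k F. step (1 / 2 ^ k) F \<and> (\<integral>x. \<bar>f x - F x\<bar> \<partial>P) < e)"

lemma step_dyadic_refine: "step (1 / 2 ^ k) F \<Longrightarrow> k \<le> l \<Longrightarrow> step (1 / 2 ^ l) F"
  using step_refine[of "1 / 2 ^ k" F "2 ^ (l - k)"] by (simp flip: power_add)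

lemma approximable_step: "step (1 / 2 ^ k) F \<Longrightarrow> approximable F"
  unfolding approximable_def by (auto intro!: step_integrable exI[of _ k] exI[of _ F])

lemma approximable_scale:
  assumes "approximable f" shows "approximable (\<lambda>x. c * f x)"
  unfolding approximable_def
proof (intro conjI allI impI)
  show "integrable P (\<lambda>x. c * f x)" using assms by (simp add: approximable_def)
  fix e :: real assume e: "e > 0"
  then have "e / (\<bar>c\<bar> + 1) > 0" by simp
  then obtain k F where F: "step (1 / 2 ^ k) F" "(\<integral>x. \<bar>f x - F x\<bar> \<partial>P) < e / (\<bar>c\<bar> + 1)"
    using assms unfolding approximable_def by blast
  have "(\<integral>x. \<bar>c * f x - c * F x\<bar> \<partial>P) = \<bar>c\<bar> * (\<integral>x. \<bar>f x - F x\<bar> \<partial>P)"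
    unfolding right_diff_distrib[symmetric] abs_mult by simp
  also have "\<dots> \<le> \<bar>c\<bar> * (e / (\<bar>c\<bar> + 1))" using F by (intro mult_left_mono) auto
  also have "\<dots> < e" using e by (simp add: field_simps)
  finally show "\<exists>k F. step (1 / 2 ^ k) F \<and> (\<integral>x. \<bar>c * f x - F x\<bar> \<partial>P) < e"
    using step_comp[OF F(1), of "\<lambda>t. c * t"] by (intro exI[of _ k] exI[of _ "\<lambda>x. c * F x"]) simp
qed

lemma approximable_add:
  assumes f: "approximable f" and g: "approximable g" shows "approximable (\<lambda>x. f x + g x)"
  unfolding approximable_def
proof (intro conjI allI impI)
  show "integrable P (\<lambda>x. f x + g x)" using assms by (simp add: approximable_def)
  fix e :: real assume "e > 0"
  then have e: "e / 2 > 0" by simp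
  obtain k F where F: "step (1 / 2 ^ k) F" "(\<integral>x. \<bar>f x - F x\<bar> \<partial>P) < e / 2"
    using f e unfolding approximable_def by blast
  obtain l G where G: "step (1 / 2 ^ l) G" "(\<integral>x. \<bar>g x - G x\<bar> \<partial>P) < e / 2"
    using g e unfolding approximable_def by blast
  have st: "step (1 / 2 ^ max k l) (\<lambda>x. F x + G x)"
    by (intro step_add step_dyadic_refine[OF F(1)] step_dyadic_refine[OF G(1)]) auto
  have i: "integrable P (\<lambda>x. \<bar>f x - F x\<bar>)" "integrable P (\<lambda>x. \<bar>g x - G x\<bar>)"
    using f g step_integrable[OF F(1)] step_integrable[OF G(1)] by (auto simp: approximable_def)
  have "(\<integral>x. \<bar>f x + g x - (F x + G x)\<bar> \<partial>P) \<le> (\<integral>x. \<bar>f x - F x\<bar> + \<bar>g x - G x\<bar> \<partial>P)"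
    using i f g step_integrable[OF st] by (intro integral_mono) (auto simp: approximable_def)
  also have "\<dots> < e" using i F G by simp
  finally show "\<exists>k F. step (1 / 2 ^ k) F \<and> (\<integral>x. \<bar>f x + g x - F x\<bar> \<partial>P) < e"
    using st by (intro exI[of _ "max k l"] exI[of _ "\<lambda>x. F x + G x"]) simp
qed

lemma approximable_lim:
  assumes s: "\<And>i. approximable (s i)" and f: "integrable P f" and lim: "(\<lambda>i::nat. \<integral>x. \<bar>f x - s i x\<bar> \<partial>P) \<longlonglongrightarrow> 0"
  shows "approximable f"
  unfolding approximable_def
proof (intro conjI allI impI)
  fix e :: real assume "e > 0"
  then have e: "e / 2 > 0" by simp
  have "\<exists>i. (\<integral>x. \<bar>f x - s i x\<bar> \<partial>P) < e / 2"
    by (rule eventually_happens'[OF sequentially_bot order_tendstoD(2)[OF lim e]])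
  then obtain i where i: "(\<integral>x. \<bar>f x - s i x\<bar> \<partial>P) < e / 2" ..
  have "\<exists>k F. step (1 / 2 ^ k) F \<and> (\<integral>x. \<bar>s i x - F x\<bar> \<partial>P) < e / 2"
    using s[of i] e unfolding approximable_def by blast
  then obtain k F where F: "step (1 / 2 ^ k) F" "(\<integral>x. \<bar>s i x - F x\<bar> \<partial>P) < e / 2" by (elim exE conjE)
  have si: "integrable P (s i)" using s[of i] by (simp add: approximable_def)
  have "(\<integral>x. \<bar>f x - F x\<bar> \<partial>P) \<le> (\<integral>x. \<bar>f x - s i x\<bar> + \<bar>s i x - F x\<bar> \<partial>P)"
    using si f step_integrable[OF F(1)] by (intro integral_mono) auto
  also have "\<dots> < e" using si f step_integrable[OF F(1)] F i by simp
  finally show "\<exists>k F. step (1 / 2 ^ k) F \<and> (\<integral>x. \<bar>f x - F x\<bar> \<partial>P) < e"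
    using F(1) by (intro exI[of _ k] exI[of _ F]) simp
qed (rule f)

definition sbox :: "nat \<Rightarrow> (nat \<Rightarrow> real) set" where
  "sbox R = {y \<in> space P. \<forall>i<n. - real R \<le> y i \<and> y i < real R}"

text \<open>Lower orthants with dyadic vertex: an intersection-stable generator of the product
  sigma-algebra whose indicators, cut off to a box, are exactly dyadic step functions.\<close>

definition quadrant :: "(nat \<Rightarrow> int) \<Rightarrow> nat \<Rightarrow> (nat \<Rightarrow> real) set" where
  "quadrant a k = {y \<in> space P. \<forall>i<n. y i < real_of_int (a i) / 2 ^ k}"

lemma sbox_eq_PiE: "sbox R = Pi\<^sub>E {..<n} (\<lambda>i. {- real R..<real R})"
  unfolding sbox_def space_P by (rule set_eqI) (simp only: PiE_iff mem_Collect_eq atLeastLessThan_iff lessThan_iff Ball_def, blast)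

lemma quadrant_eq_PiE: "quadrant a k = Pi\<^sub>E {..<n} (\<lambda>i. {..<real_of_int (a i) / 2 ^ k})"
  unfolding quadrant_def space_P by (rule set_eqI) (simp only: PiE_iff mem_Collect_eq lessThan_iff Ball_def, blast)

lemma sets_sbox [measurable]: "sbox R \<in> sets P"
  unfolding sbox_eq_PiE by (rule sets_PiM_I_finite) auto

lemma sets_quadrant [measurable]: "quadrant a k \<in> sets P"
  unfolding quadrant_eq_PiE by (rule sets_PiM_I_finite) auto

lemma emeasure_sbox: "emeasure P (sbox R) < \<infinity>"
  unfolding sbox_eq_PiE
  by (subst lborel_product.emeasure_PiM) (auto simp: less_top[symmetric] ennreal_power)

lemma step_quadrant_sbox: "step (1 / 2 ^ k) (indicator (quadrant a k \<inter> sbox R))"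
proof -
  let ?C = "\<lambda>c. \<forall>i<n. c i < a i \<and> - (int R * 2 ^ k) \<le> c i \<and> c i < int R * 2 ^ k"
  have ci: "cell (1 / 2 ^ k) y i = \<lfloor>y i * 2 ^ k\<rfloor>" if "i < n" for y i
    using that by (simp add: cell_def)
  \<comment> \<open>The vertex and the faces of the box lie on the dyadic grid, so membership is a
    condition on the cell index alone.\<close>
  have m: "y \<in> quadrant a k \<inter> sbox R \<longleftrightarrow> ?C (cell (1 / 2 ^ k) y)" if y: "y \<in> space P" for y
  proof -
    have "z < real_of_int b / 2 ^ k \<longleftrightarrow> \<lfloor>z * 2 ^ k\<rfloor> < b" for z b
      by (simp add: floor_less_iff pos_less_divide_eq)
    moreover have "- real R \<le> z \<longleftrightarrow> - (int R * 2 ^ k) \<le> \<lfloor>z * 2 ^ k\<rfloor>" for z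
    proof -
      have "- (int R * 2 ^ k) \<le> \<lfloor>z * 2 ^ k\<rfloor> \<longleftrightarrow> (- real R) * 2 ^ k \<le> z * 2 ^ k" by (simp add: le_floor_iff)
      also have "\<dots> \<longleftrightarrow> - real R \<le> z" by (rule mult_le_cancel_right_pos) simp
      finally show ?thesis by blast
    qed
    moreover have "z < real R \<longleftrightarrow> \<lfloor>z * 2 ^ k\<rfloor> < int R * 2 ^ k" for z
      by (simp add: floor_less_iff)
    ultimately show ?thesis using y ci by (auto simp: quadrant_def sbox_def)
  qed
  show ?thesis
  proof (rule stepI)
    fix x y assume "x \<in> space P" "y \<in> space P" "cell (1 / 2 ^ k) x = cell (1 / 2 ^ k) y"
    then show "indicator (quadrant a k \<inter> sbox R) x = (indicator (quadrant a k \<inter> sbox R) y :: real)"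
      using m[of x] m[of y] by (simp add: indicator_def del: Int_iff)
  next
    have "cell (1 / 2 ^ k) ` {x \<in> space P. indicator (quadrant a k \<inter> sbox R) x \<noteq> (0::real)} \<subseteq> Pi\<^sub>E {..<n} (\<lambda>i. {- (int R * 2 ^ k)..<int R * 2 ^ k})"
    proof (rule image_subsetI)
      fix x assume "x \<in> {x \<in> space P. indicator (quadrant a k \<inter> sbox R) x \<noteq> (0::real)}"
      then have x: "x \<in> space P" "indicator (quadrant a k \<inter> sbox R) x \<noteq> (0::real)" by auto
      then have "x \<in> quadrant a k \<inter> sbox R" by (metis indicator_simps(2))
      then have C: "?C (cell (1 / 2 ^ k) x)" using m[OF x(1)] by (simp del: Int_iff)
      show "cell (1 / 2 ^ k) x \<in> Pi\<^sub>E {..<n} (\<lambda>i. {- (int R * 2 ^ k)..<int R * 2 ^ k})"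
        by (rule PiE_I) (use C in \<open>auto simp: cell_def\<close>)
    qed
    then show "finite (cell (1 / 2 ^ k) ` {x \<in> space P. indicator (quadrant a k \<inter> sbox R) x \<noteq> (0::real)})"
      by (rule finite_subset) (simp add: finite_PiE)
  qed simp
qed

definition quadrants :: "(nat \<Rightarrow> real) set set" where
  "quadrants = {quadrant a k | a k. True}"

lemma Int_stable_quadrants: "Int_stable quadrants"
proof (rule Int_stableI)
  fix A B assume "A \<in> quadrants" "B \<in> quadrants"
  then obtain a k b l where AB: "A = quadrant a k" "B = quadrant b l" unfolding quadrants_def by auto
  have "quadrant a k \<inter> quadrant b l = quadrant (\<lambda>i. min (a i * 2 ^ l) (b i * 2 ^ k)) (k + l)"
  proof -
    have "real_of_int (min (p * 2 ^ l) (q * 2 ^ k)) / 2 ^ (k + l) = min (real_of_int p / 2 ^ k) (real_of_int q / 2 ^ l)" for p q :: int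
      by (simp add: min_divide_distrib_right of_int_min power_add)
    then show ?thesis unfolding quadrant_def by auto
  qed
  then show "A \<inter> B \<in> quadrants" unfolding AB quadrants_def by blast
qed

lemma sets_P_eq_sigma_quadrants: "sets P = sigma_sets (space P) quadrants"
proof
  have sub: "quadrants \<subseteq> Pow (space P)" by (auto simp: quadrants_def quadrant_def)
  show "sigma_sets (space P) quadrants \<subseteq> sets P"
    by (rule sets.sigma_sets_subset) (auto simp: quadrants_def)
  let ?N = "sigma (space P) quadrants"
  have N: "sets ?N = sigma_sets (space P) quadrants" "space ?N = space P" using sub by simp_all
  have "(\<lambda>\<omega>. \<omega> i) \<in> borel_measurable ?N" if i: "i < n" for i
    unfolding borel_measurable_iff_less
  proof
    fix a :: real
    \<comment> \<open>The half-space is exhausted by orthants: the vertex coordinate in direction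
      \<open>i\<close> is \<open>a\<close> rounded down to the grid, the others are
      \<open>N\<close>.\<close>
    have "{w \<in> space ?N. w i < a} = (\<Union>k::nat. \<Union>N::nat. quadrant (\<lambda>l. if l = i then \<lfloor>a * 2 ^ k\<rfloor> else int N * 2 ^ k) k)"
    proof safe
      fix w assume w: "w \<in> space ?N" "w i < a"
      obtain k where k: "(1/2) ^ k < a - w i"
        using real_arch_pow_inv[of "a - w i" "1/2"] w(2) by auto
      obtain N :: nat where N': "(\<Sum>l<n. \<bar>w l\<bar>) < real N" using reals_Archimedean2 by blast
      have wl: "w l < real N" if "l < n" for l
      proof -
        have "\<bar>w l\<bar> \<le> (\<Sum>l<n. \<bar>w l\<bar>)" using that by (intro member_le_sum) auto
        then show ?thesis using N' by linarith
      qed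
      have wi: "w i < \<lfloor>a * 2 ^ k\<rfloor> / 2 ^ k"
      proof -
        have "a * 2 ^ k - 1 < \<lfloor>a * 2 ^ k\<rfloor>" by linarith
        then have "(a * 2 ^ k - 1) / 2 ^ k < \<lfloor>a * 2 ^ k\<rfloor> / 2 ^ k" by (rule divide_strict_right_mono) simp
        then have "a - (1/2) ^ k < \<lfloor>a * 2 ^ k\<rfloor> / 2 ^ k" by (simp add: diff_divide_distrib power_one_over)
        then show ?thesis using k by linarith
      qed
      have "w \<in> quadrant (\<lambda>l. if l = i then \<lfloor>a * 2 ^ k\<rfloor> else int N * 2 ^ k) k"
        unfolding quadrant_def using w(1) wl wi N(2) by auto
      then show "w \<in> (\<Union>k::nat. \<Union>N::nat. quadrant (\<lambda>l. if l = i then \<lfloor>a * 2 ^ k\<rfloor> else int N * 2 ^ k) k)" by blast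
    next
      fix w k N assume "w \<in> quadrant (\<lambda>l. if l = i then \<lfloor>a * 2 ^ k\<rfloor> else int N * 2 ^ k) k"
      then have w: "w \<in> space P" "w i < \<lfloor>a * 2 ^ k\<rfloor> / 2 ^ k" using i unfolding quadrant_def by auto
      have "\<lfloor>a * 2 ^ k\<rfloor> / 2 ^ k \<le> (a * 2 ^ k) / 2 ^ k" by (intro divide_right_mono) auto
      then show "w i < a" using w(2) by simp
      show "w \<in> space ?N" using w(1) by (simp only: N)
    qed
    also have "\<dots> \<in> sets ?N"
    proof (intro sets.countable_UN'' countableI_type)
      fix k N :: nat
      have "quadrant (\<lambda>l. if l = i then \<lfloor>a * 2 ^ k\<rfloor> else int N * 2 ^ k) k \<in> quadrants" unfolding quadrants_def by blast
      then show "quadrant (\<lambda>l. if l = i then \<lfloor>a * 2 ^ k\<rfloor> else int N * 2 ^ k) k \<in> sets ?N" unfolding N by (rule sigma_sets.Basic)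
    qed
    finally show "{w \<in> space ?N. w i < a} \<in> sets ?N" .
  qed
  then have "(\<lambda>\<omega> i. \<omega> i) \<in> measurable ?N P"
    using N(2) by (intro measurable_PiM_single') (auto simp: space_PiM)
  then have idm: "(\<lambda>\<omega>. \<omega>) \<in> measurable ?N P" by simp
  show "sets P \<subseteq> sigma_sets (space P) quadrants"
  proof
    fix A assume A: "A \<in> sets P"
    have "(\<lambda>\<omega>. \<omega>) -` A \<inter> space ?N \<in> sets ?N" by (rule measurable_sets[OF idm A])
    then show "A \<in> sigma_sets (space P) quadrants" using sets.sets_into_space[OF A] by (simp add: N Int_absorb2)
  qed
qed

text \<open>Dynkin's argument. Intersecting with a box keeps all measures finite, which makes
  complements expressible as differences and gives a dominating function for disjoint
  unions.\<close>

lemma approximable_indicator_sbox: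
  assumes A: "A \<in> sets P"
  shows "approximable (indicator (A \<inter> sbox R))"
proof -
  have int: "integrable P (indicator (B \<inter> sbox R) :: _ \<Rightarrow> real)" if "B \<in> sets P" for B
    using that emeasure_sbox[of R] by (intro integrable_real_indicator) (auto intro: order.strict_trans1[OF emeasure_mono])
  have sub: "quadrants \<subseteq> Pow (space P)" by (auto simp: quadrants_def quadrant_def)
  have box: "approximable (indicator (sbox R))"
  proof -
    have "quadrant (\<lambda>_. int R) 0 \<inter> sbox R = sbox R" by (auto simp: quadrant_def sbox_def)
    then show ?thesis using approximable_step[OF step_quadrant_sbox[of 0 "\<lambda>_. int R" R]] by simp
  qed
  from A have "A \<in> sigma_sets (space P) quadrants" by (simp only: sets_P_eq_sigma_quadrants)
  with Int_stable_quadrants sub show ?thesis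
  proof (induction rule: sigma_sets_induct_disjoint)
    case (basic A)
    then show ?case using approximable_step[OF step_quadrant_sbox] by (auto simp: quadrants_def)
  next
    case empty
    show ?case using approximable_scale[OF box, of 0] by simp
  next
    case (compl A)
    have "(\<lambda>x. indicator (sbox R) x + (- 1) * indicator (A \<inter> sbox R) x) = (indicator ((space P - A) \<inter> sbox R) :: _ \<Rightarrow> real)"
      by (auto simp: fun_eq_iff indicator_def sbox_def)
    then show ?case using approximable_add[OF box approximable_scale[OF compl(2), of "- 1"]] by simp
  next
    case (union A)
    have Am: "A i \<in> sets P" for i using union(2) by (auto simp: sets_P_eq_sigma_quadrants)
    let ?s = "\<lambda>m x. \<Sum>i<m. indicator (A i \<inter> sbox R) x :: real"
    let ?f = "indicator ((\<Union>i. A i) \<inter> sbox R) :: _ \<Rightarrow> real"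
    have s: "approximable (?s m)" for m
    proof (induction m)
      case 0 then show ?case using approximable_scale[OF box, of 0] by simp
    next
      case (Suc m) then show ?case using approximable_add[OF _ union(3)[of m]] by simp
    qed
    have eq: "?s m x = indicator ((\<Union>i<m. A i) \<inter> sbox R) x" for m x
    proof -
      have "disjoint_family_on (\<lambda>i. A i \<inter> sbox R) {..<m}" using union(1) by (auto simp: disjoint_family_on_def)
      then have "indicator (\<Union>i<m. A i \<inter> sbox R) x = ?s m x"
        by (intro indicator_UN_disjoint) auto
      then show ?thesis by simp
    qed
    have "(\<lambda>m. \<integral>x. \<bar>?f x - ?s m x\<bar> \<partial>P) \<longlonglongrightarrow> (\<integral>x. 0 \<partial>P)"
    proof (rule integral_dominated_convergence[where w="indicator (sbox R)"])
      show "integrable P (indicator (sbox R) :: _ \<Rightarrow> real)" using box by (simp add: approximable_def)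
      show "AE x in P. (\<lambda>m. \<bar>?f x - ?s m x\<bar>) \<longlonglongrightarrow> 0"
      proof (rule AE_I2)
        fix x
        show "(\<lambda>m. \<bar>?f x - ?s m x\<bar>) \<longlonglongrightarrow> 0"
        proof (cases "\<exists>i. x \<in> A i")
          case True
          then obtain i where i: "x \<in> A i" by auto
          have "\<bar>?f x - ?s m x\<bar> = 0" if "m > i" for m
            unfolding eq using i that by (auto simp: indicator_def)
          then show ?thesis by (intro tendsto_eventually) (auto simp: eventually_sequentially intro!: exI[of _ "Suc i"])
        next
          case False
          then show ?thesis unfolding eq by simp
        qed
      qed
      show "AE x in P. norm \<bar>?f x - ?s m x\<bar> \<le> indicator (sbox R) x" for m
        unfolding eq by (rule AE_I2) (auto simp: indicator_def)
    qed (use Am in measurable)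
    then have "approximable ?f"
      by (intro approximable_lim[OF s]) (use Am int in auto)
    then show ?case by simp
  qed
qed

text \<open>The boxes are removed by dominated convergence; closure under sums and limits then
  carries the density from indicators to all integrable functions.\<close>

lemma approximable_integrable:
  assumes "integrable P f" shows "approximable f"
  using assms
proof (induction rule: integrable_induct)
  case (base A c)
  have "approximable (indicator A)"
  proof (rule approximable_lim)
    show "approximable (indicator (A \<inter> sbox R))" for R by (rule approximable_indicator_sbox[OF base(1)])
    show iA: "integrable P (indicator A :: _ \<Rightarrow> real)" using base by (intro integrable_real_indicator) auto
    have "(\<lambda>R. \<integral>x. \<bar>indicator A x - indicator (A \<inter> sbox R) x\<bar> \<partial>P) \<longlonglongrightarrow> (\<integral>x. (0::real) \<partial>P)"
    proof (rule integral_dominated_convergence[where w="indicator A", OF _ _ iA])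
      show "AE x in P. (\<lambda>R. \<bar>indicator A x - indicator (A \<inter> sbox R) x\<bar>) \<longlonglongrightarrow> (0::real)"
      proof (rule AE_I2)
        fix x assume x: "x \<in> space P"
        obtain N :: nat where N: "(\<Sum>l<n. \<bar>x l\<bar>) < real N" using reals_Archimedean2 by blast
        have "x \<in> sbox R" if "R \<ge> N" for R
          unfolding sbox_def
        proof (intro CollectI conjI x allI impI)
          fix i assume "i < n"
          then have "\<bar>x i\<bar> \<le> (\<Sum>l<n. \<bar>x l\<bar>)" by (intro member_le_sum) auto
          then have "\<bar>x i\<bar> < real R" using N that by linarith
          then show "- real R \<le> x i" "x i < real R" by auto
        qed
        then have "\<bar>indicator A x - indicator (A \<inter> sbox R) x\<bar> = (0::real)" if "R \<ge> N" for R
          using that by (auto simp: indicator_def)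
        then show "(\<lambda>R. \<bar>indicator A x - indicator (A \<inter> sbox R) x\<bar>) \<longlonglongrightarrow> (0::real)"
          by (intro tendsto_eventually) (auto simp: eventually_sequentially)
      qed
      show "AE x in P. norm (\<bar>indicator A x - indicator (A \<inter> sbox R) x\<bar> :: real) \<le> (indicator A x :: real)" for R
        by (rule AE_I2) (auto simp: indicator_def)
    qed (use base in measurable)
    then show "(\<lambda>R. \<integral>x. \<bar>indicator A x - indicator (A \<inter> sbox R) x\<bar> \<partial>P) \<longlonglongrightarrow> (0::real)" by simp
  qed
  from approximable_scale[OF this, of c] show ?case by (simp add: mult.commute)
next
  case (add f g)
  then show ?case by (intro approximable_add)
next
  case (lim f s)
  show ?case
  proof (rule approximable_lim)
    have m[measurable]: "f \<in> borel_measurable P" "\<And>i. s i \<in> borel_measurable P" using lim by (auto simp: integrable_iff_bounded)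
    have "(\<lambda>i. \<integral>x. \<bar>f x - s i x\<bar> \<partial>P) \<longlonglongrightarrow> (\<integral>x. 0 \<partial>P)"
    proof (rule integral_dominated_convergence[where w="\<lambda>x. 3 * \<bar>f x\<bar>"])
      show "integrable P (\<lambda>x. 3 * \<bar>f x\<bar>)" using lim by simp
      show "AE x in P. (\<lambda>i. \<bar>f x - s i x\<bar>) \<longlonglongrightarrow> 0"
      proof (rule AE_I2)
        fix x assume "x \<in> space P"
        then have "(\<lambda>i. f x - s i x) \<longlonglongrightarrow> f x - f x" by (intro tendsto_diff tendsto_const lim)
        from tendsto_rabs[OF this] show "(\<lambda>i. \<bar>f x - s i x\<bar>) \<longlonglongrightarrow> 0" by simp
      qed
      show "AE x in P. norm \<bar>f x - s i x\<bar> \<le> 3 * \<bar>f x\<bar>" for i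
      proof (rule AE_I2)
        fix x assume "x \<in> space P"
        from lim(3)[OF this, of i] show "norm \<bar>f x - s i x\<bar> \<le> 3 * \<bar>f x\<bar>" by (simp add: abs_real_def split: if_splits)
      qed
    qed measurable
    then show "(\<lambda>i. \<integral>x. \<bar>f x - s i x\<bar> \<partial>P) \<longlonglongrightarrow> 0" by simp
  qed (use lim in auto)
qed

lemma step_approximation:
  assumes "integrable P f" "e > 0"
  obtains s F where "step s F" "(\<integral>x. \<bar>f x - F x\<bar> \<partial>P) < e"
  using approximable_integrable[OF assms(1)] assms(2) unfolding approximable_def by blast

section \<open>Calderon-Zygmund decomposition and the Poisson maximal function\<close>

text \<open>The set is the limit inferior of the \<open>E k\<close>: a point outside it lies outside
  infinitely many \<open>E k\<close>, which suffices when a bound is passed to a limit.\<close>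

lemma emeasure_UN_inter_le:
  fixes E :: "nat \<Rightarrow> (nat \<Rightarrow> real) set"
  assumes E: "\<And>k. E k \<in> sets P" "\<And>k. emeasure P (E k) \<le> ennreal (c k)" and c: "c \<longlonglongrightarrow> L" "\<And>k. 0 \<le> c k"
  shows "emeasure P (\<Union>m. \<Inter>k\<in>{m..}. E k) \<le> ennreal L"
proof -
  have [measurable]: "(\<Inter>k\<in>{m..}. E k) \<in> sets P" for m using E(1) by (intro sets.countable_INT') auto
  have "emeasure P (\<Inter>k\<in>{m..}. E k) \<le> ennreal L" for m
  proof (rule tendsto_lowerbound[OF tendsto_ennrealI[OF c(1)]])
    show "\<forall>\<^sub>F k in sequentially. emeasure P (\<Inter>k\<in>{m..}. E k) \<le> ennreal (c k)"
      unfolding eventually_sequentially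
    proof (intro exI[of _ m] allI impI)
      fix k assume "m \<le> k"
      then have "emeasure P (\<Inter>k\<in>{m..}. E k) \<le> emeasure P (E k)" by (intro emeasure_mono E) auto
      then show "emeasure P (\<Inter>k\<in>{m..}. E k) \<le> ennreal (c k)" using E(2)[of k] by (rule order_trans)
    qed
  qed simp
  moreover have "emeasure P (\<Union>m. \<Inter>k\<in>{m..}. E k) = (SUP m. emeasure P (\<Inter>k\<in>{m..}. E k))"
    by (rule SUP_emeasure_incseq[symmetric]) (auto simp: incseq_def)
  ultimately show ?thesis by (simp add: SUP_least)
qed

text \<open>Weak type bounds are stated with an exceptional set instead of the superlevel set of the
  maximal function, which avoids its measurability.\<close>
lemma weak_type_extend:
  fixes K :: "'i \<Rightarrow> ((nat \<Rightarrow> real) \<Rightarrow> real) \<Rightarrow> (nat \<Rightarrow> real) \<Rightarrow> real"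
  assumes cont: "\<And>i x g G. i \<in> J \<Longrightarrow> x \<in> space P \<Longrightarrow> integrable P g \<Longrightarrow> (\<And>k::nat. integrable P (G k)) \<Longrightarrow>
      (\<lambda>k. \<integral>y. \<bar>g y - G k y\<bar> \<partial>P) \<longlonglongrightarrow> 0 \<Longrightarrow> (\<lambda>k. K i (G k) x) \<longlonglongrightarrow> K i g x"
    and st: "\<And>s F. step s F \<Longrightarrow> \<exists>E\<in>sets P. emeasure P E \<le> ennreal (C * (\<integral>x. \<bar>F x\<bar> \<partial>P)) \<and>
        (\<forall>x\<in>space P - E. \<forall>i\<in>J. \<bar>K i F x\<bar> \<le> B)"
    and C: "0 \<le> C" and f: "integrable P f"
  shows "\<exists>E\<in>sets P. emeasure P E \<le> ennreal (C * (\<integral>x. \<bar>f x\<bar> \<partial>P)) \<and>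
        (\<forall>x\<in>space P - E. \<forall>i\<in>J. \<bar>K i f x\<bar> \<le> B)"
proof -
  have "\<forall>k. \<exists>F. (\<exists>s. step s F) \<and> (\<integral>x. \<bar>f x - F x\<bar> \<partial>P) < 1 / real (Suc k)"
  proof
    fix k show "\<exists>F. (\<exists>s. step s F) \<and> (\<integral>x. \<bar>f x - F x\<bar> \<partial>P) < 1 / real (Suc k)"
      by (rule step_approximation[OF f, of "1 / real (Suc k)"]) auto
  qed
  then obtain F where F: "\<And>k. \<exists>s. step s (F k)" "\<And>k. (\<integral>x. \<bar>f x - F k x\<bar> \<partial>P) < 1 / real (Suc k)" by metis
  have Fi: "integrable P (F k)" for k using F(1)[of k] step_integrable by blast
  have lim: "(\<lambda>k. \<integral>x. \<bar>f x - F k x\<bar> \<partial>P) \<longlonglongrightarrow> 0"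
  proof (rule tendsto_sandwich[OF _ _ tendsto_const LIMSEQ_Suc[OF lim_1_over_n]])
    show "\<forall>\<^sub>F k in sequentially. (\<integral>x. \<bar>f x - F k x\<bar> \<partial>P) \<le> 1 / real (Suc k)"
      using less_imp_le[OF F(2)] by (intro always_eventually) blast
  qed simp
  have lim1: "(\<lambda>k. C * (\<integral>x. \<bar>F k x\<bar> \<partial>P)) \<longlonglongrightarrow> C * (\<integral>x. \<bar>f x\<bar> \<partial>P)"
  proof (rule tendsto_mult_left)
    show "(\<lambda>k. \<integral>x. \<bar>F k x\<bar> \<partial>P) \<longlonglongrightarrow> (\<integral>x. \<bar>f x\<bar> \<partial>P)"
    proof (rule LIM_zero_cancel, rule Lim_null_comparison[OF _ lim], rule always_eventually, rule allI)
      fix k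
      have "(\<integral>x. \<bar>F k x\<bar> \<partial>P) - (\<integral>x. \<bar>f x\<bar> \<partial>P) = (\<integral>x. \<bar>F k x\<bar> - \<bar>f x\<bar> \<partial>P)" using Fi f by simp
      also have "norm \<dots> \<le> (\<integral>x. norm (\<bar>F k x\<bar> - \<bar>f x\<bar>) \<partial>P)" by (rule integral_norm_bound)
      also have "\<dots> \<le> (\<integral>x. \<bar>f x - F k x\<bar> \<partial>P)" using Fi f by (intro integral_mono) auto
      finally show "norm ((\<integral>x. \<bar>F k x\<bar> \<partial>P) - (\<integral>x. \<bar>f x\<bar> \<partial>P)) \<le> (\<integral>x. \<bar>f x - F k x\<bar> \<partial>P)" .
    qed
  qed
  have "\<forall>k. \<exists>E. E \<in> sets P \<and> emeasure P E \<le> ennreal (C * (\<integral>x. \<bar>F k x\<bar> \<partial>P)) \<and> (\<forall>x\<in>space P - E. \<forall>i\<in>J. \<bar>K i (F k) x\<bar> \<le> B)"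
  proof
    fix k
    obtain s where "step s (F k)" using F(1)[of k] by auto
    from st[OF this] show "\<exists>E. E \<in> sets P \<and> emeasure P E \<le> ennreal (C * (\<integral>x. \<bar>F k x\<bar> \<partial>P)) \<and> (\<forall>x\<in>space P - E. \<forall>i\<in>J. \<bar>K i (F k) x\<bar> \<le> B)"
      by blast
  qed
  then obtain E where "\<forall>k. E k \<in> sets P \<and> emeasure P (E k) \<le> ennreal (C * (\<integral>x. \<bar>F k x\<bar> \<partial>P)) \<and> (\<forall>x\<in>space P - E k. \<forall>i\<in>J. \<bar>K i (F k) x\<bar> \<le> B)"
    by (rule choice[THEN exE])
  then have E: "E k \<in> sets P" "emeasure P (E k) \<le> ennreal (C * (\<integral>x. \<bar>F k x\<bar> \<partial>P))"
      "x \<in> space P \<Longrightarrow> x \<notin> E k \<Longrightarrow> i \<in> J \<Longrightarrow> \<bar>K i (F k) x\<bar> \<le> B" for k x i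
    by blast+
  let ?E = "\<Union>m. \<Inter>k\<in>{m..}. E k"
  show ?thesis
  proof (intro bexI[of _ ?E] conjI ballI)
    show "?E \<in> sets P" using E(1) by (intro sets.countable_UN'' sets.countable_INT') auto
    show "emeasure P ?E \<le> ennreal (C * (\<integral>x. \<bar>f x\<bar> \<partial>P))"
      by (rule emeasure_UN_inter_le[OF E(1,2) lim1]) (use C in auto)
    fix x i assume x: "x \<in> space P - ?E" and i: "i \<in> J"
    have l: "(\<lambda>k. \<bar>K i (F k) x\<bar>) \<longlonglongrightarrow> \<bar>K i f x\<bar>"
      using x by (intro tendsto_rabs cont[OF i _ f Fi lim]) auto
    \<comment> \<open>If the bound failed for one \<open>i\<close>, it would fail for all late
      approximants as well, and \<open>x\<close> would lie in all late \<open>E k\<close>.\<close>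
    show "\<bar>K i f x\<bar> \<le> B"
    proof (rule ccontr)
      assume "\<not> ?thesis"
      then have "\<forall>\<^sub>F k in sequentially. B < \<bar>K i (F k) x\<bar>" by (intro order_tendstoD(1)[OF l]) simp
      then obtain m where m: "\<And>k. k \<ge> m \<Longrightarrow> B < \<bar>K i (F k) x\<bar>" unfolding eventually_sequentially by blast
      have "x \<in> (\<Inter>k\<in>{m..}. E k)"
      proof (rule INT_I)
        fix k assume "k \<in> {m..}"
        then have "B < \<bar>K i (F k) x\<bar>" using m by simp
        then show "x \<in> E k" using E(3)[of x k i] x i by (meson DiffD1 not_less)
      qed
      then show False using x by blast
    qed
  qed
qed

text \<open>The stopping cubes are the largest dyadic cubes on which the average exceeds \<open>lam\<close>; for a
  step function there are only finitely many of them.\<close>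
lemma Calderon_Zygmund_cubes:
  assumes F: "step s0 F" and F0: "\<And>x. x \<in> space P \<Longrightarrow> 0 \<le> F x" and lam: "lam > 0"
  obtains I where "finite I" "\<And>s m. (s, m) \<in> I \<Longrightarrow> s > 0"
    "disjoint_family_on (\<lambda>(s, m). cube s m) I"
    "\<And>s m. (s, m) \<in> I \<Longrightarrow> lam * s ^ n < (\<integral>x. indicator (cube s m) x * F x \<partial>P)"
    "\<And>s m. (s, m) \<in> I \<Longrightarrow> (\<integral>x. indicator (cube s m) x * F x \<partial>P) \<le> 2 ^ n * lam * s ^ n"
    "\<And>x. x \<in> space P \<Longrightarrow> x \<notin> (\<Union>(s, m)\<in>I. cube s m) \<Longrightarrow> F x \<le> lam"
proof -
  have s0: "s0 > 0" by (rule step_pos[OF F])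
  have Fi: "integrable P F" by (rule step_integrable[OF F])
  define S where "S l = s0 * real (2 ^ l)" for l :: nat
  have S: "S l > 0" for l unfolding S_def using s0 by simp
  have n1: "n \<ge> 1" using j_less by simp
  define w where "w Q = (\<integral>x. indicator Q x * F x \<partial>P)" for Q
  have wi: "integrable P (\<lambda>x. indicator (cube s m) x * F x)" for s m
    using integrable_real_mult_indicator[OF sets_cube Fi] by (simp add: mult.commute)
  define N where "N = (\<integral>x. F x \<partial>P)"
  have wN: "w (cube s m) \<le> N" for s m
    unfolding w_def N_def using wi Fi F0 by (intro integral_mono) (auto simp: indicator_def)
  have N0: "0 \<le> N" unfolding N_def using F0 by (intro integral_nonneg_AE AE_I2) auto
  define W where "W l x = w (cube (S l) (cell (S l) x))" for l x
  have coars: "cell (S l') x = cell (S l') y" if "cell (S l) x = cell (S l) y" "l \<le> l'" for l l' x y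
  proof -
    have "S l' = S l * real (2 ^ (l' - l))" unfolding S_def using that(2) by (simp flip: power_add)
    then show ?thesis using cell_coarsen[OF S that(1), of "2 ^ (l' - l)"] by simp
  qed
  \<comment> \<open>From scale \<open>L0\<close> on even the full mass \<open>N\<close> is too small
    for a cube average above \<open>lam\<close>, so the stopping scales are bounded.\<close>
  obtain L0 where L0: "N < lam * s0 ^ n * 2 ^ L0"
  proof -
    obtain L0 where "N / (lam * s0 ^ n) < 2 ^ L0" using real_arch_pow[of 2] by auto
    then have "N < lam * s0 ^ n * 2 ^ L0" using lam s0 by (simp add: pos_divide_less_eq mult.commute)
    then show ?thesis by (rule that)
  qed
  define L where "L x = {l. lam * S l ^ n < W l x}" for x
  have LL0: "l < L0" if "l \<in> L x" for l x
  proof (rule ccontr)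
    assume "\<not> l < L0"
    then have "(2::real) ^ L0 \<le> 2 ^ (l * n)" using n1 by (intro power_increasing) (auto intro: order_trans[of L0 l])
    then have "lam * s0 ^ n * 2 ^ L0 \<le> lam * s0 ^ n * 2 ^ (l * n)" using lam s0 by (intro mult_left_mono) auto
    also have "\<dots> = lam * S l ^ n" by (simp add: S_def power_mult_distrib power_mult)
    also have "\<dots> < N" using that wN unfolding L_def W_def by (auto intro: less_le_trans)
    finally show False using L0 by simp
  qed
  have finL: "finite (L x)" for x by (rule finite_subset[of _ "{..<L0}"]) (use LL0 in auto)
  define \<Omega> where "\<Omega> = {x \<in> space P. L x \<noteq> {}}"
  define lx where "lx x = Max (L x)" for x
  have lx: "lx x \<in> L x" if "x \<in> \<Omega>" for x unfolding lx_def using that finL by (intro Max_in) (auto simp: \<Omega>_def)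
  have lx_max: "l \<le> lx x" if "l \<in> L x" for l x unfolding lx_def using that finL by simp
  define q where "q x = (S (lx x), cell (S (lx x)) x)" for x
  define I where "I = q ` \<Omega>"
  have Lcell: "l \<in> L y" if "l \<in> L x" "cell (S l) x = cell (S l) y" for l x y
    using that unfolding L_def W_def by simp
  \<comment> \<open>Two stopping cubes with a common point have the same scale: the larger one
    contains the base point of the smaller, so its scale is admissible there too, and the scale of
    the smaller one was maximal.\<close>
  have key: "lx x = lx y" if xy: "x \<in> \<Omega>" "y \<in> \<Omega>" and z: "cell (S (lx x)) z = cell (S (lx x)) x" "cell (S (lx y)) z = cell (S (lx y)) y" for x y z
  proof -
    have A: "lx x \<le> lx y" if "lx y \<le> lx x" "x \<in> \<Omega>" "cell (S (lx x)) z = cell (S (lx x)) x" "cell (S (lx y)) z = cell (S (lx y)) y" for x y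
    proof -
      have "cell (S (lx x)) z = cell (S (lx x)) y" by (rule coars[OF that(4,1)])
      then have "cell (S (lx x)) x = cell (S (lx x)) y" using that(3) by simp
      then have "lx x \<in> L y" by (rule Lcell[OF lx[OF that(2)]])
      then show ?thesis by (rule lx_max)
    qed
    show ?thesis using A[of y x] A[of x y] xy z by (cases "lx x \<le> lx y") auto
  qed
  show thesis
  proof (rule that[of I])
    show "finite I"
    proof (rule finite_subset)
      \<comment> \<open>Every stopping cube contains a cell of the support of \<open>F\<close>, and
        its scale together with that cell determines it.\<close>
      show "finite (\<Union>l\<in>{..<L0}. (\<lambda>m. (S l, \<lambda>i\<in>{..<n}. m i div int (2 ^ l))) ` supp_cells s0 F)"
        using step_finite[OF F] by auto
      show "I \<subseteq> (\<Union>l\<in>{..<L0}. (\<lambda>m. (S l, \<lambda>i\<in>{..<n}. m i div int (2 ^ l))) ` supp_cells s0 F)"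
      proof
        fix Q assume "Q \<in> I"
        then obtain x where x: "x \<in> \<Omega>" "Q = q x" unfolding I_def by auto
        let ?l = "lx x"
        have "\<exists>y\<in>cube (S ?l) (cell (S ?l) x). F y \<noteq> 0"
        proof (rule ccontr)
          assume "\<not> ?thesis"
          then have "W ?l x = (\<integral>y. 0 \<partial>P)"
            unfolding W_def w_def by (intro Bochner_Integration.integral_cong) (auto simp: indicator_def)
          then have "W ?l x = 0" by simp
          moreover have "0 < lam * S ?l ^ n" using lam S[of ?l] by simp
          ultimately show False using lx[OF x(1)] unfolding L_def by simp
        qed
        then obtain y where y: "y \<in> space P" "cell (S ?l) y = cell (S ?l) x" "F y \<noteq> 0"
          using mem_cube_cell[OF S] by auto
        have "cell (S ?l) y = (\<lambda>i\<in>{..<n}. cell s0 y i div int (2 ^ ?l))"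
        proof -
          have "\<lfloor>y i / (s0 * real (2 ^ ?l))\<rfloor> = \<lfloor>y i / s0\<rfloor> div int (2 ^ ?l)" for i
            using floor_div_nat[of "y i / s0" "2 ^ ?l"] by simp
          then show ?thesis unfolding cell_def S_def by (intro restrict_ext) simp
        qed
        moreover have "cell s0 y \<in> supp_cells s0 F" using y by (auto simp: supp_cells_def)
        moreover have "?l < L0" by (rule LL0[OF lx[OF x(1)]])
        ultimately show "Q \<in> (\<Union>l\<in>{..<L0}. (\<lambda>m. (S l, \<lambda>i\<in>{..<n}. m i div int (2 ^ l))) ` supp_cells s0 F)"
          unfolding x(2) q_def y(2)[symmetric] by blast
      qed
    qed
    show "s > 0" if "(s, m) \<in> I" for s m using that S by (auto simp: I_def q_def)
    show "disjoint_family_on (\<lambda>(s, m). cube s m) I"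
      unfolding disjoint_family_on_def
    proof (intro ballI impI)
      fix Q Q' assume QQ: "Q \<in> I" "Q' \<in> I" "Q \<noteq> Q'"
      then obtain x y where xy: "x \<in> \<Omega>" "Q = q x" "y \<in> \<Omega>" "Q' = q y" unfolding I_def by auto
      show "(case Q of (s, m) \<Rightarrow> cube s m) \<inter> (case Q' of (s, m) \<Rightarrow> cube s m) = {}"
      proof (rule ccontr)
        assume "\<not> ?thesis"
        then obtain z where "z \<in> cube (S (lx x)) (cell (S (lx x)) x)" "z \<in> cube (S (lx y)) (cell (S (lx y)) y)"
          unfolding xy q_def by auto
        then have z: "cell (S (lx x)) z = cell (S (lx x)) x" "cell (S (lx y)) z = cell (S (lx y)) y"
          using mem_cube_cell[OF S] by auto
        have "lx x = lx y" by (rule key[OF xy(1,3) z])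
        then have "q x = q y" using z unfolding q_def by simp
        then show False using QQ xy by simp
      qed
    qed
    show "lam * s ^ n < (\<integral>x. indicator (cube s m) x * F x \<partial>P)" if "(s, m) \<in> I" for s m
      using that lx unfolding I_def q_def L_def W_def w_def by auto
    show "(\<integral>x. indicator (cube s m) x * F x \<partial>P) \<le> 2 ^ n * lam * s ^ n" if sm: "(s, m) \<in> I" for s m
    proof -
      obtain x where x: "x \<in> \<Omega>" "s = S (lx x)" "m = cell (S (lx x)) x" using sm unfolding I_def q_def by auto
      \<comment> \<open>By maximality the dyadic parent has average at most \<open>lam\<close>; its
        volume is larger by the factor 2^n, and \<open>F\<close> is nonnegative.\<close>
      have "Suc (lx x) \<notin> L x" using lx_max[of "Suc (lx x)" x] by auto
      then have "W (Suc (lx x)) x \<le> lam * S (Suc (lx x)) ^ n" unfolding L_def by simp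
      also have "\<dots> = 2 ^ n * lam * s ^ n" unfolding x S_def by (simp add: power_mult_distrib)
      finally have up: "W (Suc (lx x)) x \<le> 2 ^ n * lam * s ^ n" .
      have sub: "y \<in> cube (S (Suc (lx x))) (cell (S (Suc (lx x))) x)" if "y \<in> cube (S (lx x)) (cell (S (lx x)) x)" for y
        using that coars[of "lx x" y x "Suc (lx x)"] mem_cube_cell[OF S] by auto
      have "W (lx x) x \<le> W (Suc (lx x)) x" unfolding W_def w_def
        using wi F0 sub by (intro integral_mono) (auto simp: indicator_def)
      then show ?thesis using up unfolding W_def w_def x by simp
    qed
    fix x assume x: "x \<in> space P" "x \<notin> (\<Union>(s, m)\<in>I. cube s m)"
    have "x \<notin> \<Omega>"
    proof
      assume "x \<in> \<Omega>"
      then have "q x \<in> I" unfolding I_def by blast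
      moreover have "x \<in> cube (S (lx x)) (cell (S (lx x)) x)" using x(1) mem_cube_cell[OF S] by blast
      ultimately show False using x(2) unfolding q_def by blast
    qed
    \<comment> \<open>Scale 0 is the grid of \<open>F\<close> itself, where the average over the
      cube is the value \<open>F x\<close>.\<close>
    then have "0 \<notin> L x" using x(1) unfolding \<Omega>_def by auto
    then have "W 0 x \<le> lam * s0 ^ n" unfolding L_def S_def by simp
    moreover have "W 0 x = F x * s0 ^ n"
    proof -
      have "W 0 x = (\<integral>y. F x * indicator (cube s0 (cell s0 x)) y \<partial>P)"
        unfolding W_def w_def S_def
      proof (rule Bochner_Integration.integral_cong)
        fix y assume y: "y \<in> space P"
        show "indicator (cube (s0 * real (2 ^ 0)) (cell (s0 * real (2 ^ 0)) x)) y * F y = F x * indicator (cube s0 (cell s0 x)) y"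
          using step_const[OF F y x(1)] mem_cube_cell[OF s0, of y x] by (auto simp: indicator_def)
      qed simp
      also have "\<dots> = F x * s0 ^ n" using s0 by (simp add: measure_cube)
      finally show ?thesis .
    qed
    ultimately show "F x \<le> lam" using s0 by simp
  qed
qed

text \<open>The dilated cubes in the exceptional set have 4 n times the original side.\<close>

definition CE :: real where "CE = real (4 * n) ^ n"
definition CM :: real where "CM = 2 ^ (3 * n + 2) + 1"

lemma n_pos: "real n > 0" "n \<ge> 1"
  using j_less by auto

lemma sum_indicator_disjoint:
  assumes "finite I" "disjoint_family_on A I"
  shows "(\<Sum>i\<in>I. indicator (A i) x) = (indicator (\<Union>i\<in>I. A i) x :: real)"
  by (rule indicator_UN_disjoint[OF assms, symmetric])

text \<open>Off the dilated cubes every stopping cube looks like a point, so by Harnack each mass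
  \<open>w Q\<close> at the corner may be spread over the cube with density at most 2^n lam. The
  cubes are disjoint and the Poisson kernel has mass one; this gives the last estimate, uniformly in
  \<open>r\<close>, with the two factors 2^n and 2^(n+1).\<close>

lemma Calderon_Zygmund_structure:
  assumes F: "step s0 F" and F0: "\<And>x. x \<in> space P \<Longrightarrow> 0 \<le> F x" and lam: "lam > 0"
  obtains I E w where "finite I" "\<And>Q. Q \<in> I \<Longrightarrow> fst Q > 0"
    "disjoint_family_on (\<lambda>Q. cube (fst Q) (snd Q)) I"
    "\<And>Q. w Q = (\<integral>x. indicator (cube (fst Q) (snd Q)) x * F x \<partial>P)"
    "\<And>Q. 0 \<le> w Q"
    "\<And>Q. Q \<in> I \<Longrightarrow> w Q \<le> 2 ^ n * lam * fst Q ^ n"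
    "\<And>x. x \<in> space P \<Longrightarrow> x \<notin> (\<Union>Q\<in>I. cube (fst Q) (snd Q)) \<Longrightarrow> F x \<le> lam"
    "(\<Sum>Q\<in>I. w Q) \<le> (\<integral>x. F x \<partial>P)"
    "E \<in> sets P" "emeasure P E \<le> ennreal (CE / lam * (\<integral>x. F x \<partial>P))"
    "\<And>x Q. x \<in> space P \<Longrightarrow> x \<notin> E \<Longrightarrow> Q \<in> I \<Longrightarrow> 2 * (real n * fst Q) < edist x (corner (fst Q) (snd Q))"
    "\<And>x r. x \<in> space P \<Longrightarrow> x \<notin> E \<Longrightarrow> r > 0 \<Longrightarrow>
       (\<Sum>Q\<in>I. w Q * pois r x (corner (fst Q) (snd Q))) \<le> 2 ^ (2 * n + 1) * lam"
proof -
  have Fi: "integrable P F" by (rule step_integrable[OF F])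
  obtain I where I: "finite I" "\<And>s m. (s, m) \<in> I \<Longrightarrow> s > 0"
    "disjoint_family_on (\<lambda>(s, m). cube s m) I"
    "\<And>s m. (s, m) \<in> I \<Longrightarrow> lam * s ^ n < (\<integral>x. indicator (cube s m) x * F x \<partial>P)"
    "\<And>s m. (s, m) \<in> I \<Longrightarrow> (\<integral>x. indicator (cube s m) x * F x \<partial>P) \<le> 2 ^ n * lam * s ^ n"
    "\<And>x. x \<in> space P \<Longrightarrow> x \<notin> (\<Union>(s, m)\<in>I. cube s m) \<Longrightarrow> F x \<le> lam"
    by (rule Calderon_Zygmund_cubes[OF F F0 lam]) blast+
  define cu where "cu Q = cube (fst Q) (snd Q)" for Q
  have cu_eq: "cu = (\<lambda>Q. cube (fst Q) (snd Q))" by (rule ext) (rule cu_def)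
  define w where "w Q = (\<integral>x. indicator (cu Q) x * F x \<partial>P)" for Q
  have cuS [measurable]: "cu Q \<in> sets P" for Q unfolding cu_def by measurable
  have s: "fst Q > 0" if "Q \<in> I" for Q using I(2)[of "fst Q" "snd Q"] that by simp
  have disj: "disjoint_family_on cu I" using I(3) unfolding cu_eq by (simp only: case_prod_unfold)
  have w0: "0 \<le> w Q" for Q unfolding w_def using F0 by (intro integral_nonneg_AE AE_I2) auto
  have wl: "lam * fst Q ^ n < w Q" if "Q \<in> I" for Q using I(4)[of "fst Q" "snd Q"] that unfolding w_def cu_def by simp
  have wu: "w Q \<le> 2 ^ n * lam * fst Q ^ n" if "Q \<in> I" for Q using I(5)[of "fst Q" "snd Q"] that unfolding w_def cu_def by simp
  have off: "F x \<le> lam" if "x \<in> space P" "x \<notin> (\<Union>Q\<in>I. cu Q)" for x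
  proof -
    have eq: "(\<Union>(s, m)\<in>I. cube s m) = (\<Union>Q\<in>I. cu Q)" by (simp add: cu_def case_prod_unfold)
    show ?thesis by (rule I(6)[OF that(1), unfolded eq, OF that(2)])
  qed
  have wi: "integrable P (\<lambda>x. indicator (cu Q) x * F x)" for Q
    using integrable_real_mult_indicator[OF cuS Fi] by (simp add: mult.commute)
  have sumw: "(\<Sum>Q\<in>I. w Q) \<le> (\<integral>x. F x \<partial>P)"
  proof -
    have "(\<Sum>Q\<in>I. w Q) = (\<integral>x. (\<Sum>Q\<in>I. indicator (cu Q) x * F x) \<partial>P)"
      unfolding w_def using wi by (subst Bochner_Integration.integral_sum) auto
    also have "\<dots> \<le> (\<integral>x. F x \<partial>P)"
    proof (rule integral_mono)
      fix x assume "x \<in> space P"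
      then show "(\<Sum>Q\<in>I. indicator (cu Q) x * F x) \<le> F x"
        unfolding sum_distrib_right[symmetric] sum_indicator_disjoint[OF I(1) disj] using F0 by (auto simp: indicator_def)
    qed (use wi Fi in auto)
    finally show ?thesis .
  qed
  \<comment> \<open>The half side 2 n s is twice the bound n s for the distance of a point of the
    cube from its corner (\<open>edist_corner_cube\<close>).\<close>
  define dil where "dil Q = Pi\<^sub>E {..<n} (\<lambda>i. {fst Q * snd Q i - 2 * (real n * fst Q)..fst Q * snd Q i + 2 * (real n * fst Q)})" for Q :: "real \<times> (nat \<Rightarrow> int)"
  have [measurable]: "dil Q \<in> sets P" for Q unfolding dil_def by (rule sets_PiM_I_finite) auto
  have edil: "emeasure P (dil Q) = ennreal (CE * fst Q ^ n)" if "Q \<in> I" for Q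
  proof -
    have "emeasure P (dil Q) = (\<Prod>i<n. ennreal (4 * (real n * fst Q)))"
      unfolding dil_def using s[OF that] by (subst lborel_product.emeasure_PiM) auto
    also have "\<dots> = ennreal (CE * fst Q ^ n)" using s[OF that] by (simp add: ennreal_power CE_def power_mult_distrib mult.assoc)
    finally show ?thesis .
  qed
  define E where "E = (\<Union>Q\<in>I. dil Q)"
  have Em: "E \<in> sets P" unfolding E_def using I(1) by (intro sets.finite_UN) auto
  have Ee: "emeasure P E \<le> ennreal (CE / lam * (\<integral>x. F x \<partial>P))"
  proof -
    have CE0: "0 \<le> CE" by (simp add: CE_def)
    have "emeasure P E \<le> (\<Sum>Q\<in>I. emeasure P (dil Q))" unfolding E_def using I(1) by (intro emeasure_subadditive_finite) auto
    also have "\<dots> = ennreal (\<Sum>Q\<in>I. CE * fst Q ^ n)" using edil s CE0 by (subst sum_ennreal[symmetric]) (auto simp: less_imp_le)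
    also have "\<dots> \<le> ennreal (CE / lam * (\<integral>x. F x \<partial>P))"
    proof (rule ennreal_leI)
      have "(\<Sum>Q\<in>I. CE * fst Q ^ n) \<le> (\<Sum>Q\<in>I. CE / lam * w Q)"
      proof (rule sum_mono)
        fix Q assume "Q \<in> I"
        then have "CE / lam * (lam * fst Q ^ n) \<le> CE / lam * w Q"
          using wl[of Q] lam CE0 by (intro mult_left_mono) auto
        then show "CE * fst Q ^ n \<le> CE / lam * w Q" using lam by simp
      qed
      also have "\<dots> \<le> CE / lam * (\<integral>x. F x \<partial>P)"
        unfolding sum_distrib_left[symmetric] using sumw lam CE0 by (intro mult_left_mono) auto
      finally show "(\<Sum>Q\<in>I. CE * fst Q ^ n) \<le> CE / lam * (\<integral>x. F x \<partial>P)" .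
    qed
    finally show ?thesis .
  qed
  have far: "2 * (real n * fst Q) < edist x (corner (fst Q) (snd Q))" if x: "x \<in> space P" "x \<notin> E" and Q: "Q \<in> I" for x Q
  proof -
    have "x \<notin> dil Q" using x Q unfolding E_def by blast
    then obtain i where i: "i < n" "x i \<notin> {fst Q * snd Q i - 2 * (real n * fst Q)..fst Q * snd Q i + 2 * (real n * fst Q)}"
      using x(1) unfolding dil_def space_P by (auto simp: PiE_iff)
    then have "2 * (real n * fst Q) < \<bar>x i - corner (fst Q) (snd Q) i\<bar>" by (auto simp: corner_def)
    also have "\<dots> \<le> edist x (corner (fst Q) (snd Q))" by (rule coord_le_edist[OF i(1)])
    finally show ?thesis .
  qed
  have K1: "(\<Sum>Q\<in>I. w Q * pois r x (corner (fst Q) (snd Q))) \<le> 2 ^ (2 * n + 1) * lam"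
    if x: "x \<in> space P" "x \<notin> E" and r: "r > 0" for x r
  proof -
    have pI: "integrable P (\<lambda>y. indicator (cu Q) y * pois r x y)" for Q
      using integrable_real_mult_indicator[OF cuS integrable_pois[OF r x(1)]] by (simp add: mult.commute)
    have "(\<Sum>Q\<in>I. w Q * pois r x (corner (fst Q) (snd Q))) \<le> (\<Sum>Q\<in>I. 2 ^ n * lam * 2 ^ (n + 1) * (\<integral>y. indicator (cu Q) y * pois r x y \<partial>P))"
    proof (rule sum_mono)
      fix Q assume Q: "Q \<in> I"
      let ?c = "corner (fst Q) (snd Q)"
      have "fst Q ^ n * pois r x ?c = (\<integral>y. indicator (cu Q) y * pois r x ?c \<partial>P)"
        using s[OF Q] by (simp add: cu_def measure_cube)
      also have "\<dots> \<le> (\<integral>y. 2 ^ (n + 1) * (indicator (cu Q) y * pois r x y) \<partial>P)"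
      proof (rule integral_mono)
        show "integrable P (\<lambda>y. indicator (cu Q) y * pois r x ?c)"
          using s[OF Q] by (intro integrable_mult_left integrable_real_indicator) (auto simp: cu_def emeasure_cube)
        show "integrable P (\<lambda>y. 2 ^ (n + 1) * (indicator (cu Q) y * pois r x y))" using pI by (rule integrable_mult_right)
        fix y assume "y \<in> space P"
        have "pois r x ?c \<le> 2 ^ (n + 1) * pois r x y" if "y \<in> cu Q"
        proof (rule pois_Harnack[OF r])
          show "edist x y \<le> 2 * edist x ?c"
            using edist_triangle[of x y ?c] edist_commute[of ?c y] edist_corner_cube[OF s[OF Q] that[unfolded cu_def]]
              far[OF x Q] edist_nonneg[of x ?c] by linarith
        qed
        then show "indicator (cu Q) y * pois r x ?c \<le> 2 ^ (n + 1) * (indicator (cu Q) y * pois r x y)"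
          by (auto simp: indicator_def)
      qed
      finally have a: "fst Q ^ n * pois r x ?c \<le> 2 ^ (n + 1) * (\<integral>y. indicator (cu Q) y * pois r x y \<partial>P)" by simp
      have "w Q * pois r x ?c \<le> (2 ^ n * lam * fst Q ^ n) * pois r x ?c" using wu[OF Q] r by (intro mult_right_mono) auto
      also have "\<dots> = 2 ^ n * lam * (fst Q ^ n * pois r x ?c)" by simp
      also have "\<dots> \<le> 2 ^ n * lam * (2 ^ (n + 1) * (\<integral>y. indicator (cu Q) y * pois r x y \<partial>P))"
        using a lam by (intro mult_left_mono) auto
      finally show "w Q * pois r x ?c \<le> 2 ^ n * lam * 2 ^ (n + 1) * (\<integral>y. indicator (cu Q) y * pois r x y \<partial>P)" by (simp add: mult.assoc)
    qed
    also have "\<dots> = 2 ^ n * lam * 2 ^ (n + 1) * (\<integral>y. (\<Sum>Q\<in>I. indicator (cu Q) y * pois r x y) \<partial>P)"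
      unfolding sum_distrib_left[symmetric] using pI by (subst Bochner_Integration.integral_sum) auto
    also have "\<dots> \<le> 2 ^ n * lam * 2 ^ (n + 1) * (\<integral>y. pois r x y \<partial>P)"
    proof (rule mult_left_mono, rule integral_mono)
      show "integrable P (\<lambda>y. \<Sum>Q\<in>I. indicator (cu Q) y * pois r x y)" using pI by (intro Bochner_Integration.integrable_sum) auto
      show "integrable P (\<lambda>y. pois r x y)" by (rule integrable_pois[OF r x(1)])
      show "(\<Sum>Q\<in>I. indicator (cu Q) y * pois r x y) \<le> pois r x y" for y
        unfolding sum_distrib_right[symmetric] sum_indicator_disjoint[OF I(1) disj] using r by (auto simp: indicator_def)
    qed (use lam in simp)
    also have "\<dots> = 2 ^ (2 * n + 1) * lam"
    proof -
      have "n + (n + 1) = 2 * n + 1" by simp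
      then have pw: "(2::real) ^ n * 2 ^ (n + 1) = 2 ^ (2 * n + 1)" by (simp only: power_add[symmetric])
      have "2 ^ n * lam * 2 ^ (n + 1) * (\<integral>y. pois r x y \<partial>P) = (2 ^ n * 2 ^ (n + 1)) * lam"
        unfolding integral_pois[OF r x(1)] by (simp only: mult_1_right mult.assoc mult.commute[of lam])
      then show ?thesis unfolding pw .
    qed
    finally show ?thesis .
  qed
  show thesis
    by (rule that[OF I(1) s disj[unfolded cu_eq] w_def[unfolded cu_def] w0 wu off[unfolded cu_def] sumw Em Ee far K1])
qed

text \<open>Weak type (1,1) of the Poisson maximal function, read off from the stopping cubes
  instead of a covering lemma: off them \<open>F\<close> is at most \<open>lam\<close>, and on them
  Harnack moves the mass to the corner.\<close>

lemma maximal_step: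
  assumes F: "step s0 F" and F0: "\<And>x. x \<in> space P \<Longrightarrow> 0 \<le> F x" and lam: "lam > 0"
  shows "\<exists>E\<in>sets P. emeasure P E \<le> ennreal (CE / lam * (\<integral>x. F x \<partial>P)) \<and>
    (\<forall>x\<in>space P - E. \<forall>r>0. pois_op r F x \<le> CM * lam)"
proof -
  have Fi: "integrable P F" by (rule step_integrable[OF F])
  obtain I E w where I: "finite I" "\<And>Q. Q \<in> I \<Longrightarrow> fst Q > 0"
    and disj: "disjoint_family_on (\<lambda>Q. cube (fst Q) (snd Q)) I"
    and w: "\<And>Q. w Q = (\<integral>x. indicator (cube (fst Q) (snd Q)) x * F x \<partial>P)"
    and off: "\<And>x. x \<in> space P \<Longrightarrow> x \<notin> (\<Union>Q\<in>I. cube (fst Q) (snd Q)) \<Longrightarrow> F x \<le> lam"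
    and E: "E \<in> sets P" "emeasure P E \<le> ennreal (CE / lam * (\<integral>x. F x \<partial>P))"
    and far: "\<And>x Q. x \<in> space P \<Longrightarrow> x \<notin> E \<Longrightarrow> Q \<in> I \<Longrightarrow> 2 * (real n * fst Q) < edist x (corner (fst Q) (snd Q))"
    and K1: "\<And>x r. x \<in> space P \<Longrightarrow> x \<notin> E \<Longrightarrow> r > 0 \<Longrightarrow>
       (\<Sum>Q\<in>I. w Q * pois r x (corner (fst Q) (snd Q))) \<le> 2 ^ (2 * n + 1) * lam"
    by (rule Calderon_Zygmund_structure[OF F F0 lam], assumption) (rule that; assumption)
  show ?thesis
  proof (intro bexI[of _ E] conjI E ballI allI impI)
    fix x and r :: real assume "x \<in> space P - E" and r: "r > 0"
    then have x: "x \<in> space P" "x \<notin> E" by auto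
    let ?cu = "\<lambda>Q. cube (fst Q) (snd Q)" and ?c = "\<lambda>Q. corner (fst Q) (snd Q)"
    have wi: "integrable P (\<lambda>y. indicator (?cu Q) y * F y)" for Q
      using integrable_real_mult_indicator[OF sets_cube Fi] by (simp add: mult.commute)
    note ki = integrable_kernel_mult(2)[OF wi x(1) r]
    have "pois_op r F x \<le> (\<integral>y. lam * pois r x y + (\<Sum>Q\<in>I. pois r x y * (indicator (?cu Q) y * F y)) \<partial>P)"
      unfolding pois_op_def
    proof (rule integral_mono)
      show "integrable P (\<lambda>y. pois r x y * F y)" by (rule integrable_kernel_mult(2)[OF Fi x(1) r])
      show "integrable P (\<lambda>y. lam * pois r x y + (\<Sum>Q\<in>I. pois r x y * (indicator (?cu Q) y * F y)))"
        using ki integrable_pois[OF r x(1)] by (intro Bochner_Integration.integrable_add Bochner_Integration.integrable_sum integrable_mult_right) auto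
      fix y assume y: "y \<in> space P"
      have "F y \<le> lam + indicator (\<Union>Q\<in>I. ?cu Q) y * F y" using off[OF y] lam by (auto simp: indicator_def)
      then have "F y \<le> lam + (\<Sum>Q\<in>I. indicator (?cu Q) y) * F y"
        unfolding sum_indicator_disjoint[OF I(1) disj] .
      then have "pois r x y * F y \<le> pois r x y * (lam + (\<Sum>Q\<in>I. indicator (?cu Q) y) * F y)" using r by (intro mult_left_mono) auto
      then show "pois r x y * F y \<le> lam * pois r x y + (\<Sum>Q\<in>I. pois r x y * (indicator (?cu Q) y * F y))"
        by (simp add: algebra_simps sum_distrib_left)
    qed
    also have "\<dots> = lam + (\<Sum>Q\<in>I. \<integral>y. pois r x y * (indicator (?cu Q) y * F y) \<partial>P)"
      using ki integrable_pois[OF r x(1)] integral_pois[OF r x(1)] by simp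
    also have "\<dots> \<le> lam + (\<Sum>Q\<in>I. 2 ^ (n + 1) * (w Q * pois r x (?c Q)))"
    proof (intro add_left_mono sum_mono)
      fix Q assume Q: "Q \<in> I"
      have "(\<integral>y. pois r x y * (indicator (?cu Q) y * F y) \<partial>P) \<le> (\<integral>y. 2 ^ (n + 1) * pois r x (?c Q) * (indicator (?cu Q) y * F y) \<partial>P)"
      proof (rule integral_mono[OF ki integrable_mult_right[OF wi]])
        fix y assume y: "y \<in> space P"
        have "pois r x y \<le> 2 ^ (n + 1) * pois r x (?c Q)" if "y \<in> ?cu Q"
        proof (rule pois_Harnack[OF r])
          show "edist x (?c Q) \<le> 2 * edist x y"
            using edist_triangle[of x "?c Q" y] edist_corner_cube[OF I(2)[OF Q] that] far[OF x Q] by linarith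
        qed
        then show "pois r x y * (indicator (?cu Q) y * F y) \<le> 2 ^ (n + 1) * pois r x (?c Q) * (indicator (?cu Q) y * F y)"
          using F0[OF y] by (auto simp: indicator_def mult_right_mono)
      qed
      also have "\<dots> = 2 ^ (n + 1) * (w Q * pois r x (?c Q))" unfolding w by simp
      finally show "(\<integral>y. pois r x y * (indicator (?cu Q) y * F y) \<partial>P) \<le> 2 ^ (n + 1) * (w Q * pois r x (?c Q))" .
    qed
    also have "\<dots> \<le> lam + 2 ^ (n + 1) * (2 ^ (2 * n + 1) * lam)"
      unfolding sum_distrib_left[symmetric] using K1[OF x r] by (intro add_left_mono mult_left_mono) auto
    also have "\<dots> = CM * lam"
    proof -
      have "(2::real) ^ (n + 1) * 2 ^ (2 * n + 1) = 2 ^ (3 * n + 2)" by (simp flip: power_add)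
      then have "lam + 2 ^ (n + 1) * (2 ^ (2 * n + 1) * lam) = lam + 2 ^ (3 * n + 2) * lam"
        by (simp only: mult.assoc[symmetric])
      then show ?thesis unfolding CM_def distrib_right by (simp only: mult_1 add.commute)
    qed
    finally show "pois_op r F x \<le> CM * lam" .
  qed
qed

lemma tendsto_kernel_integral:
  fixes k g :: "(nat \<Rightarrow> real) \<Rightarrow> real" and G :: "nat \<Rightarrow> (nat \<Rightarrow> real) \<Rightarrow> real"
  assumes k: "k \<in> borel_measurable P" "\<And>y. \<bar>k y\<bar> \<le> b" and g: "integrable P g" "\<And>m. integrable P (G m)"
    and lim: "(\<lambda>m. \<integral>y. \<bar>g y - G m y\<bar> \<partial>P) \<longlonglongrightarrow> 0"
  shows "(\<lambda>m. \<integral>y. k y * G m y \<partial>P) \<longlonglongrightarrow> (\<integral>y. k y * g y \<partial>P)"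
proof (rule LIM_zero_cancel, rule Lim_null_comparison[OF _ tendsto_mult_right_zero[OF lim, of b]], rule always_eventually, rule allI)
  fix m
  have i: "integrable P (\<lambda>y. k y * G m y)" "integrable P (\<lambda>y. k y * g y)"
    by (rule integrable_bounded_mult[of _ _ _ b]; use k g in simp)+
  have "(\<integral>y. k y * G m y \<partial>P) - (\<integral>y. k y * g y \<partial>P) = (\<integral>y. k y * G m y - k y * g y \<partial>P)" using i by simp
  also have "norm \<dots> \<le> (\<integral>y. norm (k y * G m y - k y * g y) \<partial>P)" by (rule integral_norm_bound)
  also have "\<dots> \<le> (\<integral>y. b * \<bar>g y - G m y\<bar> \<partial>P)"
  proof (rule integral_mono)
    show "integrable P (\<lambda>y. norm (k y * G m y - k y * g y))" using i by auto
    show "integrable P (\<lambda>y. b * \<bar>g y - G m y\<bar>)" using g by auto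
    fix y
    have "norm (k y * G m y - k y * g y) = \<bar>k y\<bar> * \<bar>g y - G m y\<bar>"
      by (simp add: abs_mult[symmetric] right_diff_distrib abs_minus_commute)
    also have "\<dots> \<le> b * \<bar>g y - G m y\<bar>" using k(2) by (intro mult_right_mono) auto
    finally show "norm (k y * G m y - k y * g y) \<le> b * \<bar>g y - G m y\<bar>" .
  qed
  finally show "norm ((\<integral>y. k y * G m y \<partial>P) - (\<integral>y. k y * g y \<partial>P)) \<le> b * (\<integral>y. \<bar>g y - G m y\<bar> \<partial>P)" by simp
qed

lemma maximal_weak_type:
  assumes f: "integrable P f" and lam: "lam > 0"
  shows "\<exists>E\<in>sets P. emeasure P E \<le> ennreal (CE / lam * (\<integral>x. \<bar>f x\<bar> \<partial>P)) \<and>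
    (\<forall>x\<in>space P - E. \<forall>r\<in>{0<..}. \<bar>pois_op r (\<lambda>y. \<bar>f y\<bar>) x\<bar> \<le> CM * lam)"
proof (rule weak_type_extend[where K="\<lambda>(r::real) f. pois_op r (\<lambda>y. \<bar>f y\<bar>)"])
  show "0 \<le> CE / lam" using lam by (simp add: CE_def)
next
  fix s F assume F: "step s F"
  have F': "step s (\<lambda>x. \<bar>F x\<bar>)" using step_comp[OF F, of abs] by simp
  show "\<exists>E\<in>sets P. emeasure P E \<le> ennreal (CE / lam * (\<integral>x. \<bar>F x\<bar> \<partial>P)) \<and>
    (\<forall>x\<in>space P - E. \<forall>r\<in>{0<..}. \<bar>pois_op r (\<lambda>y. \<bar>F y\<bar>) x\<bar> \<le> CM * lam)"
    using maximal_step[OF F' _ lam] pois_op_nonneg[of "\<lambda>y. \<bar>F y\<bar>"] by (simp add: Ball_def)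
next
  fix r :: real and x and g :: "(nat \<Rightarrow> real) \<Rightarrow> real" and G :: "nat \<Rightarrow> (nat \<Rightarrow> real) \<Rightarrow> real"
  assume r: "r \<in> {0<..}" and x [measurable]: "x \<in> space P" and g: "integrable P g" "\<And>k. integrable P (G k)"
    and lim: "(\<lambda>k. \<integral>y. \<bar>g y - G k y\<bar> \<partial>P) \<longlonglongrightarrow> 0"
  have "(\<lambda>k. \<integral>y. \<bar>\<bar>g y\<bar> - \<bar>G k y\<bar>\<bar> \<partial>P) \<longlonglongrightarrow> 0"
  proof (rule tendsto_sandwich[OF _ _ tendsto_const lim])
    show "\<forall>\<^sub>F k in sequentially. (\<integral>y. \<bar>\<bar>g y\<bar> - \<bar>G k y\<bar>\<bar> \<partial>P) \<le> (\<integral>y. \<bar>g y - G k y\<bar> \<partial>P)"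
      using g by (intro always_eventually allI integral_mono) auto
  qed simp
  then show "(\<lambda>k. pois_op r (\<lambda>y. \<bar>G k y\<bar>) x) \<longlonglongrightarrow> pois_op r (\<lambda>y. \<bar>g y\<bar>) x"
    unfolding pois_op_def using g r by (intro tendsto_kernel_integral[of _ "cn / r ^ n"] pois_bounded) auto
qed (rule f)

section \<open>The maximal truncation\<close>

text \<open>The constant of \<open>pois_lower_ball\<close> divided by the volume of the cube over
  which Cotlar's inequality averages.\<close>

definition CD :: real where "CD = 2 ^ (n + 1) * real n ^ n / cn"
definition C5 :: real where "C5 = sqrt (3 * (CK\<^sup>2 + CD + CT * CD) * CM)"

lemma CT_nonneg: "0 \<le> CT" unfolding CT_def B0_def by simp
lemma CE_nonneg: "0 \<le> CE" unfolding CE_def by simp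
lemma CM_pos: "0 < CM" unfolding CM_def by (simp add: add_pos_pos)
lemma CD_nonneg: "0 \<le> CD" unfolding CD_def using less_imp_le[OF cn_pos] by simp
lemma C5_nonneg: "0 \<le> C5" unfolding C5_def using CT_nonneg CD_nonneg CM_pos by simp

lemma integrable_trunc_square:
  assumes "integrable P f" "integrable P (\<lambda>x. (f x)\<^sup>2)" "r > 0"
  shows "integrable P (\<lambda>x. (trunc r f x)\<^sup>2)" "(\<integral>x. (trunc r f x)\<^sup>2 \<partial>P) \<le> CT * (\<integral>x. (f x)\<^sup>2 \<partial>P)"
proof -
  have [measurable]: "f \<in> borel_measurable P" using assms(1) by simp
  note T = trunc_L2[OF assms]
  show i: "integrable P (\<lambda>x. (trunc r f x)\<^sup>2)"
    using order_le_less_trans[OF T] by (intro integrableI_bounded) auto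
  have "ennreal (\<integral>x. (trunc r f x)\<^sup>2 \<partial>P) = (\<integral>\<^sup>+x. ennreal ((trunc r f x)\<^sup>2) \<partial>P)"
    using i by (intro nn_integral_eq_integral[symmetric]) auto
  with T have "ennreal (\<integral>x. (trunc r f x)\<^sup>2 \<partial>P) \<le> ennreal (CT * (\<integral>x. (f x)\<^sup>2 \<partial>P))" by (simp only:)
  moreover have "0 \<le> CT * (\<integral>x. (f x)\<^sup>2 \<partial>P)" using CT_nonneg by simp
  ultimately show "(\<integral>x. (trunc r f x)\<^sup>2 \<partial>P) \<le> CT * (\<integral>x. (f x)\<^sup>2 \<partial>P)" by (simp only: ennreal_le_iff)
qed

lemma pois_lower_ball:
  assumes e: "\<epsilon> > 0" and y: "edist x y \<le> \<epsilon>"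
  shows "1 \<le> 2 ^ (n + 1) * \<epsilon> ^ n / cn * pois \<epsilon> x y"
proof -
  have "1 = 2 ^ (n + 1) * \<epsilon> ^ n / cn * (cn * \<epsilon> / (2 * \<epsilon>) ^ (n + 1))"
    using e cn_pos by (simp add: power_mult_distrib del: cn_pos)
  also have "\<dots> \<le> 2 ^ (n + 1) * \<epsilon> ^ n / cn * pois \<epsilon> x y"
    using e y less_imp_le[OF cn_pos] by (intro mult_left_mono pois_lower) auto
  finally show ?thesis .
qed

text \<open>Cotlar's inequality: the truncation at \<open>\<epsilon>\<close> is compared with the average over a small cube of
  the finer truncation applied to the part of \<open>g\<close> away from \<open>x\<close>.\<close>
lemma Cotlar:
  assumes g: "integrable P g" and g2: "integrable P (\<lambda>x. (g x)\<^sup>2)" and x: "x \<in> space P"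
    and \<delta>: "\<delta> > 0" and \<epsilon>: "2 * \<delta> \<le> \<epsilon>"
  shows "(trunc \<epsilon> g x)\<^sup>2 \<le> 3 * (CK\<^sup>2 * pois_op \<epsilon> (\<lambda>y. (g y)\<^sup>2) x + CD * pois_op \<epsilon> (\<lambda>y. (trunc \<delta> g y)\<^sup>2) x + CT * CD * pois_op \<epsilon> (\<lambda>y. (g y)\<^sup>2) x)"
proof -
  have e: "\<epsilon> > 0" using \<delta> \<epsilon> by simp
  have gm [measurable]: "g \<in> borel_measurable P" using g by simp
  have [measurable]: "x \<in> space P" by (rule x)
  define f1 where "f1 y = (if edist x y < \<epsilon> then g y else 0)" for y
  define f2 where "f2 y = (if edist x y < \<epsilon> then 0 else g y)" for y
  have m [measurable]: "f1 \<in> borel_measurable P" "f2 \<in> borel_measurable P" unfolding f1_def f2_def by measurable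
  have i1: "integrable P f1" by (rule Bochner_Integration.integrable_bound[OF g]) (auto simp: f1_def)
  have i2: "integrable P f2" by (rule Bochner_Integration.integrable_bound[OF g]) (auto simp: f2_def)
  have i12: "integrable P (\<lambda>y. (f1 y)\<^sup>2)" by (rule Bochner_Integration.integrable_bound[OF g2]) (auto simp: f1_def)
  define A where "A = CK * pois_op \<epsilon> (\<lambda>y. \<bar>g y\<bar>) x"
  have A0: "0 \<le> A" unfolding A_def using pois_op_nonneg[of "\<lambda>y. \<bar>g y\<bar>" \<epsilon> x] e CK_ge(1) by simp
  have A2: "A\<^sup>2 \<le> CK\<^sup>2 * pois_op \<epsilon> (\<lambda>y. (g y)\<^sup>2) x"
    unfolding A_def power_mult_distrib using pois_op_square_le[of "\<lambda>y. \<bar>g y\<bar>" x \<epsilon>] g g2 x e by (intro mult_left_mono) auto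
  \<comment> \<open>A cube of side \<open>\<epsilon> / n\<close> about \<open>x\<close> stays within
    distance \<open>\<epsilon> / 2\<close> of \<open>x\<close>, so the kernel is smooth between
    \<open>U\<close> and the support of \<open>f2\<close>.\<close>
  define U where "U = Pi\<^sub>E {..<n} (\<lambda>i. {x i - \<epsilon> / (2 * n)..x i + \<epsilon> / (2 * n)})"
  have [measurable]: "U \<in> sets P" unfolding U_def by (rule sets_PiM_I_finite) auto
  have eU: "emeasure P U = ennreal ((\<epsilon> / n) ^ n)"
    unfolding U_def using e by (subst lborel_product.emeasure_PiM) (auto simp: ennreal_power)
  have Ud: "edist x x' \<le> \<epsilon> / 2" if "x' \<in> U" for x'
  proof -
    have "edist x x' \<le> real n * (\<epsilon> / (2 * n))"
    proof (rule edist_le)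
      fix i assume "i < n"
      then have "x' i \<in> {x i - \<epsilon> / (2 * n)..x i + \<epsilon> / (2 * n)}" using that unfolding U_def by (auto simp: PiE_iff)
      then show "\<bar>x i - x' i\<bar> \<le> \<epsilon> / (2 * n)" unfolding atLeastAtMost_iff abs_le_iff by linarith
    qed
    then show ?thesis using n_pos by simp
  qed
  have US: "x' \<in> space P" if "x' \<in> U" for x' using that by (auto simp: U_def space_P PiE_iff)
  \<comment> \<open>Compare \<open>trunc \<epsilon> g x\<close> with
    \<open>trunc \<delta> f2 x'\<close> at the cost of the Poisson error \<open>A\<close>, then use
    that \<open>f2\<close> is \<open>g - f1\<close>.\<close>
  have pt: "(trunc \<epsilon> g x)\<^sup>2 \<le> 3 * (A\<^sup>2 + (trunc \<delta> g x')\<^sup>2 + (trunc \<delta> f1 x')\<^sup>2)" if x'U: "x' \<in> U" for x'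
  proof -
    note x' [measurable] = US[OF x'U]
    have "\<bar>trunc \<epsilon> g x - trunc \<delta> f2 x'\<bar> \<le> A"
    proof -
      have "trunc \<epsilon> g x - trunc \<delta> f2 x' = (\<integral>y. tker \<epsilon> x y * g y - tker \<delta> x' y * f2 y \<partial>P)"
        unfolding trunc_def using integrable_kernel_mult(1)[OF g x e] integrable_kernel_mult(1)[OF i2 x' \<delta>] by simp
      also have "\<bar>\<dots>\<bar> \<le> (\<integral>y. \<bar>tker \<epsilon> x y * g y - tker \<delta> x' y * f2 y\<bar> \<partial>P)" by (rule integral_abs_bound)
      also have "\<dots> \<le> (\<integral>y. CK * (pois \<epsilon> x y * \<bar>g y\<bar>) \<partial>P)"
      proof (rule integral_mono)
        show "integrable P (\<lambda>y. \<bar>tker \<epsilon> x y * g y - tker \<delta> x' y * f2 y\<bar>)"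
          using integrable_kernel_mult(1)[OF g x e] integrable_kernel_mult(1)[OF i2 x' \<delta>] by auto
        show "integrable P (\<lambda>y. CK * (pois \<epsilon> x y * \<bar>g y\<bar>))"
          using integrable_kernel_mult(2)[OF _ x e, of "\<lambda>y. \<bar>g y\<bar>"] g by simp
        fix y
        show "\<bar>tker \<epsilon> x y * g y - tker \<delta> x' y * f2 y\<bar> \<le> CK * (pois \<epsilon> x y * \<bar>g y\<bar>)"
        proof (cases "edist x y < \<epsilon>")
          case True
          then show ?thesis using e CK_ge(1) by (simp add: tker_def f2_def)
        next
          case False
          \<comment> \<open>So the truncation at \<open>\<delta>\<close> about \<open>x'\<close>
            removes nothing from \<open>f2\<close>, and both kernels are the full
            \<open>ker\<close>.\<close>
          have "\<delta> \<le> edist x' y" using edist_triangle[of x y x'] Ud[OF x'U] False \<epsilon> by linarith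
          then have "tker \<epsilon> x y * g y - tker \<delta> x' y * f2 y = (ker x y - ker x' y) * g y"
            using False by (simp add: tker_def f2_def left_diff_distrib)
          moreover have "\<bar>ker x y - ker x' y\<bar> \<le> CK * pois \<epsilon> x y"
            using Ud[OF x'U] False e by (intro ker_diff_le_pois[where \<delta>="\<epsilon> / 2"]) auto
          ultimately show ?thesis unfolding mult.assoc[symmetric] by (simp add: abs_mult mult_right_mono)
        qed
      qed
      also have "\<dots> = A" unfolding A_def pois_op_def by simp
      finally show ?thesis .
    qed
    moreover have "trunc \<delta> g x' = trunc \<delta> f1 x' + trunc \<delta> f2 x'"
    proof -
      have "trunc \<delta> f1 x' + trunc \<delta> f2 x' = (\<integral>y. tker \<delta> x' y * f1 y + tker \<delta> x' y * f2 y \<partial>P)"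
        unfolding trunc_def using integrable_kernel_mult(1)[OF i1 x' \<delta>] integrable_kernel_mult(1)[OF i2 x' \<delta>] by simp
      also have "\<dots> = trunc \<delta> g x'" unfolding trunc_def by (rule Bochner_Integration.integral_cong) (auto simp: f1_def f2_def)
      finally show ?thesis by simp
    qed
    ultimately have "\<bar>trunc \<epsilon> g x\<bar> \<le> A + \<bar>trunc \<delta> g x'\<bar> + \<bar>trunc \<delta> f1 x'\<bar>" by linarith
    then have "\<bar>trunc \<epsilon> g x\<bar>\<^sup>2 \<le> (A + \<bar>trunc \<delta> g x'\<bar> + \<bar>trunc \<delta> f1 x'\<bar>)\<^sup>2" by (rule power_mono) simp
    also have "\<dots> \<le> 3 * (A\<^sup>2 + \<bar>trunc \<delta> g x'\<bar>\<^sup>2 + \<bar>trunc \<delta> f1 x'\<bar>\<^sup>2)"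
      using sum_squares_bound[of A "\<bar>trunc \<delta> g x'\<bar>"] sum_squares_bound[of A "\<bar>trunc \<delta> f1 x'\<bar>"] sum_squares_bound[of "\<bar>trunc \<delta> g x'\<bar>" "\<bar>trunc \<delta> f1 x'\<bar>"]
      by (simp add: power2_eq_square algebra_simps)
    finally show ?thesis by simp
  qed
  let ?D = "2 ^ (n + 1) * \<epsilon> ^ n / cn"
  have D0: "0 \<le> ?D" using e less_imp_le[OF cn_pos] by simp
  have Dp: "0 \<le> ?D * pois \<epsilon> x y" for y using D0 e by (intro mult_nonneg_nonneg) auto
  note b2 = integrable_trunc_square(1)[OF g g2 \<delta>]
  note c2 = integrable_trunc_square[OF i1 i12 \<delta>]
  have iU: "integrable P (\<lambda>x'. indicator U x' * (trunc \<delta> g x')\<^sup>2)"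
    using integrable_real_mult_indicator[OF \<open>U \<in> sets P\<close> b2] by (simp add: mult.commute)
  have bU: "(\<integral>x'. indicator U x' * (trunc \<delta> g x')\<^sup>2 \<partial>P) \<le> ?D * pois_op \<epsilon> (\<lambda>y. (trunc \<delta> g y)\<^sup>2) x"
  proof -
    have "(\<integral>x'. indicator U x' * (trunc \<delta> g x')\<^sup>2 \<partial>P) \<le> (\<integral>x'. ?D * (pois \<epsilon> x x' * (trunc \<delta> g x')\<^sup>2) \<partial>P)"
    proof (rule integral_mono[OF iU])
      show "integrable P (\<lambda>x'. ?D * (pois \<epsilon> x x' * (trunc \<delta> g x')\<^sup>2))"
        by (intro integrable_mult_right integrable_kernel_mult(2)[OF b2 x e])
      fix x'
      have "indicator U x' \<le> ?D * pois \<epsilon> x x'"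
      proof (cases "x' \<in> U")
        case True
        have "edist x x' \<le> \<epsilon>" using Ud[OF True] e by linarith
        from pois_lower_ball[OF e this] True show ?thesis by (simp only: indicator_simps)
      next
        case False
        then show ?thesis using Dp[of x'] by (simp only: indicator_simps not_False_eq_True)
      qed
      then show "indicator U x' * (trunc \<delta> g x')\<^sup>2 \<le> ?D * (pois \<epsilon> x x' * (trunc \<delta> g x')\<^sup>2)"
        unfolding mult.assoc[symmetric] by (rule mult_right_mono) simp
    qed
    then show ?thesis unfolding pois_op_def by simp
  qed
  \<comment> \<open>The part near \<open>x\<close> is not estimated pointwise: the L^2 bound for
    \<open>trunc \<delta>\<close> controls its square integral, and the indicator of the ball is
    then dominated by a multiple of \<open>pois\<close>.\<close>
  have cU: "(\<integral>x'. (trunc \<delta> f1 x')\<^sup>2 \<partial>P) \<le> CT * (?D * pois_op \<epsilon> (\<lambda>y. (g y)\<^sup>2) x)"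
  proof -
    have "(\<integral>y. (f1 y)\<^sup>2 \<partial>P) \<le> (\<integral>y. ?D * (pois \<epsilon> x y * (g y)\<^sup>2) \<partial>P)"
    proof (rule integral_mono[OF i12])
      show "integrable P (\<lambda>y. ?D * (pois \<epsilon> x y * (g y)\<^sup>2))"
        by (intro integrable_mult_right integrable_kernel_mult(2)[OF g2 x e])
      fix y
      have "(if edist x y < \<epsilon> then 1 else 0) \<le> ?D * pois \<epsilon> x y"
        using pois_lower_ball[OF e, of x y] Dp[of y] by (cases "edist x y < \<epsilon>") (simp_all only: if_True if_False less_imp_le)
      then have "(if edist x y < \<epsilon> then 1 else 0) * (g y)\<^sup>2 \<le> ?D * pois \<epsilon> x y * (g y)\<^sup>2" by (rule mult_right_mono) simp
      then show "(f1 y)\<^sup>2 \<le> ?D * (pois \<epsilon> x y * (g y)\<^sup>2)" by (simp add: f1_def mult.assoc split: if_splits)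
    qed
    then have "(\<integral>y. (f1 y)\<^sup>2 \<partial>P) \<le> ?D * pois_op \<epsilon> (\<lambda>y. (g y)\<^sup>2) x" unfolding pois_op_def by simp
    then show ?thesis using c2(2) CT_nonneg by (meson mult_left_mono order_trans)
  qed
  let ?V = "(\<epsilon> / n) ^ n"
  have V: "?V > 0" using e n_pos by simp
  have mU: "measure P U = ?V" unfolding measure_def eU using V by simp
  have iUc: "integrable P (\<lambda>x'. indicator U x' * c)" for c :: real
    by (intro integrable_mult_left integrable_real_indicator) (simp_all add: eU)
  have "?V * (trunc \<epsilon> g x)\<^sup>2 = (\<integral>x'. indicator U x' * (trunc \<epsilon> g x)\<^sup>2 \<partial>P)" by (simp add: mU)
  also have "\<dots> \<le> (\<integral>x'. indicator U x' * (3 * A\<^sup>2) + 3 * (indicator U x' * (trunc \<delta> g x')\<^sup>2) + 3 * (trunc \<delta> f1 x')\<^sup>2 \<partial>P)"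
  proof (rule integral_mono[OF iUc])
    show "integrable P (\<lambda>x'. indicator U x' * (3 * A\<^sup>2) + 3 * (indicator U x' * (trunc \<delta> g x')\<^sup>2) + 3 * (trunc \<delta> f1 x')\<^sup>2)"
      by (intro Bochner_Integration.integrable_add iUc integrable_mult_right iU c2(1))
    show "indicator U x' * (trunc \<epsilon> g x)\<^sup>2 \<le> indicator U x' * (3 * A\<^sup>2) + 3 * (indicator U x' * (trunc \<delta> g x')\<^sup>2) + 3 * (trunc \<delta> f1 x')\<^sup>2" for x'
      using pt[of x'] by (cases "x' \<in> U") auto
  qed
  also have "\<dots> = ?V * (3 * A\<^sup>2) + 3 * (\<integral>x'. indicator U x' * (trunc \<delta> g x')\<^sup>2 \<partial>P) + 3 * (\<integral>x'. (trunc \<delta> f1 x')\<^sup>2 \<partial>P)"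
    using iUc iU c2(1) by (simp add: mU)
  also have "\<dots> \<le> ?V * (3 * A\<^sup>2) + 3 * (?D * pois_op \<epsilon> (\<lambda>y. (trunc \<delta> g y)\<^sup>2) x) + 3 * (CT * (?D * pois_op \<epsilon> (\<lambda>y. (g y)\<^sup>2) x))"
    using bU cU by linarith
  also have "?D = ?V * CD" unfolding CD_def using n_pos by (simp add: power_divide)
  finally have "?V * (trunc \<epsilon> g x)\<^sup>2 \<le> ?V * (3 * (A\<^sup>2 + CD * pois_op \<epsilon> (\<lambda>y. (trunc \<delta> g y)\<^sup>2) x + CT * CD * pois_op \<epsilon> (\<lambda>y. (g y)\<^sup>2) x))"
    by (simp add: algebra_simps)
  then have "(trunc \<epsilon> g x)\<^sup>2 \<le> 3 * (A\<^sup>2 + CD * pois_op \<epsilon> (\<lambda>y. (trunc \<delta> g y)\<^sup>2) x + CT * CD * pois_op \<epsilon> (\<lambda>y. (g y)\<^sup>2) x)"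
    using V by (simp only: mult_le_cancel_left_pos)
  also have "\<dots> \<le> 3 * (CK\<^sup>2 * pois_op \<epsilon> (\<lambda>y. (g y)\<^sup>2) x + CD * pois_op \<epsilon> (\<lambda>y. (trunc \<delta> g y)\<^sup>2) x + CT * CD * pois_op \<epsilon> (\<lambda>y. (g y)\<^sup>2) x)"
    using A2 by simp
  finally show ?thesis .
qed

text \<open>The squared form of Cotlar's inequality involves Poisson averages of the integrable
  functions \<open>g^2\<close> and \<open>(trunc \<delta> g)^2\<close>, so the weak L^1 maximal
  bound applies to both. The constants do not depend on \<open>\<delta>\<close>.\<close>

lemma truncation_weak_L2_aux:
  assumes g: "integrable P g" and g2: "integrable P (\<lambda>x. (g x)\<^sup>2)" and lam: "lam > 0" and \<delta>: "\<delta> > 0"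
  shows "\<exists>E. E \<in> sets P \<and> emeasure P E \<le> ennreal (CE * (1 + CT) / lam\<^sup>2 * (\<integral>x. (g x)\<^sup>2 \<partial>P)) \<and>
    (\<forall>x\<in>space P - E. \<forall>\<epsilon>. 2 * \<delta> \<le> \<epsilon> \<longrightarrow> \<bar>trunc \<epsilon> g x\<bar> \<le> C5 * lam)"
proof -
  define S where "S = (\<integral>x. (g x)\<^sup>2 \<partial>P)"
  have S0: "0 \<le> S" unfolding S_def by simp
  have l2: "lam\<^sup>2 > 0" using lam by simp
  note b2 = integrable_trunc_square[OF g g2 \<delta>]
  obtain E1 where E1: "E1 \<in> sets P" "emeasure P E1 \<le> ennreal (CE / lam\<^sup>2 * S)"
    "\<And>x r. x \<in> space P \<Longrightarrow> x \<notin> E1 \<Longrightarrow> r > 0 \<Longrightarrow> pois_op r (\<lambda>y. (g y)\<^sup>2) x \<le> CM * lam\<^sup>2"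
    using maximal_weak_type[OF g2 l2] unfolding S_def by (auto simp: Ball_def) (meson abs_le_D1)
  obtain E2 where E2: "E2 \<in> sets P" "emeasure P E2 \<le> ennreal (CE / lam\<^sup>2 * (\<integral>x. (trunc \<delta> g x)\<^sup>2 \<partial>P))"
    "\<And>x r. x \<in> space P \<Longrightarrow> x \<notin> E2 \<Longrightarrow> r > 0 \<Longrightarrow> pois_op r (\<lambda>y. (trunc \<delta> g y)\<^sup>2) x \<le> CM * lam\<^sup>2"
    using maximal_weak_type[OF b2(1) l2] by (auto simp: Ball_def) (meson abs_le_D1)
  have "emeasure P (E1 \<union> E2) \<le> emeasure P E1 + emeasure P E2" using E1 E2 by (intro emeasure_subadditive) auto
  also have "\<dots> \<le> ennreal (CE / lam\<^sup>2 * S) + ennreal (CE / lam\<^sup>2 * (CT * S))"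
  proof (rule add_mono[OF E1(2) order_trans[OF E2(2)]], rule ennreal_leI)
    show "CE / lam\<^sup>2 * (\<integral>x. (trunc \<delta> g x)\<^sup>2 \<partial>P) \<le> CE / lam\<^sup>2 * (CT * S)"
      using b2(2) CE_nonneg l2 unfolding S_def by (intro mult_left_mono) auto
  qed
  also have "\<dots> = ennreal (CE * (1 + CT) / lam\<^sup>2 * S)"
    using S0 CE_nonneg CT_nonneg by (subst ennreal_plus[symmetric]) (auto simp: algebra_simps add_divide_distrib)
  finally have e: "emeasure P (E1 \<union> E2) \<le> ennreal (CE * (1 + CT) / lam\<^sup>2 * S)" .
  have "\<bar>trunc \<epsilon> g x\<bar> \<le> C5 * lam" if x: "x \<in> space P" "x \<notin> E1" "x \<notin> E2" and \<epsilon>: "2 * \<delta> \<le> \<epsilon>" for x \<epsilon>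
  proof -
    have e: "\<epsilon> > 0" using \<delta> \<epsilon> by simp
    have "(trunc \<epsilon> g x)\<^sup>2 \<le> 3 * (CK\<^sup>2 * (CM * lam\<^sup>2) + CD * (CM * lam\<^sup>2) + CT * CD * (CM * lam\<^sup>2))"
      using Cotlar[OF g g2 x(1) \<delta> \<epsilon>] E1(3)[OF x(1,2) e] E2(3)[OF x(1,3) e] CD_nonneg CT_nonneg
      by (elim order_trans, intro mult_left_mono add_mono) auto
    also have "\<dots> = (C5 * lam)\<^sup>2"
      unfolding C5_def power_mult_distrib using CD_nonneg CT_nonneg CM_pos by (simp add: algebra_simps)
    finally show ?thesis using abs_le_square_iff[of "trunc \<epsilon> g x" "C5 * lam"] C5_nonneg lam by simp
  qed
  then show ?thesis using e E1(1) E2(1) unfolding S_def by (intro exI[of _ "E1 \<union> E2"]) auto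
qed

text \<open>As \<open>\<delta>\<close> tends to 0 the exceptional sets need not be nested. A point
  outside their limit inferior lies outside sets with arbitrarily small \<open>\<delta>\<close>, so
  every \<open>\<epsilon>\<close> is reached.\<close>

lemma truncation_weak_L2:
  assumes g: "integrable P g" and g2: "integrable P (\<lambda>x. (g x)\<^sup>2)" and lam: "lam > 0"
  shows "\<exists>E\<in>sets P. emeasure P E \<le> ennreal (CE * (1 + CT) / lam\<^sup>2 * (\<integral>x. (g x)\<^sup>2 \<partial>P)) \<and>
    (\<forall>x\<in>space P - E. \<forall>\<epsilon>>0. \<bar>trunc \<epsilon> g x\<bar> \<le> C5 * lam)"
proof -
  let ?c = "CE * (1 + CT) / lam\<^sup>2 * (\<integral>x. (g x)\<^sup>2 \<partial>P)"
  have c0: "0 \<le> ?c" using CE_nonneg CT_nonneg by simp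
  have "\<forall>k. \<exists>E. E \<in> sets P \<and> emeasure P E \<le> ennreal ?c \<and>
    (\<forall>x\<in>space P - E. \<forall>\<epsilon>. 2 * (1 / real (Suc k)) \<le> \<epsilon> \<longrightarrow> \<bar>trunc \<epsilon> g x\<bar> \<le> C5 * lam)"
    by (intro allI truncation_weak_L2_aux[OF g g2 lam]) simp
  then obtain E where "\<forall>k. E k \<in> sets P \<and> emeasure P (E k) \<le> ennreal ?c \<and>
    (\<forall>x\<in>space P - E k. \<forall>\<epsilon>. 2 * (1 / real (Suc k)) \<le> \<epsilon> \<longrightarrow> \<bar>trunc \<epsilon> g x\<bar> \<le> C5 * lam)"
    by (rule choice[THEN exE])
  then have E: "E k \<in> sets P" "emeasure P (E k) \<le> ennreal ?c"
    "x \<in> space P \<Longrightarrow> x \<notin> E k \<Longrightarrow> 2 * (1 / real (Suc k)) \<le> \<epsilon> \<Longrightarrow> \<bar>trunc \<epsilon> g x\<bar> \<le> C5 * lam" for k x \<epsilon>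
    by blast+
  let ?E = "\<Union>m. \<Inter>k\<in>{m..}. E k"
  show ?thesis
  proof (intro bexI[of _ ?E] conjI ballI allI impI)
    show "?E \<in> sets P" using E(1) by (intro sets.countable_UN'' sets.countable_INT') auto
    show "emeasure P ?E \<le> ennreal ?c"
      by (rule emeasure_UN_inter_le[OF E(1,2) tendsto_const]) (rule c0)
    fix x \<epsilon> assume x: "x \<in> space P - ?E" and \<epsilon>: "(0::real) < \<epsilon>"
    obtain m where m: "inverse (real (Suc m)) < \<epsilon> / 2" using reals_Archimedean[of "\<epsilon> / 2"] \<epsilon> by auto
    obtain k where k: "k \<ge> m" "x \<notin> E k" using x by auto
    have "1 / real (Suc k) \<le> 1 / real (Suc m)" using k(1) by (simp add: frac_le)
    then have "2 * (1 / real (Suc k)) \<le> \<epsilon>" using m by (simp add: inverse_eq_divide)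
    then show "\<bar>trunc \<epsilon> g x\<bar> \<le> C5 * lam" using E(3)[of x k \<epsilon>] x k(2) by blast
  qed
qed

section \<open>Weak type (1,1) bound for the maximal truncation, with a constant depending on
  \<open>n\<close>\<close>

lemma trunc_add:
  assumes "integrable P f" "integrable P g" "x \<in> space P" "\<epsilon> > 0"
  shows "trunc \<epsilon> (\<lambda>y. f y + g y) x = trunc \<epsilon> f x + trunc \<epsilon> g x"
  unfolding trunc_def using integrable_kernel_mult(1)[OF assms(1,3,4)] integrable_kernel_mult(1)[OF assms(2,3,4)]
  by (simp add: distrib_left)

lemma trunc_diff:
  assumes "integrable P f" "integrable P g" "x \<in> space P" "\<epsilon> > 0"
  shows "trunc \<epsilon> (\<lambda>y. f y - g y) x = trunc \<epsilon> f x - trunc \<epsilon> g x"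
  unfolding trunc_def using integrable_kernel_mult(1)[OF assms(1,3,4)] integrable_kernel_mult(1)[OF assms(2,3,4)]
  by (simp add: right_diff_distrib)

text \<open>The summands belong to the dilated cubes, to the exceptional set of the good part (whose
  squared L^2 norm is at most 2^n lam times the mass), and to Chebyshev's inequality for the sum
  \<open>J\<close> of Poisson kernels.\<close>

definition CW :: real where "CW = CE + CE * (1 + CT) * 2 ^ n + 1"
definition BW :: real where "BW = C5 + 2 * CK * (1 + 2 ^ (2 * n + 1))"

lemma CW_nonneg: "0 \<le> CW" unfolding CW_def using CE_nonneg CT_nonneg by simp
lemma BW_pos: "0 < BW" unfolding BW_def using C5_nonneg CK_ge(1) by (intro add_nonneg_pos mult_pos_pos add_pos_pos) auto

text \<open>The good part is at most 2^n lam and falls under the L^2 theory. Each bad part has mean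
  zero, so only the variation of the kernel over its cube matters; \<open>tker_diff_le\<close>
  splits this into a term at the scale of the cube and a term at scale
  \<open>\<epsilon>\<close>.\<close>

lemma truncation_weak_step_nonneg:
  assumes F: "step s0 F" and F0: "\<And>x. x \<in> space P \<Longrightarrow> 0 \<le> F x" and lam: "lam > 0"
  shows "\<exists>E\<in>sets P. emeasure P E \<le> ennreal (CW / lam * (\<integral>x. F x \<partial>P)) \<and>
    (\<forall>x\<in>space P - E. \<forall>\<epsilon>>0. \<bar>trunc \<epsilon> F x\<bar> \<le> BW * lam)"
proof -
  have Fi: "integrable P F" by (rule step_integrable[OF F])
  define N where "N = (\<integral>x. F x \<partial>P)"
  have N0: "0 \<le> N" unfolding N_def using F0 by (intro integral_nonneg_AE AE_I2) auto
  obtain I E w where I: "finite I" "\<And>Q. Q \<in> I \<Longrightarrow> fst Q > 0"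
    and disj: "disjoint_family_on (\<lambda>Q. cube (fst Q) (snd Q)) I"
    and w: "\<And>Q. w Q = (\<integral>x. indicator (cube (fst Q) (snd Q)) x * F x \<partial>P)"
    and w0: "\<And>Q. 0 \<le> w Q"
    and wu: "\<And>Q. Q \<in> I \<Longrightarrow> w Q \<le> 2 ^ n * lam * fst Q ^ n"
    and off: "\<And>x. x \<in> space P \<Longrightarrow> x \<notin> (\<Union>Q\<in>I. cube (fst Q) (snd Q)) \<Longrightarrow> F x \<le> lam"
    and sumw: "(\<Sum>Q\<in>I. w Q) \<le> (\<integral>x. F x \<partial>P)"
    and E: "E \<in> sets P" "emeasure P E \<le> ennreal (CE / lam * (\<integral>x. F x \<partial>P))"
    and far: "\<And>x Q. x \<in> space P \<Longrightarrow> x \<notin> E \<Longrightarrow> Q \<in> I \<Longrightarrow> 2 * (real n * fst Q) < edist x (corner (fst Q) (snd Q))"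
    and K1: "\<And>x r. x \<in> space P \<Longrightarrow> x \<notin> E \<Longrightarrow> r > 0 \<Longrightarrow>
       (\<Sum>Q\<in>I. w Q * pois r x (corner (fst Q) (snd Q))) \<le> 2 ^ (2 * n + 1) * lam"
    by (rule Calderon_Zygmund_structure[OF F F0 lam], assumption) (rule that; assumption)
  let ?cu = "\<lambda>Q. cube (fst Q) (snd Q)" and ?c = "\<lambda>Q. corner (fst Q) (snd Q)"
  define a where "a Q = w Q / fst Q ^ n" for Q
  define b where "b Q y = indicator (?cu Q) y * (F y - a Q)" for Q y
  define g where "g y = F y - (\<Sum>Q\<in>I. b Q y)" for y
  have a0: "0 \<le> a Q" if "Q \<in> I" for Q unfolding a_def using w0 I(2)[OF that] by simp
  have au: "a Q \<le> 2 ^ n * lam" if "Q \<in> I" for Q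
    unfolding a_def using wu[OF that] I(2)[OF that] by (simp add: pos_divide_le_eq)
  have cuI: "integrable P (indicator (?cu Q) :: _ \<Rightarrow> real)" if "Q \<in> I" for Q
    using I(2)[OF that] by (intro integrable_real_indicator) (auto simp: emeasure_cube)
  have wi: "integrable P (\<lambda>y. indicator (?cu Q) y * F y)" for Q
    using integrable_real_mult_indicator[OF sets_cube Fi] by (simp add: mult.commute)
  have bi: "integrable P (b Q)" if "Q \<in> I" for Q
    unfolding b_def right_diff_distrib using wi cuI[OF that] by (intro Bochner_Integration.integrable_diff integrable_mult_left) auto
  have bint: "(\<integral>y. b Q y \<partial>P) = 0" if "Q \<in> I" for Q
  proof -
    have "(\<integral>y. b Q y \<partial>P) = w Q - fst Q ^ n * a Q"
      unfolding b_def right_diff_distrib using wi cuI[OF that] I(2)[OF that] by (simp add: w measure_cube)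
    then show ?thesis using I(2)[OF that] by (simp add: a_def)
  qed
  have babs: "(\<integral>y. \<bar>b Q y\<bar> \<partial>P) \<le> 2 * w Q" if "Q \<in> I" for Q
  proof -
    have "(\<integral>y. \<bar>b Q y\<bar> \<partial>P) \<le> (\<integral>y. indicator (?cu Q) y * F y + indicator (?cu Q) y * a Q \<partial>P)"
    proof (rule integral_mono)
      show "integrable P (\<lambda>y. \<bar>b Q y\<bar>)" using bi[OF that] by simp
      show "integrable P (\<lambda>y. indicator (?cu Q) y * F y + indicator (?cu Q) y * a Q)"
        using wi cuI[OF that] by (intro Bochner_Integration.integrable_add integrable_mult_left) auto
      show "\<bar>b Q y\<bar> \<le> indicator (?cu Q) y * F y + indicator (?cu Q) y * a Q" if "y \<in> space P" for y
        unfolding b_def using F0[OF that] a0[OF \<open>Q \<in> I\<close>] by (auto simp: indicator_def)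
    qed
    also have "\<dots> = w Q + fst Q ^ n * a Q" using wi cuI[OF that] I(2)[OF that] by (simp add: w measure_cube)
    also have "\<dots> = 2 * w Q" using I(2)[OF that] by (simp add: a_def)
    finally show ?thesis .
  qed
  have gi: "integrable P g" unfolding g_def using Fi bi by (intro Bochner_Integration.integrable_diff Bochner_Integration.integrable_sum)
  have gcases: "0 \<le> g y \<and> g y \<le> 2 ^ n * lam" if y: "y \<in> space P" for y
  proof (cases "y \<in> (\<Union>Q\<in>I. ?cu Q)")
    case True
    then obtain Q where Q: "Q \<in> I" "y \<in> ?cu Q" by blast
    have "b Q' y = 0" if "Q' \<in> I - {Q}" for Q'
      using that Q disj unfolding b_def disjoint_family_on_def by (auto simp: indicator_def)
    then have "(\<Sum>Q\<in>I. b Q y) = b Q y" using I(1) Q(1) by (subst sum.remove[of I Q]) auto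
    then have "g y = a Q" unfolding g_def b_def using Q by simp
    then show ?thesis using a0[OF Q(1)] au[OF Q(1)] by simp
  next
    case False
    then have "b Q y = 0" if "Q \<in> I" for Q using that unfolding b_def by auto
    then have "g y = F y" unfolding g_def by simp
    moreover have "lam \<le> 2 ^ n * lam" using lam by simp
    ultimately show ?thesis using off[OF y False] F0[OF y] by linarith
  qed
  have gint: "(\<integral>y. g y \<partial>P) = N"
    unfolding g_def N_def using Fi bi bint by (simp add: Bochner_Integration.integral_sum)
  have g2: "integrable P (\<lambda>y. (g y)\<^sup>2)" "(\<integral>y. (g y)\<^sup>2 \<partial>P) \<le> 2 ^ n * lam * N"
  proof -
    have le: "(g y)\<^sup>2 \<le> 2 ^ n * lam * g y" if "y \<in> space P" for y
      unfolding power2_eq_square using gcases[OF that] by (intro mult_right_mono) auto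
    show i: "integrable P (\<lambda>y. (g y)\<^sup>2)"
    proof (rule Bochner_Integration.integrable_bound)
      show "integrable P (\<lambda>y. 2 ^ n * lam * g y)" using gi by simp
      show "AE y in P. norm ((g y)\<^sup>2) \<le> norm (2 ^ n * lam * g y)"
        using le gcases lam by (intro AE_I2) (auto simp: abs_mult)
    qed (use gi in measurable)
    have "(\<integral>y. (g y)\<^sup>2 \<partial>P) \<le> (\<integral>y. 2 ^ n * lam * g y \<partial>P)" using le i gi by (intro integral_mono) auto
    then show "(\<integral>y. (g y)\<^sup>2 \<partial>P) \<le> 2 ^ n * lam * N" using gint by simp
  qed
  obtain E2 where E2: "E2 \<in> sets P" "emeasure P E2 \<le> ennreal (CE * (1 + CT) / lam\<^sup>2 * (\<integral>x. (g x)\<^sup>2 \<partial>P))"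
    "\<And>x \<epsilon>. x \<in> space P \<Longrightarrow> x \<notin> E2 \<Longrightarrow> \<epsilon> > 0 \<Longrightarrow> \<bar>trunc \<epsilon> g x\<bar> \<le> C5 * lam"
    using truncation_weak_L2[OF gi g2(1) lam] by blast
  \<comment> \<open>The error at the scale of the cubes does not involve \<open>\<epsilon>\<close>
    and has integral at most \<open>N\<close>, so Chebyshev's inequality handles it for all
    truncations at once. The error at scale \<open>\<epsilon>\<close> is bounded pointwise by
    \<open>K1\<close>.\<close>
  define J where "J x = (\<Sum>Q\<in>I. w Q * pois (real n * fst Q) x (?c Q))" for x
  have rQ: "real n * fst Q > 0" if "Q \<in> I" for Q using I(2)[OF that] n_pos by simp
  have [measurable]: "J \<in> borel_measurable P" unfolding J_def by measurable
  have J0: "0 \<le> J x" for x unfolding J_def using w0 rQ by (intro sum_nonneg mult_nonneg_nonneg) (auto simp: less_imp_le)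
  define E3 where "E3 = {x \<in> space P. lam < J x}"
  have E3m: "E3 \<in> sets P" unfolding E3_def by measurable
  have pI: "integrable P (\<lambda>x. pois (real n * fst Q) x (?c Q))" "(\<integral>x. pois (real n * fst Q) x (?c Q) \<partial>P) = 1" if "Q \<in> I" for Q
    using integrable_pois[OF rQ[OF that], of "?c Q"] integral_pois[OF rQ[OF that], of "?c Q"]
    by (simp_all add: pois_commute[of _ _ "?c Q"])
  have Ji: "integrable P J" unfolding J_def using pI by (intro Bochner_Integration.integrable_sum integrable_mult_right) auto
  have Jint: "(\<integral>x. J x \<partial>P) \<le> N"
  proof -
    have "(\<integral>x. J x \<partial>P) = (\<Sum>Q\<in>I. w Q)"
      unfolding J_def using pI by (subst Bochner_Integration.integral_sum) auto
    then show ?thesis using sumw unfolding N_def by simp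
  qed
  have E3e: "emeasure P E3 \<le> ennreal (N / lam)"
  proof -
    have "emeasure P E3 = (\<integral>\<^sup>+x. indicator E3 x \<partial>P)" using E3m by simp
    also have "\<dots> \<le> (\<integral>\<^sup>+x. ennreal (J x / lam) \<partial>P)"
      using lam J0 by (intro nn_integral_mono) (auto simp: E3_def indicator_def ennreal_1[symmetric] simp del: ennreal_1 intro!: ennreal_leI)
    also have "\<dots> = ennreal (\<integral>x. J x / lam \<partial>P)" using Ji J0 lam by (intro nn_integral_eq_integral) auto
    also have "\<dots> \<le> ennreal (N / lam)" using Jint lam by (intro ennreal_leI) (simp add: divide_right_mono)
    finally show ?thesis .
  qed
  have bound: "\<bar>trunc \<epsilon> F x\<bar> \<le> BW * lam" if x: "x \<in> space P" "x \<notin> E" "x \<notin> E2" "x \<notin> E3" and e: "\<epsilon> > 0" for x \<epsilon>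
  proof -
    note [measurable] = x(1)
    have "F y = g y + (\<Sum>Q\<in>I. b Q y)" for y unfolding g_def by simp
    then have Feq: "F = (\<lambda>y. g y + (\<Sum>Q\<in>I. b Q y))" by (rule ext)
    have "trunc \<epsilon> F x = trunc \<epsilon> (\<lambda>y. g y + (\<Sum>Q\<in>I. b Q y)) x" by (rule arg_cong[OF Feq])
    also have "\<dots> = trunc \<epsilon> g x + trunc \<epsilon> (\<lambda>y. \<Sum>Q\<in>I. b Q y) x"
      using gi bi x(1) e by (intro trunc_add Bochner_Integration.integrable_sum) auto
    also have "trunc \<epsilon> (\<lambda>y. \<Sum>Q\<in>I. b Q y) x = (\<Sum>Q\<in>I. \<integral>y. tker \<epsilon> x y * b Q y \<partial>P)"
      unfolding trunc_def sum_distrib_left using integrable_kernel_mult(1)[OF bi x(1) e]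
      by (intro Bochner_Integration.integral_sum) auto
    finally have dec: "trunc \<epsilon> F x = trunc \<epsilon> g x + (\<Sum>Q\<in>I. \<integral>y. tker \<epsilon> x y * b Q y \<partial>P)" .
    have "\<bar>\<integral>y. tker \<epsilon> x y * b Q y \<partial>P\<bar> \<le> 2 * CK * (w Q * pois (real n * fst Q) x (?c Q) + w Q * pois \<epsilon> x (?c Q))" if Q: "Q \<in> I" for Q
    proof -
      let ?p = "CK * (pois (real n * fst Q) x (?c Q) + pois \<epsilon> x (?c Q))"
      have p0: "0 \<le> ?p" using CK_ge(1) e rQ[OF Q] by (intro mult_nonneg_nonneg add_nonneg_nonneg) (auto simp: less_imp_le)
      have i: "integrable P (\<lambda>y. tker \<epsilon> x y * b Q y)" by (rule integrable_kernel_mult(1)[OF bi[OF Q] x(1) e])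
      have "(\<integral>y. tker \<epsilon> x y * b Q y \<partial>P) = (\<integral>y. (tker \<epsilon> x y - tker \<epsilon> x (?c Q)) * b Q y \<partial>P)"
        using i bi[OF Q] bint[OF Q] by (simp add: left_diff_distrib)
      also have "\<bar>\<dots>\<bar> \<le> (\<integral>y. \<bar>(tker \<epsilon> x y - tker \<epsilon> x (?c Q)) * b Q y\<bar> \<partial>P)" by (rule integral_abs_bound)
      also have "\<dots> \<le> (\<integral>y. ?p * \<bar>b Q y\<bar> \<partial>P)"
      proof (rule integral_mono)
        show "integrable P (\<lambda>y. \<bar>(tker \<epsilon> x y - tker \<epsilon> x (?c Q)) * b Q y\<bar>)"
          using i bi[OF Q] by (auto simp: left_diff_distrib)
        show "integrable P (\<lambda>y. ?p * \<bar>b Q y\<bar>)" using bi[OF Q] by simp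
        fix y
        show "\<bar>(tker \<epsilon> x y - tker \<epsilon> x (?c Q)) * b Q y\<bar> \<le> ?p * \<bar>b Q y\<bar>"
        proof (cases "y \<in> ?cu Q")
          case True
          have "\<bar>tker \<epsilon> x y - tker \<epsilon> x (?c Q)\<bar> \<le> ?p"
            using edist_corner_cube[OF I(2)[OF Q] True] far[OF x(1,2) Q] rQ[OF Q] e by (intro tker_diff_le) auto
          then show ?thesis unfolding abs_mult by (rule mult_right_mono) simp
        next
          case False
          then have "b Q y = 0" by (simp add: b_def)
          then show ?thesis by simp
        qed
      qed
      also have "\<dots> = ?p * (\<integral>y. \<bar>b Q y\<bar> \<partial>P)" by simp
      also have "\<dots> \<le> ?p * (2 * w Q)" by (rule mult_left_mono[OF babs[OF Q] p0])
      also have "\<dots> = 2 * CK * (w Q * pois (real n * fst Q) x (?c Q) + w Q * pois \<epsilon> x (?c Q))" by (simp add: algebra_simps)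
      finally show ?thesis .
    qed
    then have "\<bar>\<Sum>Q\<in>I. \<integral>y. tker \<epsilon> x y * b Q y \<partial>P\<bar> \<le> (\<Sum>Q\<in>I. 2 * CK * (w Q * pois (real n * fst Q) x (?c Q) + w Q * pois \<epsilon> x (?c Q)))"
      by (intro order_trans[OF sum_abs sum_mono])
    also have "\<dots> = 2 * CK * (J x + (\<Sum>Q\<in>I. w Q * pois \<epsilon> x (?c Q)))"
      unfolding J_def sum.distrib[symmetric] sum_distrib_left ..
    also have "\<dots> \<le> 2 * CK * (lam + 2 ^ (2 * n + 1) * lam)"
      using x K1[OF x(1,2) e] CK_ge(1) by (intro mult_left_mono add_mono) (auto simp: E3_def)
    finally have "\<bar>trunc \<epsilon> F x\<bar> \<le> C5 * lam + 2 * CK * (lam + 2 ^ (2 * n + 1) * lam)"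
      using dec E2(3)[OF x(1,3) e] by linarith
    also have "\<dots> = BW * lam" unfolding BW_def by (simp add: algebra_simps)
    finally show ?thesis .
  qed
  have "emeasure P (E \<union> E2 \<union> E3) \<le> emeasure P E + emeasure P E2 + emeasure P E3"
    using E E2 E3m by (intro order_trans[OF emeasure_subadditive] add_mono emeasure_subadditive) auto
  also have "\<dots> \<le> ennreal (CE / lam * N) + ennreal (CE * (1 + CT) * 2 ^ n / lam * N) + ennreal (N / lam)"
  proof (intro add_mono E3e)
    show "emeasure P E \<le> ennreal (CE / lam * N)" using E(2) unfolding N_def .
    have "CE * (1 + CT) / lam\<^sup>2 * (\<integral>x. (g x)\<^sup>2 \<partial>P) \<le> CE * (1 + CT) / lam\<^sup>2 * (2 ^ n * lam * N)"
      using g2(2) CE_nonneg CT_nonneg by (intro mult_left_mono) auto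
    also have "\<dots> = CE * (1 + CT) * 2 ^ n / lam * N" using lam by (simp add: power2_eq_square)
    finally show "emeasure P E2 \<le> ennreal (CE * (1 + CT) * 2 ^ n / lam * N)"
      by (intro order_trans[OF E2(2)] ennreal_leI)
  qed
  also have "\<dots> = ennreal (CW / lam * N)"
  proof -
    have "0 \<le> CE / lam * N" "0 \<le> CE * (1 + CT) * 2 ^ n / lam * N" "0 \<le> N / lam" using CE_nonneg CT_nonneg N0 lam by auto
    then have "ennreal (CE / lam * N) + ennreal (CE * (1 + CT) * 2 ^ n / lam * N) + ennreal (N / lam)
      = ennreal (CE / lam * N + CE * (1 + CT) * 2 ^ n / lam * N + N / lam)" by (simp only: ennreal_plus add_nonneg_nonneg)
    also have "CE / lam * N + CE * (1 + CT) * 2 ^ n / lam * N + N / lam = CW / lam * N"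
      unfolding CW_def by (simp add: add_divide_distrib distrib_right)
    finally show ?thesis .
  qed
  finally have e: "emeasure P (E \<union> E2 \<union> E3) \<le> ennreal (CW / lam * (\<integral>x. F x \<partial>P))" unfolding N_def .
  show ?thesis
    by (intro bexI[of _ "E \<union> E2 \<union> E3"] conjI e ballI allI impI) (use bound E(1) E2(1) E3m in auto)
qed

lemma truncation_weak_step:
  assumes F: "step s F" and lam: "lam > 0"
  shows "\<exists>E\<in>sets P. emeasure P E \<le> ennreal (CW / lam * (\<integral>x. \<bar>F x\<bar> \<partial>P)) \<and>
    (\<forall>x\<in>space P - E. \<forall>\<epsilon>\<in>{0<..}. \<bar>trunc \<epsilon> F x\<bar> \<le> 2 * BW * lam)"
proof -
  define p where "p x = max (F x) 0" for x
  define m where "m x = max (- F x) 0" for x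
  have p: "step s p" unfolding p_def by (rule step_comp[OF F]) simp
  have m: "step s m" unfolding m_def using step_comp[OF F, of "\<lambda>t. max (- t) 0"] by simp
  have i: "integrable P p" "integrable P m" using step_integrable p m by auto
  obtain Ep where Ep: "Ep \<in> sets P" "emeasure P Ep \<le> ennreal (CW / lam * (\<integral>x. p x \<partial>P))"
    "\<And>x \<epsilon>. x \<in> space P \<Longrightarrow> x \<notin> Ep \<Longrightarrow> \<epsilon> > 0 \<Longrightarrow> \<bar>trunc \<epsilon> p x\<bar> \<le> BW * lam"
    using truncation_weak_step_nonneg[OF p _ lam] unfolding p_def by fastforce
  obtain Em where Em: "Em \<in> sets P" "emeasure P Em \<le> ennreal (CW / lam * (\<integral>x. m x \<partial>P))"
    "\<And>x \<epsilon>. x \<in> space P \<Longrightarrow> x \<notin> Em \<Longrightarrow> \<epsilon> > 0 \<Longrightarrow> \<bar>trunc \<epsilon> m x\<bar> \<le> BW * lam"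
    using truncation_weak_step_nonneg[OF m _ lam] unfolding m_def by fastforce
  have nn: "0 \<le> (\<integral>x. p x \<partial>P)" "0 \<le> (\<integral>x. m x \<partial>P)" by (intro integral_nonneg_AE AE_I2; simp add: p_def m_def)+
  have "emeasure P (Ep \<union> Em) \<le> emeasure P Ep + emeasure P Em" using Ep Em by (intro emeasure_subadditive) auto
  also have "\<dots> \<le> ennreal (CW / lam * (\<integral>x. p x \<partial>P)) + ennreal (CW / lam * (\<integral>x. m x \<partial>P))" by (intro add_mono Ep Em)
  also have "\<dots> = ennreal (CW / lam * ((\<integral>x. p x \<partial>P) + (\<integral>x. m x \<partial>P)))"
    using nn CW_nonneg lam by (subst ennreal_plus[symmetric]) (auto simp: distrib_left)
  also have "(\<integral>x. p x \<partial>P) + (\<integral>x. m x \<partial>P) = (\<integral>x. \<bar>F x\<bar> \<partial>P)"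
    using i by (subst Bochner_Integration.integral_add[symmetric]) (auto simp: p_def m_def intro!: Bochner_Integration.integral_cong)
  finally have e: "emeasure P (Ep \<union> Em) \<le> ennreal (CW / lam * (\<integral>x. \<bar>F x\<bar> \<partial>P))" .
  have "\<bar>trunc \<epsilon> F x\<bar> \<le> 2 * BW * lam" if x: "x \<in> space P" "x \<notin> Ep" "x \<notin> Em" and \<epsilon>: "\<epsilon> > 0" for x \<epsilon>
  proof -
    have "F = (\<lambda>y. p y - m y)" by (auto simp: p_def m_def fun_eq_iff)
    then have "trunc \<epsilon> F x = trunc \<epsilon> p x - trunc \<epsilon> m x" using trunc_diff[OF i x(1) \<epsilon>] by simp
    then show ?thesis using Ep(3)[OF x(1,2) \<epsilon>] Em(3)[OF x(1,3) \<epsilon>] by linarith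
  qed
  then show ?thesis
    by (intro bexI[of _ "Ep \<union> Em"] conjI e ballI) (use Ep(1) Em(1) in auto)
qed

definition WT :: real where "WT = CW * (2 * BW)"

lemma WT_nonneg: "0 \<le> WT" unfolding WT_def using CW_nonneg BW_pos by simp

lemma truncation_weak_type:
  assumes f: "integrable P f" and lam: "lam > 0"
  shows "\<exists>E\<in>sets P. emeasure P E \<le> ennreal (WT / lam * (\<integral>x. \<bar>f x\<bar> \<partial>P)) \<and>
    (\<forall>x\<in>space P - E. \<forall>\<epsilon>\<in>{0<..}. \<bar>trunc \<epsilon> f x\<bar> \<le> lam)"
proof -
  let ?l = "lam / (2 * BW)"
  have l: "?l > 0" using lam BW_pos by simp
  have eq: "CW / ?l = WT / lam" "2 * BW * ?l = lam" using BW_pos lam by (simp_all add: WT_def)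
  show ?thesis
  proof (rule weak_type_extend[where K=trunc])
    show "0 \<le> WT / lam" using WT_nonneg lam by simp
    show "\<exists>E\<in>sets P. emeasure P E \<le> ennreal (WT / lam * (\<integral>x. \<bar>F x\<bar> \<partial>P)) \<and>
      (\<forall>x\<in>space P - E. \<forall>\<epsilon>\<in>{0<..}. \<bar>trunc \<epsilon> F x\<bar> \<le> lam)" if "step s F" for s F
      using truncation_weak_step[OF that l] unfolding eq .
    fix \<epsilon> :: real and x and g :: "(nat \<Rightarrow> real) \<Rightarrow> real" and G :: "nat \<Rightarrow> (nat \<Rightarrow> real) \<Rightarrow> real"
    assume e: "\<epsilon> \<in> {0<..}" and x [measurable]: "x \<in> space P" and g: "integrable P g" "\<And>k. integrable P (G k)"
      and lim: "(\<lambda>k. \<integral>y. \<bar>g y - G k y\<bar> \<partial>P) \<longlonglongrightarrow> 0"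
    show "(\<lambda>k. trunc \<epsilon> (G k) x) \<longlonglongrightarrow> trunc \<epsilon> g x"
      unfolding trunc_def using g e lim by (intro tendsto_kernel_integral[of _ "cn / \<epsilon> ^ n"] abs_tker_le) auto
  qed (rule f)
qed

section \<open>Existence of principal values\<close>

lemma null_coord:
  assumes C: "countable C" and i: "i < n"
  shows "{x \<in> space P. x i \<in> C} \<in> null_sets P"
proof -
  have "{x \<in> space P. x i \<in> C} = Pi\<^sub>E {..<n} (\<lambda>k. if k = i then C else UNIV)"
  proof (rule set_eqI)
    fix x
    have "(\<forall>k\<in>{..<n}. x k \<in> (if k = i then C else UNIV)) \<longleftrightarrow> x i \<in> C" using i by (metis UNIV_I lessThan_iff)
    then show "x \<in> {x \<in> space P. x i \<in> C} \<longleftrightarrow> x \<in> Pi\<^sub>E {..<n} (\<lambda>k. if k = i then C else UNIV)"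
      unfolding space_P PiE_iff mem_Collect_eq by blast
  qed
  moreover have Cb: "C \<in> sets borel" using C by (rule sets.countable[rotated]) auto
  moreover have "Pi\<^sub>E {..<n} (\<lambda>k. if k = i then C else UNIV) \<in> sets P"
    by (rule sets_PiM_I_finite) (use Cb in auto)
  moreover have "emeasure P (Pi\<^sub>E {..<n} (\<lambda>k. if k = i then C else UNIV)) = (\<Prod>k<n. emeasure lborel (if k = i then C else UNIV))"
    by (rule lborel_product.emeasure_PiM) (use Cb in auto)
  moreover have "\<dots> = 0"
    using i emeasure_lborel_countable[OF C] by (intro prod_zero) auto
  ultimately show ?thesis by (auto simp: null_sets_def)
qed

lemma AE_off_grid:
  assumes s: "s > 0" shows "AE x in P. \<forall>i<n. x i / s \<notin> \<int>"
proof -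
  have "AE x in P. x i / s \<notin> \<int>" if i: "i < n" for i
  proof (rule AE_I'[OF null_coord[OF _ i]])
    show "countable (range (\<lambda>k::int. s * real_of_int k))" by simp
    show "{x \<in> space P. \<not> x i / s \<notin> \<int>} \<subseteq> {x \<in> space P. x i \<in> range (\<lambda>k::int. s * real_of_int k)}"
    proof safe
      fix x assume "x \<in> space P" "x i / s \<in> \<int>"
      then obtain k where "x i / s = real_of_int k" by (auto elim: Ints_cases)
      then have "x i = s * real_of_int k" using s by (simp add: field_simps)
      then show "x i \<in> range (\<lambda>k::int. s * real_of_int k)" by blast
    qed
  qed
  then have "AE x in P. \<forall>i\<in>{..<n}. x i / s \<notin> \<int>" by (intro AE_finite_allI) auto
  then show ?thesis unfolding Ball_def lessThan_iff .
qed

lemma cell_locally_constant: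
  assumes s: "s > 0" and x: "\<forall>i<n. x i / s \<notin> \<int>"
  obtains \<eta> where "\<eta> > 0" "\<And>y. y \<in> space P \<Longrightarrow> edist x y < \<eta> \<Longrightarrow> cell s y = cell s x"
proof -
  define h where "h i = min (x i - s * \<lfloor>x i / s\<rfloor>) (s * (real_of_int \<lfloor>x i / s\<rfloor> + 1) - x i)" for i
  have h: "h i > 0" if i: "i < n" for i
  proof -
    have "s * \<lfloor>x i / s\<rfloor> \<le> x i \<and> x i < s * (real_of_int \<lfloor>x i / s\<rfloor> + 1)" using floor_div_eq_iff[OF s, of "x i"] by blast
    moreover have "s * \<lfloor>x i / s\<rfloor> \<noteq> x i"
    proof
      assume "s * \<lfloor>x i / s\<rfloor> = x i"
      then have "x i / s = \<lfloor>x i / s\<rfloor>" using s by (simp add: field_simps)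
      then show False using x i by (metis Ints_of_int)
    qed
    ultimately show ?thesis unfolding h_def by auto
  qed
  show ?thesis
  proof (rule that)
    show "Min (h ` {..<n}) > 0" using h j_less by (subst Min_gr_iff) auto
    fix y assume y: "y \<in> space P" "edist x y < Min (h ` {..<n})"
    show "cell s y = cell s x" unfolding cell_eq_iff
    proof (intro allI impI)
      fix i assume i: "i < n"
      have "\<bar>x i - y i\<bar> \<le> edist x y" by (rule coord_le_edist[OF i])
      also have "\<dots> < h i" using y(2) i by (subst (asm) Min_gr_iff) auto
      finally have "s * \<lfloor>x i / s\<rfloor> \<le> y i \<and> y i < s * (real_of_int \<lfloor>x i / s\<rfloor> + 1)" unfolding h_def by linarith
      then show "\<lfloor>y i / s\<rfloor> = \<lfloor>x i / s\<rfloor>" using floor_div_eq_iff[OF s] by blast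
    qed
  qed
qed

text \<open>The reflection y -> 2 x - y, under which the kernels centred at \<open>x\<close> are
  odd.\<close>

abbreviation refl_at :: "(nat \<Rightarrow> real) \<Rightarrow> (nat \<Rightarrow> real) \<Rightarrow> nat \<Rightarrow> real" where
  "refl_at x \<equiv> aff (- 1) (\<lambda>i. 2 * x i)"

lemma integral_odd_eq_0:
  fixes h :: "(nat \<Rightarrow> real) \<Rightarrow> real"
  assumes h: "h \<in> borel_measurable P" and odd: "\<And>y. y \<in> space P \<Longrightarrow> h (refl_at x y) = - h y"
  shows "(\<integral>y. h y \<partial>P) = 0"
proof -
  have "(\<integral>y. h y \<partial>P) = \<bar>- 1\<bar> ^ n * (\<integral>y. h (refl_at x y) \<partial>P)" by (rule integral_aff[OF h]) simp
  also have "(\<integral>y. h (refl_at x y) \<partial>P) = (\<integral>y. - h y \<partial>P)" by (rule Bochner_Integration.integral_cong) (use odd in auto)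
  finally show ?thesis by simp
qed

lemma edist_refl_at: "edist x (refl_at x y) = edist x y"
proof -
  have "(\<Sum>i<n. (x i - refl_at x y i)\<^sup>2) = (\<Sum>i<n. (x i - y i)\<^sup>2)"
    by (rule sum.cong) (auto simp: aff_def power2_commute)
  then show ?thesis by (simp only: edist_def eucl_norm_def)
qed

lemma kernels_refl_at:
  "tker \<epsilon> x (refl_at x y) = - tker \<epsilon> x y" "cpois \<epsilon> x (refl_at x y) = - cpois \<epsilon> x y"
proof -
  have j: "x j - refl_at x y j = - (x j - y j)" using j_less by (simp add: aff_def)
  show "tker \<epsilon> x (refl_at x y) = - tker \<epsilon> x y" "cpois \<epsilon> x (refl_at x y) = - cpois \<epsilon> x y"
    unfolding tker_def ker_def cpois_def edist_refl_at j mult_minus_right divide_minus_left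
    by (cases "\<epsilon> \<le> edist x y"; simp only: if_True if_False minus_zero) (rule refl)
qed

text \<open>Off the grid hyperplanes \<open>F\<close> is constant on a ball about \<open>x\<close>,
  and oddness makes that ball contribute nothing. So truncations stop changing below its radius, and
  conjugate Poisson averages have the same limit because outside the ball their deviation is of
  order \<open>\<epsilon>\<close>.\<close>

lemma step_truncations_near:
  assumes F: "step s F" and x [measurable]: "x \<in> space P" and ng: "\<forall>i<n. x i / s \<notin> \<int>"
  obtains \<eta> where "\<eta> > 0" "\<And>\<epsilon>. 0 < \<epsilon> \<Longrightarrow> \<epsilon> \<le> \<eta> \<Longrightarrow> trunc \<epsilon> F x = trunc \<eta> F x"
    "(\<lambda>k. cpois_op (1 / real (Suc k)) F x) \<longlonglongrightarrow> trunc \<eta> F x"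
proof -
  have Fi: "integrable P F" by (rule step_integrable[OF F])
  have [measurable]: "F \<in> borel_measurable P" by (rule step_measurable[OF F])
  obtain \<eta> where \<eta>: "\<eta> > 0" "\<And>y. y \<in> space P \<Longrightarrow> edist x y < \<eta> \<Longrightarrow> cell s y = cell s x"
    using cell_locally_constant[OF step_pos[OF F] ng] by blast
  have Fc: "F y = F x" if "y \<in> space P" "edist x y < \<eta>" for y
    by (rule step_const[OF F that(1) x \<eta>(2)[OF that]])
  have near: "trunc \<epsilon> F x = trunc \<eta> F x" if e: "0 < \<epsilon>" "\<epsilon> \<le> \<eta>" for \<epsilon>
  proof -
    have "trunc \<epsilon> F x - trunc \<eta> F x = (\<integral>y. (tker \<epsilon> x y - tker \<eta> x y) * F y \<partial>P)"
      unfolding trunc_def using integrable_kernel_mult(1)[OF Fi x e(1)] integrable_kernel_mult(1)[OF Fi x \<eta>(1)]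
      by (simp add: left_diff_distrib)
    also have "\<dots> = (\<integral>y. (tker \<epsilon> x y - tker \<eta> x y) * F x \<partial>P)"
    proof (rule Bochner_Integration.integral_cong[OF refl])
      fix y assume y: "y \<in> space P"
      show "(tker \<epsilon> x y - tker \<eta> x y) * F y = (tker \<epsilon> x y - tker \<eta> x y) * F x"
      proof (cases "edist x y < \<eta>")
        case True then show ?thesis using Fc[OF y] by simp
      next
        case False then show ?thesis using e by (simp add: tker_def)
      qed
    qed
    also have "\<dots> = 0"
      by (rule integral_odd_eq_0[of _ x], measurable) (simp only: kernels_refl_at, simp add: algebra_simps)
    finally show ?thesis by simp
  qed
  define A where "A = CK * (cn / \<eta> ^ (n + 1)) * (\<integral>y. \<bar>F y\<bar> \<partial>P)"
  have Q: "\<bar>cpois_op \<epsilon> F x - trunc \<epsilon> F x\<bar> \<le> A * \<epsilon>" if e: "0 < \<epsilon>" for \<epsilon>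
  proof -
    define k where "k y = (cpois \<epsilon> x y - tker \<epsilon> x y) * F y" for y
    define h where "h y = (if edist x y < \<eta> then k y else 0)" for y
    have ki: "integrable P k" unfolding k_def left_diff_distrib
      using integrable_kernel_mult[OF Fi x e] by (intro Bochner_Integration.integrable_diff) auto
    have [measurable]: "k \<in> borel_measurable P" using ki by simp
    have [measurable]: "h \<in> borel_measurable P" unfolding h_def by measurable
    have hi: "integrable P h" by (rule Bochner_Integration.integrable_bound[OF ki]) (auto simp: h_def)
    have h0: "(\<integral>y. h y \<partial>P) = 0"
    proof (rule integral_odd_eq_0[of _ x])
      fix y assume y: "y \<in> space P"
      show "h (refl_at x y) = - h y"
      proof (cases "edist x y < \<eta>")
        case True
        have "F (refl_at x y) = F y" using Fc[OF y True] Fc[of "refl_at x y"] True by (simp only: edist_refl_at aff_in_space)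
        then show ?thesis unfolding h_def k_def edist_refl_at kernels_refl_at using True by (simp add: algebra_simps)
      next
        case False
        then show ?thesis unfolding h_def edist_refl_at by simp
      qed
    qed measurable
    have "cpois_op \<epsilon> F x - trunc \<epsilon> F x = (\<integral>y. k y \<partial>P)"
      unfolding cpois_op_def trunc_def k_def using integrable_kernel_mult[OF Fi x e] by (simp add: left_diff_distrib)
    also have "\<dots> = (\<integral>y. k y - h y \<partial>P)" using ki hi h0 by simp
    also have "\<bar>\<dots>\<bar> \<le> (\<integral>y. \<bar>k y - h y\<bar> \<partial>P)" by (rule integral_abs_bound)
    also have "\<dots> \<le> (\<integral>y. CK * (cn * \<epsilon> / \<eta> ^ (n + 1)) * \<bar>F y\<bar> \<partial>P)"
    proof (rule integral_mono)
      show "integrable P (\<lambda>y. \<bar>k y - h y\<bar>)" using ki hi by simp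
      show "integrable P (\<lambda>y. CK * (cn * \<epsilon> / \<eta> ^ (n + 1)) * \<bar>F y\<bar>)" using Fi by simp
      fix y
      have c0: "0 \<le> CK * (cn * \<epsilon> / \<eta> ^ (n + 1))" using CK_ge(1) e \<eta> less_imp_le[OF cn_pos] by simp
      show "\<bar>k y - h y\<bar> \<le> CK * (cn * \<epsilon> / \<eta> ^ (n + 1)) * \<bar>F y\<bar>"
      proof (cases "edist x y < \<eta>")
        case True then show ?thesis using c0 by (simp only: h_def if_True diff_self abs_zero mult_nonneg_nonneg abs_ge_zero)
      next
        case False
        have "\<bar>cpois \<epsilon> x y - tker \<epsilon> x y\<bar> \<le> CK * pois \<epsilon> x y" by (rule cpois_minus_tker_le[OF e])
        also have "\<dots> \<le> CK * (cn * \<epsilon> / \<eta> ^ (n + 1))"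
          using CK_ge(1) False \<eta> e by (intro mult_left_mono pois_upper_far) auto
        finally have "\<bar>k y\<bar> \<le> CK * (cn * \<epsilon> / \<eta> ^ (n + 1)) * \<bar>F y\<bar>"
          unfolding k_def abs_mult by (rule mult_right_mono) simp
        then show ?thesis using False by (simp only: h_def if_False diff_zero)
      qed
    qed
    also have "\<dots> = A * \<epsilon>" by (simp add: A_def)
    finally show ?thesis .
  qed
  have lim: "(\<lambda>k. cpois_op (1 / real (Suc k)) F x) \<longlonglongrightarrow> trunc \<eta> F x"
  proof (rule LIM_zero_cancel, rule Lim_null_comparison)
    show "(\<lambda>k. A * (1 / real (Suc k))) \<longlonglongrightarrow> 0"
      by (rule tendsto_mult_right_zero[OF LIMSEQ_Suc[OF lim_1_over_n]])
    obtain m where m: "1 / real (Suc m) < \<eta>" using nat_approx_posE[OF \<eta>(1)] .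
    show "\<forall>\<^sub>F k in sequentially. norm (cpois_op (1 / real (Suc k)) F x - trunc \<eta> F x) \<le> A * (1 / real (Suc k))"
      unfolding eventually_sequentially
    proof (intro exI[of _ m] allI impI)
      fix k assume "m \<le> k"
      then have "1 / real (Suc k) \<le> 1 / real (Suc m)" by (simp add: frac_le)
      then have "1 / real (Suc k) \<le> \<eta>" using m by linarith
      then have "trunc (1 / real (Suc k)) F x = trunc \<eta> F x" by (intro near) auto
      then show "norm (cpois_op (1 / real (Suc k)) F x - trunc \<eta> F x) \<le> A * (1 / real (Suc k))"
        using Q[of "1 / real (Suc k)"] by (simp only: real_norm_def) simp
    qed
  qed
  show thesis by (rule that[OF \<eta>(1) near lim])
qed

text \<open>\<open>Lim\<close> denotes an unspecified value where there is no limit; almost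
  everywhere there is one, by \<open>truncations_converge\<close>.\<close>

definition pv :: "((nat \<Rightarrow> real) \<Rightarrow> real) \<Rightarrow> (nat \<Rightarrow> real) \<Rightarrow> real" where
  "pv f x = Lim (at_right 0) (\<lambda>\<epsilon>. trunc \<epsilon> f x)"

lemma pv_eventually_const:
  assumes "\<eta> > 0" "\<And>\<epsilon>. 0 < \<epsilon> \<Longrightarrow> \<epsilon> \<le> \<eta> \<Longrightarrow> trunc \<epsilon> f x = c"
  shows "((\<lambda>\<epsilon>. trunc \<epsilon> f x) \<longlongrightarrow> c) (at_right 0)" "pv f x = c"
proof -
  show l: "((\<lambda>\<epsilon>. trunc \<epsilon> f x) \<longlongrightarrow> c) (at_right 0)"
  proof (rule tendsto_eventually)
    show "\<forall>\<^sub>F \<epsilon> in at_right 0. trunc \<epsilon> f x = c"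
      unfolding eventually_at_right_field using assms by (intro exI[of _ \<eta>]) auto
  qed
  show "pv f x = c" unfolding pv_def by (rule tendsto_Lim[OF trivial_limit_at_right_real l])
qed

lemma step_pv:
  assumes F: "step s F" and x: "x \<in> space P" and ng: "\<forall>i<n. x i / s \<notin> \<int>"
  shows "((\<lambda>\<epsilon>. trunc \<epsilon> F x) \<longlongrightarrow> pv F x) (at_right 0)" "(\<lambda>k. cpois_op (1 / real (Suc k)) F x) \<longlonglongrightarrow> pv F x"
    "\<exists>\<eta>>0. \<forall>\<epsilon>. 0 < \<epsilon> \<longrightarrow> \<epsilon> \<le> \<eta> \<longrightarrow> trunc \<epsilon> F x = pv F x"
proof -
  obtain \<eta> where \<eta>: "\<eta> > 0" "\<And>\<epsilon>. 0 < \<epsilon> \<Longrightarrow> \<epsilon> \<le> \<eta> \<Longrightarrow> trunc \<epsilon> F x = trunc \<eta> F x"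
    "(\<lambda>k. cpois_op (1 / real (Suc k)) F x) \<longlonglongrightarrow> trunc \<eta> F x"
    using step_truncations_near[OF F x ng] by blast
  have R: "((\<lambda>\<epsilon>. trunc \<epsilon> F x) \<longlongrightarrow> trunc \<eta> F x) (at_right 0)" "pv F x = trunc \<eta> F x"
    using pv_eventually_const[of \<eta> F x "trunc \<eta> F x"] \<eta>(1,2) by blast+
  show "((\<lambda>\<epsilon>. trunc \<epsilon> F x) \<longlongrightarrow> pv F x) (at_right 0)" unfolding R(2) by (rule R(1))
  show "(\<lambda>k. cpois_op (1 / real (Suc k)) F x) \<longlonglongrightarrow> pv F x" unfolding R(2) by (rule \<eta>(3))
  show "\<exists>\<eta>>0. \<forall>\<epsilon>. 0 < \<epsilon> \<longrightarrow> \<epsilon> \<le> \<eta> \<longrightarrow> trunc \<epsilon> F x = pv F x"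
    unfolding R(2) by (intro exI[of _ \<eta>] conjI allI impI \<eta>(1,2)) assumption+
qed

text \<open>The limit is taken along conjugate Poisson averages and not along hard truncations:
  Fatou's lemma then keeps the dimension-free constant of \<open>cpois_L2\<close>, where
  \<open>trunc_L2\<close> would bring in \<open>CT\<close>.\<close>

lemma pv_step_weak_L2:
  assumes F: "step s F" and lam: "lam > 0"
  shows "\<exists>E\<in>sets P. emeasure P E \<le> ennreal (4 * B0 * (\<integral>x. (F x)\<^sup>2 \<partial>P) / lam\<^sup>2) \<and> (\<forall>x\<in>space P - E. \<bar>pv F x\<bar> \<le> lam)"
proof -
  have Fi: "integrable P F" by (rule step_integrable[OF F])
  have F2: "integrable P (\<lambda>x. (F x)\<^sup>2)" by (rule step_integrable[OF step_comp[OF F, of "\<lambda>t. t\<^sup>2"]]) simp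
  have [measurable]: "F \<in> borel_measurable P" using Fi by simp
  define L where "L x = liminf (\<lambda>k. ennreal ((cpois_op (1 / real (Suc k)) F x)\<^sup>2))" for x
  have [measurable]: "L \<in> borel_measurable P" unfolding L_def by measurable
  have LI: "(\<integral>\<^sup>+x. L x \<partial>P) \<le> ennreal (4 * B0 * (\<integral>x. (F x)\<^sup>2 \<partial>P))"
  proof -
    have "(\<integral>\<^sup>+x. L x \<partial>P) \<le> liminf (\<lambda>k. \<integral>\<^sup>+x. ennreal ((cpois_op (1 / real (Suc k)) F x)\<^sup>2) \<partial>P)"
      unfolding L_def by (rule nn_integral_liminf) measurable
    also have "\<dots> \<le> liminf (\<lambda>k. ennreal (4 * B0 * (\<integral>x. (F x)\<^sup>2 \<partial>P)))"
      unfolding cpois_op_def by (intro Liminf_mono always_eventually allI cpois_L2 Fi F2) simp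
    finally show ?thesis by (simp add: Liminf_const)
  qed
  obtain Z where Z: "Z \<in> null_sets P" "{x \<in> space P. \<not> (\<forall>i<n. x i / s \<notin> \<int>)} \<subseteq> Z"
    using AE_off_grid[OF step_pos[OF F]] by (auto elim!: AE_E simp: null_sets_def)
  define E where "E = {x \<in> space P. ennreal (lam\<^sup>2) \<le> L x}"
  have Em: "E \<in> sets P" unfolding E_def by measurable
  have "emeasure P E = (\<integral>\<^sup>+x. indicator E x \<partial>P)" using Em by simp
  also have "\<dots> \<le> (\<integral>\<^sup>+x. ennreal (1 / lam\<^sup>2) * L x \<partial>P)"
  proof (rule nn_integral_mono)
    fix x
    have "1 \<le> ennreal (1 / lam\<^sup>2) * L x" if "x \<in> E"
    proof -
      have "1 = ennreal (1 / lam\<^sup>2) * ennreal (lam\<^sup>2)" using lam by (simp flip: ennreal_mult)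
      also have "\<dots> \<le> ennreal (1 / lam\<^sup>2) * L x" using that by (intro mult_left_mono) (auto simp: E_def)
      finally show ?thesis .
    qed
    then show "indicator E x \<le> ennreal (1 / lam\<^sup>2) * L x" by (auto simp: indicator_def)
  qed
  also have "\<dots> = ennreal (1 / lam\<^sup>2) * (\<integral>\<^sup>+x. L x \<partial>P)" by (rule nn_integral_cmult) measurable
  also have "\<dots> \<le> ennreal (1 / lam\<^sup>2) * ennreal (4 * B0 * (\<integral>x. (F x)\<^sup>2 \<partial>P))" by (intro mult_left_mono LI) simp
  also have "\<dots> = ennreal (4 * B0 * (\<integral>x. (F x)\<^sup>2 \<partial>P) / lam\<^sup>2)"
    by (subst ennreal_mult'[symmetric]) auto
  finally have Ee: "emeasure P E \<le> ennreal (4 * B0 * (\<integral>x. (F x)\<^sup>2 \<partial>P) / lam\<^sup>2)" .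
  show ?thesis
  proof (intro bexI[of _ "E \<union> Z"] conjI ballI)
    show "E \<union> Z \<in> sets P" using Em Z(1) by auto
    show "emeasure P (E \<union> Z) \<le> ennreal (4 * B0 * (\<integral>x. (F x)\<^sup>2 \<partial>P) / lam\<^sup>2)"
      using Ee by (simp add: emeasure_Un_null_set[OF Em Z(1)])
    fix x assume "x \<in> space P - (E \<union> Z)"
    then have x: "x \<in> space P" "x \<notin> E" "\<forall>i<n. x i / s \<notin> \<int>" using Z(2) by auto
    have "(\<lambda>k. ennreal ((cpois_op (1 / real (Suc k)) F x)\<^sup>2)) \<longlonglongrightarrow> ennreal ((pv F x)\<^sup>2)"
      by (intro tendsto_ennrealI tendsto_power step_pv(2)[OF F x(1,3)])
    then have "L x = ennreal ((pv F x)\<^sup>2)" unfolding L_def by (intro lim_imp_Liminf) auto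
    moreover have "L x < ennreal (lam\<^sup>2)" using x(1,2) unfolding E_def by (metis (mono_tags, lifting) mem_Collect_eq not_le)
    ultimately have "ennreal ((pv F x)\<^sup>2) < ennreal (lam\<^sup>2)" by (simp only:)
    then have "(pv F x)\<^sup>2 < lam\<^sup>2" by (simp add: ennreal_less_iff)
    then show "\<bar>pv F x\<bar> \<le> lam" using abs_le_square_iff[of "pv F x" lam] lam by simp
  qed
qed

lemma AE_of_small_exceptional_sets:
  assumes "\<And>k. \<exists>E. E \<in> sets P \<and> emeasure P E \<le> ennreal (1 / real (Suc k)) \<and> (\<forall>x\<in>space P - E. Q x)"
  shows "AE x in P. Q x"
proof -
  obtain E where E: "\<And>k. E k \<in> sets P \<and> emeasure P (E k) \<le> ennreal (1 / real (Suc k)) \<and> (\<forall>x\<in>space P - E k. Q x)"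
    using choice[of "\<lambda>k E. E \<in> sets P \<and> emeasure P E \<le> ennreal (1 / real (Suc k)) \<and> (\<forall>x\<in>space P - E. Q x)"] assms by blast
  have m: "(\<Inter>k. E k) \<in> sets P" using E by (intro sets.countable_INT') auto
  have "emeasure P (\<Inter>k. E k) \<le> ennreal 0"
  proof (rule tendsto_lowerbound[OF tendsto_ennrealI[OF LIMSEQ_Suc[OF lim_1_over_n]]])
    show "\<forall>\<^sub>F k in sequentially. emeasure P (\<Inter>k. E k) \<le> ennreal (1 / real (Suc k))"
    proof (rule always_eventually, rule allI)
      fix k
      have "emeasure P (\<Inter>k. E k) \<le> emeasure P (E k)" using E by (intro emeasure_mono) auto
      then show "emeasure P (\<Inter>k. E k) \<le> ennreal (1 / real (Suc k))" using E[of k] by (meson order_trans)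
    qed
  qed simp
  then have "(\<Inter>k. E k) \<in> null_sets P" using m by (auto simp: null_sets_def)
  then show ?thesis by (rule AE_I') (use E in auto)
qed

lemma Cauchy_at_right_convergent:
  fixes u :: "real \<Rightarrow> real"
  assumes "\<And>m. \<exists>\<delta>>0. \<forall>e e'. 0 < e \<longrightarrow> e < \<delta> \<longrightarrow> 0 < e' \<longrightarrow> e' < \<delta> \<longrightarrow> \<bar>u e - u e'\<bar> \<le> 1 / real (Suc m)"
  shows "\<exists>l. (u \<longlongrightarrow> l) (at_right 0)"
proof -
  define v where "v k = u (1 / real (Suc k))" for k
  have ev: "\<exists>K. \<forall>k\<ge>K. 1 / real (Suc k) < \<delta>" if \<delta>: "\<delta> > 0" for \<delta>
  proof -
    obtain K where K: "1 / real (Suc K) < \<delta>" using nat_approx_posE[OF \<delta>] .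
    have "1 / real (Suc k) < \<delta>" if "k \<ge> K" for k
      using that K by (intro le_less_trans[OF _ K]) (simp add: frac_le)
    then show ?thesis by blast
  qed
  have "Cauchy v"
  proof (rule metric_CauchyI)
    fix e :: real assume e: "e > 0"
    obtain m where m: "1 / real (Suc m) < e" using nat_approx_posE[OF e] .
    obtain \<delta> where \<delta>: "\<delta> > 0" "\<And>e e'. 0 < e \<Longrightarrow> e < \<delta> \<Longrightarrow> 0 < e' \<Longrightarrow> e' < \<delta> \<Longrightarrow> \<bar>u e - u e'\<bar> \<le> 1 / real (Suc m)"
      using assms[of m] by blast
    obtain K where K: "\<And>k. k \<ge> K \<Longrightarrow> 1 / real (Suc k) < \<delta>" using ev[OF \<delta>(1)] by blast
    have "dist (v p) (v q) < e" if "p \<ge> K" "q \<ge> K" for p q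
      unfolding v_def dist_real_def using \<delta>(2)[of "1 / real (Suc p)" "1 / real (Suc q)"] K that m
      by (intro le_less_trans[OF _ m]) auto
    then show "\<exists>K. \<forall>p\<ge>K. \<forall>q\<ge>K. dist (v p) (v q) < e" by blast
  qed
  then obtain l where l: "v \<longlonglongrightarrow> l" using Cauchy_convergent convergent_def by blast
  have "(u \<longlongrightarrow> l) (at_right 0)"
  proof (rule tendstoI)
    fix e :: real assume e: "e > 0"
    obtain m where m: "1 / real (Suc m) < e" using nat_approx_posE[OF e] .
    obtain \<delta> where \<delta>: "\<delta> > 0" "\<And>e e'. 0 < e \<Longrightarrow> e < \<delta> \<Longrightarrow> 0 < e' \<Longrightarrow> e' < \<delta> \<Longrightarrow> \<bar>u e - u e'\<bar> \<le> 1 / real (Suc m)"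
      using assms[of m] by blast
    obtain K where K: "\<And>k. k \<ge> K \<Longrightarrow> 1 / real (Suc k) < \<delta>" using ev[OF \<delta>(1)] by blast
    have "dist (u t) l < e" if t: "0 < t" "t < \<delta>" for t
    proof -
      have "\<bar>u t - l\<bar> \<le> 1 / real (Suc m)"
      proof (rule tendsto_upperbound[OF tendsto_rabs[OF tendsto_diff[OF tendsto_const l]]])
        show "\<forall>\<^sub>F k in sequentially. \<bar>u t - v k\<bar> \<le> 1 / real (Suc m)"
          unfolding eventually_sequentially v_def using \<delta>(2)[OF t] K by (intro exI[of _ K]) auto
      qed simp
      then show ?thesis using m by (simp add: dist_real_def)
    qed
    then show "\<forall>\<^sub>F t in at_right 0. dist (u t) l < e"
      unfolding eventually_at_right_field using \<delta>(1) by (intro exI[of _ \<delta>]) auto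
  qed
  then show ?thesis by blast
qed

text \<open>Off a small set all truncations of \<open>f - F\<close> are small at once, while those
  of the step function \<open>F\<close> are eventually constant; hence the truncations of
  \<open>f\<close> oscillate little near 0.\<close>

lemma truncations_converge:
  assumes f: "integrable P f"
  shows "AE x in P. ((\<lambda>\<epsilon>. trunc \<epsilon> f x) \<longlongrightarrow> pv f x) (at_right 0)"
proof -
  have "AE x in P. \<exists>\<delta>>0. \<forall>e e'. 0 < e \<longrightarrow> e < \<delta> \<longrightarrow> 0 < e' \<longrightarrow> e' < \<delta> \<longrightarrow> \<bar>trunc e f x - trunc e' f x\<bar> \<le> 1 / real (Suc m)" (is "AE x in P. ?Q x") for m
  proof (rule AE_of_small_exceptional_sets)
    fix k :: nat
    let ?l = "1 / (2 * real (Suc m))"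
    \<comment> \<open>With this approximation error the weak type bound at height \<open>?l\<close>
      leaves an exceptional set of measure at most 1 / (k + 1). The summand 1 makes the denominator
      positive, as \<open>WT\<close> is only known to be nonnegative.\<close>
    let ?e = "?l / ((WT + 1) * real (Suc k))"
    have l: "?l > 0" by simp
    have e: "?e > 0" using WT_nonneg by (intro divide_pos_pos mult_pos_pos) auto
    obtain s F where F: "step s F" "(\<integral>x. \<bar>f x - F x\<bar> \<partial>P) < ?e" by (rule step_approximation[OF f e])
    have Fi: "integrable P F" by (rule step_integrable[OF F(1)])
    have di: "integrable P (\<lambda>x. f x - F x)" using f Fi by simp
    obtain E where E: "E \<in> sets P" "emeasure P E \<le> ennreal (WT / ?l * (\<integral>x. \<bar>f x - F x\<bar> \<partial>P))"
      "\<And>x \<epsilon>. x \<in> space P \<Longrightarrow> x \<notin> E \<Longrightarrow> \<epsilon> > 0 \<Longrightarrow> \<bar>trunc \<epsilon> (\<lambda>y. f y - F y) x\<bar> \<le> ?l"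
      using truncation_weak_type[OF di l] by fastforce
    obtain Z where Z: "Z \<in> null_sets P" "{x \<in> space P. \<not> (\<forall>i<n. x i / s \<notin> \<int>)} \<subseteq> Z"
      using AE_off_grid[OF step_pos[OF F(1)]] by (auto elim!: AE_E simp: null_sets_def)
    have "WT / ?l * (\<integral>x. \<bar>f x - F x\<bar> \<partial>P) \<le> WT / ?l * ?e"
      using F(2) WT_nonneg l by (intro mult_left_mono) auto
    also have "\<dots> = (WT / (WT + 1)) * (1 / real (Suc k))"
    proof -
      have "p / q * (q / (b * c)) = p / b * (1 / c)" if "q \<noteq> 0" for p q b c :: real using that by simp
      from this[OF less_imp_neq[OF l, symmetric]] show ?thesis .
    qed
    also have "\<dots> \<le> 1 * (1 / real (Suc k))" using WT_nonneg by (intro mult_right_mono) auto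
    finally have small: "emeasure P E \<le> ennreal (1 / real (Suc k))"
      using E(2) by (intro order_trans[OF E(2)] ennreal_leI) (simp only: mult_1)
    show "\<exists>E. E \<in> sets P \<and> emeasure P E \<le> ennreal (1 / real (Suc k)) \<and> (\<forall>x\<in>space P - E. ?Q x)"
    proof (intro exI[of _ "E \<union> Z"] conjI ballI)
      show "E \<union> Z \<in> sets P" using E(1) Z(1) by auto
      show "emeasure P (E \<union> Z) \<le> ennreal (1 / real (Suc k))"
        using small by (simp add: emeasure_Un_null_set[OF E(1) Z(1)])
      fix x assume "x \<in> space P - (E \<union> Z)"
      then have x: "x \<in> space P" "x \<notin> E" "\<forall>i<n. x i / s \<notin> \<int>" using Z(2) by auto
      obtain \<eta> where \<eta>: "\<eta> > 0" "\<And>\<epsilon>. 0 < \<epsilon> \<Longrightarrow> \<epsilon> \<le> \<eta> \<Longrightarrow> trunc \<epsilon> F x = pv F x"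
        using step_pv(3)[OF F(1) x(1,3)] by blast
      show "?Q x"
      proof (intro exI[of _ \<eta>] conjI \<eta>(1) allI impI)
        fix e e' :: real assume ee: "0 < e" "e < \<eta>" "0 < e'" "e' < \<eta>"
        have "\<bar>trunc e f x - pv F x\<bar> \<le> ?l" if "0 < e" "e < \<eta>" for e
          using E(3)[OF x(1,2) that(1)] trunc_diff[OF f Fi x(1) that(1)] \<eta>(2)[of e] that by simp
        from this[OF ee(1,2)] this[OF ee(3,4)] have "\<bar>trunc e f x - trunc e' f x\<bar> \<le> ?l + ?l" by linarith
        also have "?l + ?l = 1 / real (Suc m)" by (simp add: field_simps)
        finally show "\<bar>trunc e f x - trunc e' f x\<bar> \<le> 1 / real (Suc m)" .
      qed
    qed
  qed
  then have "AE x in P. \<forall>m. \<exists>\<delta>>0. \<forall>e e'. 0 < e \<longrightarrow> e < \<delta> \<longrightarrow> 0 < e' \<longrightarrow> e' < \<delta> \<longrightarrow> \<bar>trunc e f x - trunc e' f x\<bar> \<le> 1 / real (Suc m)"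
    by (subst AE_all_countable) blast
  then show ?thesis
  proof (rule AE_mp, intro AE_I2 impI)
    fix x assume "\<forall>m. \<exists>\<delta>>0. \<forall>e e'. 0 < e \<longrightarrow> e < \<delta> \<longrightarrow> 0 < e' \<longrightarrow> e' < \<delta> \<longrightarrow> \<bar>trunc e f x - trunc e' f x\<bar> \<le> 1 / real (Suc m)"
    then obtain l where l: "((\<lambda>\<epsilon>. trunc \<epsilon> f x) \<longlongrightarrow> l) (at_right 0)"
      using Cauchy_at_right_convergent[of "\<lambda>\<epsilon>. trunc \<epsilon> f x"] by blast
    then have "pv f x = l" unfolding pv_def by (rule tendsto_Lim[OF trivial_limit_at_right_real])
    with l show "((\<lambda>\<epsilon>. trunc \<epsilon> f x) \<longlongrightarrow> pv f x) (at_right 0)" by simp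
  qed
qed

section \<open>Replacing the high part by Dirac masses\<close>

lemma step_corner:
  assumes F: "step s F" and m: "m \<in> supp_cells s F"
  shows "F (corner s m) \<noteq> 0" "y \<in> cube s m \<Longrightarrow> F y = F (corner s m)"
proof -
  have s: "s > 0" by (rule step_pos[OF F])
  obtain x where x: "x \<in> space P" "F x \<noteq> 0" "m = cell s x" using m unfolding supp_cells_def by auto
  have c: "cell s (corner s m) = cell s x" using cell_corner[OF s, of m] x(3) by simp
  have "F (corner s m) = F x" by (rule step_const[OF F corner_in_space x(1) c])
  then show "F (corner s m) \<noteq> 0" using x(2) by simp
  assume "y \<in> cube s m"
  then have y: "y \<in> space P" "cell s y = cell s x" using mem_cube_cell[OF s] x(3) by auto
  show "F y = F (corner s m)" by (rule step_const[OF F y(1) corner_in_space y(2)[folded c]])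
qed

lemma step_kernel_integral:
  assumes F: "step s F" and k: "\<And>m. integrable P (\<lambda>y. k y * indicator (cube s m) y)"
  shows "(\<integral>y. k y * F y \<partial>P) = (\<Sum>m\<in>supp_cells s F. F (corner s m) * (\<integral>y. k y * indicator (cube s m) y \<partial>P))"
proof -
  have "(\<integral>y. k y * F y \<partial>P) = (\<integral>y. (\<Sum>m\<in>supp_cells s F. F (corner s m) * (k y * indicator (cube s m) y)) \<partial>P)"
  proof (rule Bochner_Integration.integral_cong[OF refl])
    fix y assume y: "y \<in> space P"
    have "k y * F y = k y * (\<Sum>m\<in>supp_cells s F. F (corner s m) * indicator (cube s m) y)"
      by (rule arg_cong[OF step_expand[OF F y]])
    also have "\<dots> = (\<Sum>m\<in>supp_cells s F. F (corner s m) * (k y * indicator (cube s m) y))"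
      unfolding sum_distrib_left by (rule sum.cong) auto
    finally show "k y * F y = (\<Sum>m\<in>supp_cells s F. F (corner s m) * (k y * indicator (cube s m) y))" .
  qed
  also have "\<dots> = (\<Sum>m\<in>supp_cells s F. \<integral>y. F (corner s m) * (k y * indicator (cube s m) y) \<partial>P)"
    using k by (intro Bochner_Integration.integral_sum integrable_mult_right)
  finally show ?thesis by simp
qed

lemma integrable_indicator_cube: "s > 0 \<Longrightarrow> integrable P (indicator (cube s m) :: _ \<Rightarrow> real)"
  by (intro integrable_real_indicator) (auto simp: emeasure_cube)

lemma step_integral:
  assumes F: "step s F"
  shows "(\<integral>y. F y \<partial>P) = (\<Sum>m\<in>supp_cells s F. F (corner s m) * s ^ n)"
  using step_kernel_integral[OF F, of "\<lambda>_. 1"] integrable_indicator_cube[OF step_pos[OF F]] step_pos[OF F]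
  by (simp add: measure_cube)

lemma sets_singleton: "c \<in> space P \<Longrightarrow> {c} \<in> sets P"
proof -
  assume "c \<in> space P"
  then have "Pi\<^sub>E {..<n} (\<lambda>i. {c i}) = {c}" unfolding space_P by (rule PiE_singleton)
  moreover have "Pi\<^sub>E {..<n} (\<lambda>i. {c i}) \<in> sets P" by (rule sets_PiM_I_finite) auto
  ultimately show ?thesis by simp
qed

definition dirac_level :: "real \<Rightarrow> nat \<Rightarrow> (nat \<Rightarrow> real) \<Rightarrow> (nat \<Rightarrow> nat \<Rightarrow> real) \<Rightarrow> (nat \<Rightarrow> real) set" where
  "dirac_level lam N a c = {x \<in> space P. (\<forall>k<N. x \<noteq> c k) \<and> lam < \<bar>\<Sum>k<N. a k * ker x (c k)\<bar>}"

lemma sets_dirac_level: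
  assumes c: "\<And>k. k < N \<Longrightarrow> c k \<in> space P"
  shows "dirac_level lam N a c \<in> sets P"
proof -
  have "(\<lambda>x. \<Sum>k<N. a k * ker x (c k)) \<in> borel_measurable P"
  proof (rule borel_measurable_sum)
    fix k assume "k \<in> {..<N}"
    then have [measurable]: "c k \<in> space P" using c by simp
    show "(\<lambda>x. a k * ker x (c k)) \<in> borel_measurable P" by measurable
  qed
  then have "{x \<in> space P. lam < \<bar>\<Sum>k<N. a k * ker x (c k)\<bar>} \<in> sets P" by measurable
  moreover have "(\<Union>k\<in>{..<N}. {c k}) \<in> sets P" using sets_singleton[OF c] by (intro sets.finite_UN) auto
  ultimately have "{x \<in> space P. lam < \<bar>\<Sum>k<N. a k * ker x (c k)\<bar>} - (\<Union>k\<in>{..<N}. {c k}) \<in> sets P" by (rule sets.Diff)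
  also have "{x \<in> space P. lam < \<bar>\<Sum>k<N. a k * ker x (c k)\<bar>} - (\<Union>k\<in>{..<N}. {c k}) = dirac_level lam N a c"
    unfolding dirac_level_def by auto
  finally show ?thesis .
qed

text \<open>Since \<open>p\<close> exceeds \<open>lam\<close> on its support, the support has
  measure at most 2 S / lam. Off the enlarged cubes the kernel is smooth on the support, so the
  integral is close to its Riemann sum over corners, which is the transform of an atomic measure.
  The fineness of the grid may depend on everything, since \<open>V\<close> sees only the total mass
  of the atoms.\<close>

lemma pv_step_by_atoms:
  assumes p: "step s p" and p0: "\<And>x. x \<in> space P \<Longrightarrow> 0 \<le> p x"
    and big: "\<And>x. x \<in> space P \<Longrightarrow> p x \<noteq> 0 \<Longrightarrow> lam < p x"
    and lam: "lam > 0" and S: "S > 0" "(\<integral>x. p x \<partial>P) \<le> 2 * S"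
    and V: "\<And>N a c. (\<And>k. k < N \<Longrightarrow> a k > 0) \<Longrightarrow> (\<And>k. k < N \<Longrightarrow> c k \<in> space P) \<Longrightarrow>
      (\<Sum>k<N. a k) \<le> 16 * S \<Longrightarrow> emeasure P (dirac_level lam N a c) \<le> V"
  shows "\<exists>E\<in>sets P. emeasure P E \<le> ennreal (6 * S / lam) + V \<and> (\<forall>x\<in>space P - E. \<bar>pv p x\<bar> \<le> 3 * lam / 16)"
proof -
  have s: "s > 0" by (rule step_pos[OF p])
  have pi: "integrable P p" by (rule step_integrable[OF p])
  let ?M = "supp_cells s p"
  have finM: "finite ?M" by (rule step_finite[OF p])
  have pc: "lam < p (corner s' m)" if "step s' p" "m \<in> supp_cells s' p" for s' m
    by (rule big[OF corner_in_space step_corner(1)[OF that]])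
  \<comment> \<open>The enlarged cubes have side s (1 + 1 / n), hence at most e \<le> 3 times the
    volume, while \<open>x\<close> keeps the distance \<open>t\<close> from the support.\<close>
  define t where "t = s / (2 * n)"
  have t: "t > 0" unfolding t_def using s n_pos by simp
  define enl where "enl m = Pi\<^sub>E {..<n} (\<lambda>i. {s * m i - t..s * (m i + 1) + t})" for m :: "nat \<Rightarrow> int"
  have enlS: "enl m \<in> sets P" for m unfolding enl_def by (rule sets_PiM_I_finite) auto
  have eenl: "emeasure P (enl m) \<le> ennreal (3 * s ^ n)" for m
  proof -
    have "emeasure P (enl m) = (\<Prod>i<n. emeasure lborel {s * m i - t..s * (m i + 1) + t})"
      unfolding enl_def by (subst lborel_product.emeasure_PiM) auto
    also have "\<dots> = (\<Prod>i<n. ennreal (s + 2 * t))"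
    proof (rule prod.cong[OF refl])
      fix i
      have d: "s * (m i + 1) + t - (s * m i - t) = s + 2 * t" by (simp add: algebra_simps)
      have "s * m i - t \<le> s * (m i + 1) + t" using d s t by linarith
      then show "emeasure lborel {s * m i - t..s * (m i + 1) + t} = ennreal (s + 2 * t)"
        using d by (simp only: emeasure_lborel_Icc)
    qed
    also have "\<dots> = ennreal ((s + 2 * t) ^ n)"
      using s t by (simp only: prod_constant card_lessThan ennreal_power)
    also have "(s + 2 * t) ^ n = s ^ n * (1 + 1 / n) ^ n"
      unfolding power_mult_distrib[symmetric] t_def using n_pos by (simp add: field_simps)
    also have "\<dots> \<le> s ^ n * exp 1"
    proof (rule mult_left_mono)
      have "(1 + 1 / n) ^ n \<le> exp (1 / real n) ^ n" using exp_ge_add_one_self[of "1 / real n"] by (intro power_mono) auto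
      also have "\<dots> = exp 1" using n_pos by (simp flip: exp_of_nat_mult)
      finally show "(1 + 1 / real n) ^ n \<le> exp 1" .
    qed (use s in simp)
    also have "\<dots> \<le> s ^ n * 3" using exp_le s by (intro mult_left_mono) auto
    finally show ?thesis by (simp add: mult.commute ennreal_leI)
  qed
  define D where "D = (\<Union>m\<in>?M. enl m)"
  have DS: "D \<in> sets P" unfolding D_def using finM enlS by (intro sets.finite_UN) auto
  have De: "emeasure P D \<le> ennreal (6 * S / lam)"
  proof -
    have "emeasure P D \<le> (\<Sum>m\<in>?M. emeasure P (enl m))" unfolding D_def using finM enlS by (intro emeasure_subadditive_finite) auto
    also have "\<dots> \<le> (\<Sum>m\<in>?M. ennreal (3 * s ^ n))" by (intro sum_mono eenl)
    also have "\<dots> = ennreal (\<Sum>m\<in>?M. 3 * s ^ n)" using s by (intro sum_ennreal) auto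
    also have "\<dots> \<le> ennreal (6 * S / lam)"
    proof (rule ennreal_leI)
      have "(\<Sum>m\<in>?M. 3 * s ^ n) \<le> (\<Sum>m\<in>?M. 3 / lam * (p (corner s m) * s ^ n))"
      proof (rule sum_mono)
        fix m assume m: "m \<in> ?M"
        have "3 / lam * (lam * s ^ n) \<le> 3 / lam * (p (corner s m) * s ^ n)"
          using pc[OF p m] lam s by (intro mult_left_mono mult_right_mono) auto
        then show "3 * s ^ n \<le> 3 / lam * (p (corner s m) * s ^ n)" using lam by simp
      qed
      also have "\<dots> = 3 / lam * (\<integral>x. p x \<partial>P)" unfolding step_integral[OF p] sum_distrib_left ..
      also have "\<dots> \<le> 3 / lam * (2 * S)" using S lam by (intro mult_left_mono) auto
      finally show "(\<Sum>m\<in>?M. 3 * s ^ n) \<le> 6 * S / lam" by simp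
    qed
    finally show ?thesis .
  qed
  have far: "t < edist x y" if x: "x \<in> space P" "x \<notin> D" and y: "y \<in> space P" "p y \<noteq> 0" for x y
  proof -
    let ?m = "cell s y"
    have m: "?m \<in> ?M" using y unfolding supp_cells_def by auto
    have yc: "y \<in> cube s ?m" using y(1) mem_cube_cell[OF s] by blast
    have "x \<notin> enl ?m" using x(2) m unfolding D_def by blast
    then obtain i where i: "i < n" "x i \<notin> {s * ?m i - t..s * (?m i + 1) + t}"
      using x(1) unfolding enl_def space_P PiE_iff by blast
    have "s * ?m i \<le> y i \<and> y i < s * (?m i + 1)" using yc i(1) unfolding cube_def by blast
    then have "t < \<bar>x i - y i\<bar>" using i(2) unfolding atLeastAtMost_iff by linarith
    also have "\<dots> \<le> edist x y" by (rule coord_le_edist[OF i(1)])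
    finally show ?thesis .
  qed
  let ?U = "1 + real (n + 1) * 4 ^ n"
  \<comment> \<open>\<open>G\<close> times the distance bound n s' within a cell bounds the Riemann
    sum error: variation of the kernel at distance more than \<open>t\<close>, times the mass of
    \<open>p\<close>.\<close>
  define G where "G = cn * ?U / t ^ (n + 1) * (2 * S)"
  have G0: "0 \<le> G" unfolding G_def using t S less_imp_le[OF cn_pos] by simp
  \<comment> \<open>The two terms of the maximum ensure 2 n s' \<le> t, as
    \<open>ker_diff_le\<close> requires, and a Riemann sum error of at most
    \<open>lam / 16\<close>.\<close>
  obtain K :: nat where K: "max (2 * n * s / t) (16 * G * n * s / lam) < real K" using reals_Archimedean2 by blast
  have "0 < 2 * n * s / t" using n_pos s t by simp
  then have K0: "real K > 0" using K by linarith
  define s' where "s' = s / real K"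
  have p': "step s' p" unfolding s'_def using K0 by (intro step_refine[OF p]) simp
  have s': "s' > 0" by (rule step_pos[OF p'])
  let ?\<delta> = "real n * s'"
  have \<delta>0: "?\<delta> > 0" using s' n_pos by simp
  have \<delta>1: "2 * ?\<delta> \<le> t"
  proof -
    have "2 * n * s / t < K" using K by simp
    then show ?thesis using t K0 unfolding s'_def by (simp add: field_simps)
  qed
  have \<delta>2: "G * ?\<delta> \<le> lam / 16"
  proof -
    have "16 * G * n * s / lam < K" using K by simp
    then show ?thesis using lam K0 unfolding s'_def by (simp add: field_simps)
  qed
  let ?M' = "supp_cells s' p" and ?c = "corner s'"
  have finM': "finite ?M'" by (rule step_finite[OF p'])
  obtain h where h: "bij_betw h {0..<card ?M'} ?M'" using ex_bij_betw_nat_finite[OF finM'] by blast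
  then have h: "bij_betw h {..<card ?M'} ?M'" by (simp only: atLeast0LessThan)
  define N where "N = card ?M'"
  \<comment> \<open>Eight times the mass of the cell: off the level set at height \<open>lam\<close>
    the Riemann sum itself is at most \<open>lam / 8\<close>, while the total weight is at most 8 *
    2 S.\<close>
  define a where "a k = 8 * (p (?c (h k)) * s' ^ n)" for k
  define c where "c k = ?c (h k)" for k
  have hM: "h k \<in> ?M'" if "k < N" for k using h that unfolding bij_betw_def N_def by auto
  have a0: "a k > 0" if "k < N" for k unfolding a_def using pc[OF p' hM[OF that]] lam s' by simp
  have cS: "c k \<in> space P" for k unfolding c_def by simp
  have asum: "(\<Sum>k<N. a k) \<le> 16 * S"
  proof -
    have "(\<Sum>k<N. a k) = (\<Sum>m\<in>?M'. 8 * (p (?c m) * s' ^ n))"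
      unfolding a_def N_def by (rule sum.reindex_bij_betw[OF h])
    also have "\<dots> = 8 * (\<integral>x. p x \<partial>P)" unfolding step_integral[OF p'] sum_distrib_left ..
    finally show ?thesis using S by simp
  qed
  define A where "A = dirac_level lam N a c"
  have AS: "A \<in> sets P" unfolding A_def by (rule sets_dirac_level[OF cS])
  have Ae: "emeasure P A \<le> V" unfolding A_def by (rule V[OF a0 cS asum])
  have bound: "\<bar>pv p x\<bar> \<le> 3 * lam / 16" if x: "x \<in> space P" "x \<notin> D" "x \<notin> A" for x
  proof -
    note [measurable] = x(1)
    \<comment> \<open>\<open>p\<close> vanishes within distance \<open>t\<close> of
      \<open>x\<close>, so truncating below \<open>t\<close> has no effect and the principal value
      is an ordinary integral.\<close>
    have tk: "tker \<epsilon> x y * p y = tker t x y * p y" if "0 < \<epsilon>" "\<epsilon> \<le> t" "y \<in> space P" for \<epsilon> y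
      using far[OF x(1,2) that(3)] that(1,2) by (cases "p y = 0") (auto simp: tker_def)
    have Rlx: "pv p x = trunc t p x"
    proof (rule pv_eventually_const(2)[OF t])
      fix \<epsilon> :: real assume "0 < \<epsilon>" "\<epsilon> \<le> t"
      then show "trunc \<epsilon> p x = trunc t p x" unfolding trunc_def by (intro Bochner_Integration.integral_cong[OF refl] tk)
    qed
    have ki: "integrable P (\<lambda>y. tker t x y * indicator (cube s' m) y)" for m
      by (rule integrable_kernel_mult(1)[OF integrable_indicator_cube[OF s'] x(1) t])
    let ?H = "cn * (?U * ?\<delta> / t ^ (n + 1))"
    have each: "\<bar>(\<integral>y. tker t x y * indicator (cube s' m) y \<partial>P) - s' ^ n * ker x (?c m)\<bar> \<le> ?H * s' ^ n" if m: "m \<in> ?M'" for m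
    proof -
      have ic: "integrable P (\<lambda>y. ker x (?c m) * indicator (cube s' m) y)"
        using integrable_indicator_cube[OF s'] by (intro integrable_mult_right) auto
      have "(\<integral>y. ker x (?c m) * indicator (cube s' m) y \<partial>P) = ker x (?c m) * measure P (cube s' m)"
        by simp
      also have "\<dots> = s' ^ n * ker x (?c m)" by (simp only: measure_cube[OF s'] mult.commute)
      finally have "\<bar>(\<integral>y. tker t x y * indicator (cube s' m) y \<partial>P) - s' ^ n * ker x (?c m)\<bar>
        = \<bar>\<integral>y. tker t x y * indicator (cube s' m) y - ker x (?c m) * indicator (cube s' m) y \<partial>P\<bar>"
        by (simp only: Bochner_Integration.integral_diff[OF ki ic])
      also have "\<dots> \<le> (\<integral>y. \<bar>tker t x y * indicator (cube s' m) y - ker x (?c m) * indicator (cube s' m) y\<bar> \<partial>P)"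
        by (rule integral_abs_bound)
      also have "\<dots> \<le> (\<integral>y. ?H * indicator (cube s' m) y \<partial>P)"
      proof (rule integral_mono)
        show "integrable P (\<lambda>y. \<bar>tker t x y * indicator (cube s' m) y - ker x (?c m) * indicator (cube s' m) y\<bar>)"
          using ki ic by (intro integrable_abs Bochner_Integration.integrable_diff)
        show "integrable P (\<lambda>y. ?H * indicator (cube s' m) y)"
          using integrable_indicator_cube[OF s'] by (intro integrable_mult_right) auto
        fix y assume y: "y \<in> space P"
        show "\<bar>tker t x y * indicator (cube s' m) y - ker x (?c m) * indicator (cube s' m) y\<bar> \<le> ?H * indicator (cube s' m) y"
        proof (cases "y \<in> cube s' m")
          case True
          have "p y \<noteq> 0" using step_corner[OF p' m] True by simp
          then have d: "t < edist x y" by (rule far[OF x(1,2) y])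
          have "\<bar>ker x y - ker x (?c m)\<bar> \<le> cn * (?U * ?\<delta> / edist x y ^ (n + 1))"
            using d \<delta>0 \<delta>1 t edist_corner_cube[OF s' True] by (intro ker_diff_le) auto
          also have "\<dots> \<le> ?H"
            using d t \<delta>0 less_imp_le[OF cn_pos]
            by (intro mult_left_mono divide_left_mono power_mono mult_pos_pos zero_less_power) auto
          finally show ?thesis using True d by (simp add: tker_def)
        next
          case False then show ?thesis by simp
        qed
      qed
      also have "\<dots> = ?H * s' ^ n" using s' by (simp add: measure_cube)
      finally show ?thesis .
    qed
    have pcn: "0 \<le> p (?c m)" for m by (rule p0) simp
    have "\<bar>trunc t p x - (\<Sum>m\<in>?M'. p (?c m) * s' ^ n * ker x (?c m))\<bar>
      = \<bar>\<Sum>m\<in>?M'. p (?c m) * ((\<integral>y. tker t x y * indicator (cube s' m) y \<partial>P) - s' ^ n * ker x (?c m))\<bar>"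
      unfolding trunc_def step_kernel_integral[OF p' ki] by (simp add: right_diff_distrib sum_subtractf mult.assoc)
    also have "\<dots> \<le> (\<Sum>m\<in>?M'. p (?c m) * (?H * s' ^ n))"
    proof (rule order_trans[OF sum_abs sum_mono])
      fix m assume "m \<in> ?M'"
      from mult_left_mono[OF each[OF this] pcn[of m]]
      show "\<bar>p (?c m) * ((\<integral>y. tker t x y * indicator (cube s' m) y \<partial>P) - s' ^ n * ker x (?c m))\<bar> \<le> p (?c m) * (?H * s' ^ n)"
        by (simp only: abs_mult abs_of_nonneg[OF pcn])
    qed
    also have "\<dots> = ?H * (\<integral>x. p x \<partial>P)"
      unfolding step_integral[OF p'] sum_distrib_left by (rule sum.cong) auto
    also have "\<dots> \<le> ?H * (2 * S)"
      using S t s' less_imp_le[OF cn_pos] by (intro mult_left_mono mult_nonneg_nonneg divide_nonneg_nonneg) auto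
    also have "\<dots> = G * ?\<delta>" unfolding G_def by simp
    also have "\<dots> \<le> lam / 16" by (rule \<delta>2)
    finally have close: "\<bar>trunc t p x - (\<Sum>m\<in>?M'. p (?c m) * s' ^ n * ker x (?c m))\<bar> \<le> lam / 16" .
    have "(\<Sum>k<N. a k * ker x (c k)) = (\<Sum>m\<in>?M'. 8 * (p (?c m) * s' ^ n) * ker x (?c m))"
      unfolding a_def c_def N_def by (rule sum.reindex_bij_betw[OF h, of "\<lambda>m. 8 * (p (?c m) * s' ^ n) * ker x (?c m)"])
    also have "\<dots> = 8 * (\<Sum>m\<in>?M'. p (?c m) * s' ^ n * ker x (?c m))"
      unfolding sum_distrib_left by (rule sum.cong) auto
    finally have dsum: "(\<Sum>k<N. a k * ker x (c k)) = 8 * (\<Sum>m\<in>?M'. p (?c m) * s' ^ n * ker x (?c m))" .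
    \<comment> \<open>The atoms lie where \<open>p\<close> is nonzero, hence at distance more than
      \<open>t\<close> from \<open>x\<close>. So \<open>x\<close> can be outside the level set only
      because the height is not exceeded.\<close>
    have "x \<noteq> c k" if "k < N" for k
    proof
      assume eq: "x = c k"
      have "p (c k) \<noteq> 0" unfolding c_def by (rule step_corner(1)[OF p' hM[OF that]])
      from far[OF x(1,2) cS this] show False using t unfolding eq by simp
    qed
    then have "\<bar>\<Sum>k<N. a k * ker x (c k)\<bar> \<le> lam" using x(1,3) unfolding A_def dirac_level_def by (auto simp: not_less)
    then show ?thesis using close unfolding dsum Rlx by linarith
  qed
  show ?thesis
  proof (intro bexI[of _ "D \<union> A"] conjI ballI)
    show "D \<union> A \<in> sets P" using DS AS by auto
    show "emeasure P (D \<union> A) \<le> ennreal (6 * S / lam) + V"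
      using emeasure_subadditive[OF DS AS] add_mono[OF De Ae] by (rule order_trans)
  qed (use bound in auto)
qed

lemma pv_main:
  assumes f: "integrable P f" and lam: "lam > 0" and S: "S = (\<integral>x. \<bar>f x\<bar> \<partial>P)"
    and V: "\<And>N a c. (\<And>k. k < N \<Longrightarrow> a k > 0) \<Longrightarrow> (\<And>k. k < N \<Longrightarrow> c k \<in> space P) \<Longrightarrow>
      (\<Sum>k<N. a k) \<le> 16 * S \<Longrightarrow> emeasure P (dirac_level lam N a c) \<le> V"
  shows "\<exists>E\<in>sets P. emeasure P E \<le> ennreal (15 + 512 * B0) * (ennreal (S / lam) + V) \<and> (\<forall>x\<in>space P - E. \<bar>pv f x\<bar> \<le> lam)"
proof (cases "S = 0")
  case True
  \<comment> \<open>For \<open>S = 0\<close> the approximation error \<open>e\<close> chosen below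
    would not be positive. Here \<open>f\<close> vanishes almost everywhere and all truncations are
    0.\<close>
  have "AE x in P. \<bar>f x\<bar> = 0"
    using f True unfolding S by (subst (asm) integral_nonneg_eq_0_iff_AE) auto
  then have z: "trunc \<epsilon> f x = 0" for \<epsilon> x
    unfolding trunc_def by (intro integral_eq_zero_AE) auto
  have "pv f x = 0" for x by (rule pv_eventually_const(2)[of 1]) (auto simp: z)
  then show ?thesis using lam by (intro bexI[of _ "{}"]) auto
next
  case False
  have S0: "S > 0" using False unfolding S by (simp add: less_le)
  have B0: "0 \<le> B0" unfolding B0_def by simp
  have B0S: "0 \<le> 512 * B0 * (S / lam)" and S6: "0 \<le> 6 * S / lam" and Sl: "0 \<le> S / lam" using S0 lam B0 by auto
  \<comment> \<open>\<open>e \<le> S\<close> gives \<open>F\<close> norm at most 2 S. The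
    denominator absorbs \<open>WT\<close>, so the exceptional set of \<open>f - F\<close> at height
    \<open>lam / 2\<close> has measure at most S / lam with no trace of the dimension.\<close>
  define e where "e = S / (2 * WT + 1)"
  have e: "e > 0" "e \<le> S" unfolding e_def using S0 WT_nonneg by (auto simp: pos_divide_le_eq mult_le_cancel_left1)
  obtain s F where F: "step s F" "(\<integral>x. \<bar>f x - F x\<bar> \<partial>P) < e" by (rule step_approximation[OF f e(1)])
  have Fi: "integrable P F" by (rule step_integrable[OF F(1)])
  have di: "integrable P (\<lambda>x. f x - F x)" using f Fi by simp
  have FS: "(\<integral>x. \<bar>F x\<bar> \<partial>P) \<le> 2 * S"
  proof -
    have "(\<integral>x. \<bar>F x\<bar> \<partial>P) \<le> (\<integral>x. \<bar>f x\<bar> + \<bar>f x - F x\<bar> \<partial>P)" using f Fi by (intro integral_mono) auto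
    also have "\<dots> = S + (\<integral>x. \<bar>f x - F x\<bar> \<partial>P)" using f Fi unfolding S by simp
    finally show ?thesis using F(2) e(2) by linarith
  qed
  obtain E1 where E1: "E1 \<in> sets P" "emeasure P E1 \<le> ennreal (WT / (lam / 2) * (\<integral>x. \<bar>f x - F x\<bar> \<partial>P))"
    "\<And>x \<epsilon>. x \<in> space P \<Longrightarrow> x \<notin> E1 \<Longrightarrow> \<epsilon> > 0 \<Longrightarrow> \<bar>trunc \<epsilon> (\<lambda>y. f y - F y) x\<bar> \<le> lam / 2"
    using truncation_weak_type[OF di, of "lam / 2"] lam by (auto simp: Ball_def)
  have E1e: "emeasure P E1 \<le> ennreal (S / lam)"
  proof (rule order_trans[OF E1(2)], rule ennreal_leI)
    have "WT / (lam / 2) * (\<integral>x. \<bar>f x - F x\<bar> \<partial>P) \<le> WT / (lam / 2) * e"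
      using F(2) WT_nonneg lam by (intro mult_left_mono) auto
    also have "\<dots> = (2 * WT / (2 * WT + 1)) * (S / lam)" unfolding e_def by (simp add: mult.commute)
    also have "\<dots> \<le> 1 * (S / lam)" using WT_nonneg Sl by (intro mult_right_mono) auto
    finally show "WT / (lam / 2) * (\<integral>x. \<bar>f x - F x\<bar> \<partial>P) \<le> S / lam" by simp
  qed
  define g where "g x = (if \<bar>F x\<bar> \<le> lam then F x else 0)" for x
  define p where "p x = (if F x > lam then F x else 0)" for x
  define m where "m x = (if F x < - lam then - F x else 0)" for x
  have g: "step s g" unfolding g_def by (rule step_comp[OF F(1), of "\<lambda>t. if \<bar>t\<bar> \<le> lam then t else 0"]) simp
  have p: "step s p" unfolding p_def by (rule step_comp[OF F(1), of "\<lambda>t. if t > lam then t else 0"]) simp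
  have m: "step s m" unfolding m_def by (rule step_comp[OF F(1), of "\<lambda>t. if t < - lam then - t else 0"]) simp
  have Fdec: "F x = g x + (p x - m x)" for x unfolding g_def p_def m_def using lam by auto
  have gi: "integrable P g" and pi: "integrable P p" and mi: "integrable P m"
    by (rule step_integrable[OF g], rule step_integrable[OF p], rule step_integrable[OF m])
  have g2i: "integrable P (\<lambda>x. (g x)\<^sup>2)" by (rule step_integrable[OF step_comp[OF g, of "\<lambda>t. t\<^sup>2"]]) simp
  have g2: "(\<integral>x. (g x)\<^sup>2 \<partial>P) \<le> lam * (2 * S)"
  proof -
    have "(\<integral>x. (g x)\<^sup>2 \<partial>P) \<le> (\<integral>x. lam * \<bar>F x\<bar> \<partial>P)"
    proof (rule integral_mono[OF g2i])
      show "integrable P (\<lambda>x. lam * \<bar>F x\<bar>)" using Fi by simp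
      fix x
      show "(g x)\<^sup>2 \<le> lam * \<bar>F x\<bar>"
      proof (cases "\<bar>F x\<bar> \<le> lam")
        case True
        have "(F x)\<^sup>2 = \<bar>F x\<bar> * \<bar>F x\<bar>" by (simp add: power2_eq_square)
        also have "\<dots> \<le> lam * \<bar>F x\<bar>" using True by (intro mult_right_mono) auto
        finally show ?thesis using True by (simp add: g_def)
      qed (use lam in \<open>simp add: g_def\<close>)
    qed
    also have "\<dots> = lam * (\<integral>x. \<bar>F x\<bar> \<partial>P)" by simp
    also have "\<dots> \<le> lam * (2 * S)" using FS lam by (intro mult_left_mono) auto
    finally show ?thesis .
  qed
  \<comment> \<open>Height \<open>lam / 8\<close> against a squared L^2 norm of at most 2 lam S
    gives the constant 4 * 2 * 64 = 512.\<close>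
  obtain E2 where E2: "E2 \<in> sets P" "emeasure P E2 \<le> ennreal (4 * B0 * (\<integral>x. (g x)\<^sup>2 \<partial>P) / (lam / 8)\<^sup>2)"
    "\<And>x. x \<in> space P \<Longrightarrow> x \<notin> E2 \<Longrightarrow> \<bar>pv g x\<bar> \<le> lam / 8"
    using pv_step_weak_L2[OF g, of "lam / 8"] lam by (auto simp: Ball_def)
  have E2e: "emeasure P E2 \<le> ennreal (512 * B0 * (S / lam))"
  proof (rule order_trans[OF E2(2)], rule ennreal_leI)
    have "4 * B0 * (\<integral>x. (g x)\<^sup>2 \<partial>P) / (lam / 8)\<^sup>2 \<le> 4 * B0 * (lam * (2 * S)) / (lam / 8)\<^sup>2"
      using g2 B0 by (intro divide_right_mono mult_left_mono) auto
    also have "\<dots> = 512 * B0 * (S / lam)" using lam by (simp add: power2_eq_square)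
    finally show "4 * B0 * (\<integral>x. (g x)\<^sup>2 \<partial>P) / (lam / 8)\<^sup>2 \<le> 512 * B0 * (S / lam)" .
  qed
  have pS: "(\<integral>x. p x \<partial>P) \<le> 2 * S"
  proof -
    have "(\<integral>x. p x \<partial>P) \<le> (\<integral>x. \<bar>F x\<bar> \<partial>P)"
      by (rule integral_mono[OF pi integrable_abs[OF Fi]]) (simp add: p_def abs_ge_self)
    then show ?thesis using FS by linarith
  qed
  have mS: "(\<integral>x. m x \<partial>P) \<le> 2 * S"
  proof -
    have "(\<integral>x. m x \<partial>P) \<le> (\<integral>x. \<bar>F x\<bar> \<partial>P)"
      by (rule integral_mono[OF mi integrable_abs[OF Fi]]) (simp add: m_def abs_ge_minus_self)
    then show ?thesis using FS by linarith
  qed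
  have "\<exists>E\<in>sets P. emeasure P E \<le> ennreal (6 * S / lam) + V \<and> (\<forall>x\<in>space P - E. \<bar>pv p x\<bar> \<le> 3 * lam / 16)"
    by (rule pv_step_by_atoms[OF p _ _ lam S0 pS V]) (use lam in \<open>auto simp: p_def split: if_splits\<close>)
  then obtain E3 where E3: "E3 \<in> sets P" "emeasure P E3 \<le> ennreal (6 * S / lam) + V"
    "\<And>x. x \<in> space P \<Longrightarrow> x \<notin> E3 \<Longrightarrow> \<bar>pv p x\<bar> \<le> 3 * lam / 16" by blast
  have "\<exists>E\<in>sets P. emeasure P E \<le> ennreal (6 * S / lam) + V \<and> (\<forall>x\<in>space P - E. \<bar>pv m x\<bar> \<le> 3 * lam / 16)"
    by (rule pv_step_by_atoms[OF m _ _ lam S0 mS V]) (use lam in \<open>auto simp: m_def split: if_splits\<close>)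
  then obtain E4 where E4: "E4 \<in> sets P" "emeasure P E4 \<le> ennreal (6 * S / lam) + V"
    "\<And>x. x \<in> space P \<Longrightarrow> x \<notin> E4 \<Longrightarrow> \<bar>pv m x\<bar> \<le> 3 * lam / 16" by blast
  have "AE x in P. (\<forall>i<n. x i / s \<notin> \<int>) \<and> ((\<lambda>\<epsilon>. trunc \<epsilon> f x) \<longlongrightarrow> pv f x) (at_right 0)"
    using AE_off_grid[OF step_pos[OF F(1)]] truncations_converge[OF f] by eventually_elim blast
  then obtain Z where Z: "Z \<in> null_sets P"
    "{x \<in> space P. \<not> ((\<forall>i<n. x i / s \<notin> \<int>) \<and> ((\<lambda>\<epsilon>. trunc \<epsilon> f x) \<longlongrightarrow> pv f x) (at_right 0))} \<subseteq> Z"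
    by (elim AE_E) (auto simp: null_sets_def)
  let ?E = "E1 \<union> E2 \<union> E3 \<union> E4"
  have Em: "?E \<in> sets P" using E1 E2 E3 E4 by auto
  have "emeasure P ?E \<le> emeasure P E1 + emeasure P E2 + emeasure P E3 + emeasure P E4"
    using E1(1) E2(1) E3(1) E4(1)
    by (intro order_trans[OF emeasure_subadditive] add_mono emeasure_subadditive order_refl) auto
  also have "\<dots> \<le> ennreal (S / lam) + ennreal (512 * B0 * (S / lam)) + (ennreal (6 * S / lam) + V) + (ennreal (6 * S / lam) + V)"
    by (intro add_mono E1e E2e E3(2) E4(2))
  \<comment> \<open>13 = 1 + 6 + 6 from \<open>E1\<close>, \<open>E3\<close> and \<open>E4\<close>,
    and \<open>V\<close> occurs twice; a common factor must exceed both 13 + 512 B0 and 2, and 15 +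
    512 B0 does.\<close>
  also have "\<dots> = ennreal ((13 + 512 * B0) * (S / lam)) + 2 * V"
  proof -
    have "ennreal ((13 + 512 * B0) * (S / lam)) = ennreal (S / lam + 512 * B0 * (S / lam) + 6 * S / lam + 6 * S / lam)"
      by (simp add: algebra_simps add_divide_distrib)
    also have "\<dots> = ennreal (S / lam) + ennreal (512 * B0 * (S / lam)) + ennreal (6 * S / lam) + ennreal (6 * S / lam)"
      using Sl B0S S6 by (simp only: ennreal_plus add_nonneg_nonneg)
    finally show ?thesis by (simp add: mult_2 add_ac)
  qed
  also have "\<dots> \<le> ennreal (15 + 512 * B0) * ennreal (S / lam) + ennreal (15 + 512 * B0) * V"
  proof (rule add_mono)
    have "ennreal ((13 + 512 * B0) * (S / lam)) \<le> ennreal ((15 + 512 * B0) * (S / lam))"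
      using Sl by (intro ennreal_leI mult_right_mono) auto
    then show "ennreal ((13 + 512 * B0) * (S / lam)) \<le> ennreal (15 + 512 * B0) * ennreal (S / lam)"
      using Sl B0 by (simp only: ennreal_mult add_nonneg_nonneg mult_nonneg_nonneg zero_le_numeral)
    have "2 = ennreal 2" by simp
    also have "\<dots> \<le> ennreal (15 + 512 * B0)" using B0 by (intro ennreal_leI) simp
    finally show "2 * V \<le> ennreal (15 + 512 * B0) * V" by (rule mult_right_mono) simp
  qed
  also have "\<dots> = ennreal (15 + 512 * B0) * (ennreal (S / lam) + V)" by (simp add: distrib_left)
  finally have Ee: "emeasure P ?E \<le> ennreal (15 + 512 * B0) * (ennreal (S / lam) + V)" .
  show ?thesis
  proof (intro bexI[of _ "?E \<union> Z"] conjI ballI)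
    show "?E \<union> Z \<in> sets P" using Em Z(1) by auto
    show "emeasure P (?E \<union> Z) \<le> ennreal (15 + 512 * B0) * (ennreal (S / lam) + V)"
      unfolding emeasure_Un_null_set[OF Em Z(1)] by (rule Ee)
    fix x assume x': "x \<in> space P - (?E \<union> Z)"
    then have x: "x \<in> space P" "x \<notin> E1" "x \<notin> E2" "x \<notin> E3" "x \<notin> E4" by auto
    have ng: "\<forall>i<n. x i / s \<notin> \<int>" and lf: "((\<lambda>\<epsilon>. trunc \<epsilon> f x) \<longlongrightarrow> pv f x) (at_right 0)"
      using x' Z(2) by auto
    note lF = step_pv(1)[OF F(1) x(1) ng] and lg = step_pv(1)[OF g x(1) ng] and lp = step_pv(1)[OF p x(1) ng] and lm = step_pv(1)[OF m x(1) ng]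
    have pos: "\<forall>\<^sub>F \<epsilon> in at_right (0::real). 0 < \<epsilon>" by (simp add: eventually_at_right_less)
    have "pv F x = pv g x + (pv p x - pv m x)"
    proof (rule tendsto_unique[OF trivial_limit_at_right_real lF])
      have "((\<lambda>\<epsilon>. trunc \<epsilon> g x + (trunc \<epsilon> p x - trunc \<epsilon> m x)) \<longlongrightarrow> pv g x + (pv p x - pv m x)) (at_right 0)"
        by (intro tendsto_intros lg lp lm)
      then show "((\<lambda>\<epsilon>. trunc \<epsilon> F x) \<longlongrightarrow> pv g x + (pv p x - pv m x)) (at_right 0)"
      proof (rule Lim_transform_eventually)
        show "\<forall>\<^sub>F \<epsilon> in at_right 0. trunc \<epsilon> g x + (trunc \<epsilon> p x - trunc \<epsilon> m x) = trunc \<epsilon> F x"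
          using pos
        proof eventually_elim
          case (elim \<epsilon>)
          have Feq: "F = (\<lambda>y. g y + (p y - m y))" by (rule ext) (rule Fdec)
          have "trunc \<epsilon> F x = trunc \<epsilon> (\<lambda>y. g y + (p y - m y)) x" by (rule arg_cong[OF Feq])
          also have "\<dots> = trunc \<epsilon> g x + trunc \<epsilon> (\<lambda>y. p y - m y) x" using gi pi mi x(1) elim by (intro trunc_add) auto
          also have "trunc \<epsilon> (\<lambda>y. p y - m y) x = trunc \<epsilon> p x - trunc \<epsilon> m x" by (rule trunc_diff[OF pi mi x(1) elim])
          finally show ?case by simp
        qed
      qed
    qed
    \<comment> \<open>lam / 8 + 3 lam / 16 + 3 lam / 16 = lam / 2.\<close>
    then have RF: "\<bar>pv F x\<bar> \<le> lam / 2"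
      using E2(3)[OF x(1,3)] E3(3)[OF x(1,4)] E4(3)[OF x(1,5)] by linarith
    have "\<bar>pv f x - pv F x\<bar> \<le> lam / 2"
    proof (rule tendsto_upperbound[OF tendsto_rabs[OF tendsto_diff[OF lf lF]]])
      show "\<forall>\<^sub>F \<epsilon> in at_right 0. \<bar>trunc \<epsilon> f x - trunc \<epsilon> F x\<bar> \<le> lam / 2"
        using pos
      proof eventually_elim
        case (elim \<epsilon>)
        show ?case using E1(3)[OF x(1,2) elim] trunc_diff[OF f Fi x(1) elim] by simp
      qed
    qed simp
    then show "\<bar>pv f x\<bar> \<le> lam" using RF by linarith
  qed
qed

end

section \<open>Transfer to the completed Lebesgue measure\<close>

theorem theorem1p1:
  shows "\<exists>C::real. C > 0 \<and>
    (\<forall>n::nat. n \<ge> 1 \<longrightarrow> (\<forall>j<n. \<forall>lam::real. lam > 0 \<longrightarrow>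
      (\<forall>f :: (nat \<Rightarrow> real) \<Rightarrow> real. integrable (Leb n) f \<longrightarrow>
        outer_measure_of (Leb n) {x \<in> space (Leb n). \<bar>riesz n j f x\<bar> > lam}
        \<le> ennreal C * (ennreal (L1_norm n f / lam) +
            (SUP \<nu> \<in> {(N, a, c). (\<forall>k<N. a k > 0 \<and> c k \<in> space (Leb n)) \<and>
                                   (\<Sum>k<N. a k) \<le> 16 * L1_norm n f}.
               (case \<nu> of (N, a, c) \<Rightarrow>
                 outer_measure_of (Leb n)
                   {x \<in> space (Leb n). (\<forall>k<N. x \<noteq> c k) \<and>
                                       \<bar>riesz_dirac n j N a c x\<bar> > lam}))))))"
proof (intro exI[of _ "15 + 512 * (8 * pi\<^sup>2 + 8 * pi ^ 4)"] conjI allI impI)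
  \<comment> \<open>The value of 15 + 512 B0 is written out because the constant is chosen before
    \<open>n\<close> and \<open>j\<close>, outside the locale.\<close>
  show "(0::real) < 15 + 512 * (8 * pi\<^sup>2 + 8 * pi ^ 4)" by (intro add_pos_nonneg) auto
  fix n j :: nat and lam :: real and f :: "(nat \<Rightarrow> real) \<Rightarrow> real"
  assume j: "j < n" and lam: "lam > 0" and f: "integrable (Leb n) f"
  interpret riesz_transform n j by standard (rule j)
  have Leb: "Leb n = completion P" by (simp add: Leb_def)
  have fm: "f \<in> borel_measurable (completion P)" using f unfolding Leb by simp
  obtain f' where f'm [measurable]: "f' \<in> borel_measurable P" and ff': "AE x in P. f x = f' x"
    using completion_ex_borel_measurable_real[OF fm] by blast
  have ffc: "AE x in completion P. f x = f' x" by (rule AE_completion[OF ff'])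
  have f'c: "f' \<in> borel_measurable (completion P)" by (rule measurable_completion[OF f'm])
  have f': "integrable P f'"
  proof -
    have "integrable (completion P) f'"
      using f unfolding Leb by (subst Bochner_Integration.integrable_cong_AE[OF f'c fm]) (use ffc in auto)
    then show ?thesis by (simp add: integrable_completion)
  qed
  have L1: "L1_norm n f = (\<integral>x. \<bar>f' x\<bar> \<partial>P)"
  proof -
    have "L1_norm n f = (\<integral>x. \<bar>f' x\<bar> \<partial>completion P)" unfolding L1_norm_def Leb
      by (rule integral_cong_AE) (use fm f'c ffc in \<open>auto intro: borel_measurable_abs\<close>)
    also have "\<dots> = (\<integral>x. \<bar>f' x\<bar> \<partial>P)" by (rule integral_completion) measurable
    finally show ?thesis .
  qed
  \<comment> \<open>\<open>f\<close> and its Borel version differ on a null set of \<open>y\<close>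
    only, so the truncations agree at every \<open>x\<close>, and with them the principal
    values.\<close>
  have tr: "riesz_trunc n j f \<epsilon> x = trunc \<epsilon> f' x" if x [measurable]: "x \<in> space P" for \<epsilon> x
  proof -
    have k: "indicator {y. eucl_norm n (\<lambda>i. x i - y i) \<ge> \<epsilon>} y * riesz_kernel n j (\<lambda>i. x i - y i) = tker \<epsilon> x y" for y
      by (simp add: tker_def ker_eq_riesz_kernel edist_def indicator_def)
    have km: "tker \<epsilon> x \<in> borel_measurable (completion P)" by (rule measurable_completion) measurable
    have "riesz_trunc n j f \<epsilon> x = (\<integral>y. tker \<epsilon> x y * f y \<partial>completion P)"
      unfolding riesz_trunc_def Leb k ..
    also have "\<dots> = (\<integral>y. tker \<epsilon> x y * f' y \<partial>completion P)"
      by (rule integral_cong_AE) (use fm f'c km ffc in auto)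
    also have "\<dots> = (\<integral>y. tker \<epsilon> x y * f' y \<partial>P)" by (rule integral_completion) measurable
    finally show ?thesis unfolding trunc_def .
  qed
  have rz: "riesz n j f x = pv f' x" if "x \<in> space P" for x
    unfolding riesz_def pv_def using tr[OF that] by simp
  define V where "V = (SUP \<nu> \<in> {(N, a, c). (\<forall>k<N. a k > 0 \<and> c k \<in> space (Leb n)) \<and> (\<Sum>k<N. a k) \<le> 16 * L1_norm n f}.
      (case \<nu> of (N, a, c) \<Rightarrow> outer_measure_of (Leb n)
         {x \<in> space (Leb n). (\<forall>k<N. x \<noteq> c k) \<and> \<bar>riesz_dirac n j N a c x\<bar> > lam}))"
  have V: "emeasure P (dirac_level lam N a c) \<le> V"
    if a: "\<And>k. k < N \<Longrightarrow> a k > 0" and c: "\<And>k. k < N \<Longrightarrow> c k \<in> space P" and as: "(\<Sum>k<N. a k) \<le> 16 * L1_norm n f" for N a c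
  proof -
    have DS: "dirac_level lam N a c \<in> sets P" by (rule sets_dirac_level[OF c])
    have eq: "{x \<in> space (Leb n). (\<forall>k<N. x \<noteq> c k) \<and> \<bar>riesz_dirac n j N a c x\<bar> > lam} = dirac_level lam N a c"
      unfolding dirac_level_def riesz_dirac_def ker_eq_riesz_kernel Leb by simp
    have "emeasure P (dirac_level lam N a c) = outer_measure_of (Leb n) (dirac_level lam N a c)"
      unfolding Leb using DS by simp
    also have "\<dots> \<le> V" unfolding V_def
    proof (rule SUP_upper2[of "(N, a, c)"])
      show "(N, a, c) \<in> {(N, a, c). (\<forall>k<N. a k > 0 \<and> c k \<in> space (Leb n)) \<and> (\<Sum>k<N. a k) \<le> 16 * L1_norm n f}"
        using a c as by (simp add: Leb)
    qed (simp only: prod.case eq order_refl)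
    finally show ?thesis .
  qed
  obtain E where E: "E \<in> sets P" "emeasure P E \<le> ennreal (15 + 512 * B0) * (ennreal (L1_norm n f / lam) + V)"
    "\<And>x. x \<in> space P \<Longrightarrow> x \<notin> E \<Longrightarrow> \<bar>pv f' x\<bar> \<le> lam"
    using pv_main[OF f' lam L1 V] by blast
  \<comment> \<open>The superlevel set is only enclosed in the measurable set \<open>E\<close>; for
    the outer measure this is enough.\<close>
  have "{x \<in> space (Leb n). \<bar>riesz n j f x\<bar> > lam} \<subseteq> E"
  proof
    fix x assume "x \<in> {x \<in> space (Leb n). \<bar>riesz n j f x\<bar> > lam}"
    then have "x \<in> space P" "lam < \<bar>pv f' x\<bar>" using rz by (auto simp: Leb)
    then show "x \<in> E" using E(3)[of x] by fastforce
  qed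
  then have "outer_measure_of (Leb n) {x \<in> space (Leb n). \<bar>riesz n j f x\<bar> > lam} \<le> outer_measure_of (Leb n) E"
    by (rule outer_measure_of_mono)
  also have "\<dots> = emeasure P E" unfolding Leb using E(1) by simp
  also note E(2)
  finally show "outer_measure_of (Leb n) {x \<in> space (Leb n). \<bar>riesz n j f x\<bar> > lam}
        \<le> ennreal (15 + 512 * (8 * pi\<^sup>2 + 8 * pi ^ 4)) * (ennreal (L1_norm n f / lam) +
            (SUP \<nu> \<in> {(N, a, c). (\<forall>k<N. a k > 0 \<and> c k \<in> space (Leb n)) \<and>
                                   (\<Sum>k<N. a k) \<le> 16 * L1_norm n f}.
               (case \<nu> of (N, a, c) \<Rightarrow>
                 outer_measure_of (Leb n)
                   {x \<in> space (Leb n). (\<forall>k<N. x \<noteq> c k) \<and>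
                                       \<bar>riesz_dirac n j N a c x\<bar> > lam})))"
    unfolding V_def B0_def .
qed

end
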